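(* Let $N\in\mathbb{N}$, $1<p\le N$, let $f:\mathbb{R}\to\mathbb{R}$ be continuous, and put $F(\xi)=\int_0^{\xi}f(t)\,dt$. Let $q:[0,1]\to\mathbb{R}$ be continuous and let $q_0>0$ be a constant. Assume that $f(0)=0$, $q(t)\ge q_0>0$ in $[0,1]$ and $\inf_{\xi\ge 0}F(\xi)\ge 0$. Moreover, suppose that there exist two sequences $\{a_k\}_{k\in\mathbb{N}}$ and $\{b_k\}_{k\in\mathbb{N}}$ in $]0,+\infty[$, with $a_k<b_k$ and $\lim_{k\to+\infty}b_k=0$, such that: (i) $\lim_{k\to+\infty}\frac{b_k}{a_k}=+\infty$; (ii) $\max_{[a_k,b_k]}f\le 0$ for all $k\in\mathbb{N}$; (iii) $$\frac{\sigma(p,q_0)}{p\left(\sup_{t\in(0,1)}\mathrm{dist}(t,\{0,1\})\right)^p}<\limsup_{\xi\to 0^+}\frac{F(\xi)}{\xi^p}<+\infty,\qquad\text{where}\quad \sigma(p,q_0)=\inf_{\mu\in]0,1[}\frac{1}{q_0\,\mu(1-\mu)^{p-1}}.$$ Then the problem $$(|v'(t)|^{p-2}v'(t))'+q(t)f(v(t))=0\ \text{ in }(0,1),\qquad v(0)=v(1)=0,$$ admits a sequence of non-negative weak solutions which strongly converges to $0$ in $W^{1,p}_0(0,1)$. Respectively, let $0<a<b$ and $\Omega_{a,b}=\{x\in\mathbb{R}^N: a<|x|<b\}$. If the assumptions above hold with $q=q_{a,b}$, the specific function attached to the annulus $\Omega_{a,b}$ that is defined in the context, then the problem $$-\Delta_p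 u=f(u)\ \text{ in }\Omega_{a,b},\qquad u=0\ \text{ on }\partial\Omega_{a,b},$$ admits a sequence of non-negative weak solutions which strongly converges to $0$ in $W^{1,p}_0(\Omega_{a,b})$.
   Context: Here $\Delta_p u=\mathrm{div}(|\nabla u|^{p-2}\nabla u)$. The space $W^{1,p}_0(0,1)$ is endowed with the norm $\|v\|=\left(\int_0^1|v'(t)|^p\,dt\right)^{1/p}$. A weak solution of the ODE problem is any $v\in W^{1,p}_0(0,1)$ such that $\int_0^1|v'(t)|^{p-2}v'(t)w'(t)\,dt-\int_0^1 q(t)f(v(t))w(t)\,dt=0$ for every $w\in W^{1,p}_0(0,1)$. Weak solutions of the problem in $\Omega_{a,b}$ are understood in the usual sense: $u\in W^{1,p}_0(\Omega_{a,b})$ with $\int_{\Omega_{a,b}}|\nabla u|^{p-2}\nabla u\cdot\nabla w\,dx=\int_{\Omega_{a,b}}f(u)w\,dx$ for test functions $w$. The function $q_{a,b}:[0,1]\to\mathbb{R}$ associated with the annulus $\Omega_{a,b}$ is defined as follows. If $1<p<N$, set $$A=\frac{(ab)^{\frac{N-p}{p-1}}}{b^{\frac{N-p}{p-1}}-a^{\frac{N-p}{p-1}}},\qquad B=\frac{b^{\frac{N-p}{p-1}}}{b^{\frac{N-p}{p-1}}-a^{\frac{N-p}{p-1}}},\qquad q_{a,b}(t)=\left(\frac{p-1}{N-p}\right)^{p}\frac{A^{\frac{(p-1)p}{N-p}}}{(B-t)^{\frac{p(N-1)}{N-p}}}.$$ If $p=N$, set $q_{a,b}(t)=\left[a\left(\frac{b}{a}\right)^t\ln\frac{b}{a}\right]^{p}$.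 In both cases $q_{a,b}$ is continuous and bounded between positive constants on $[0,1]$. The ODE problem with $q=q_{a,b}$ is obtained from the problem in the annulus by writing radial functions as $u(x)=v(t)$, where $t=-A|x|^{-(N-p)/(p-1)}+B$ when $p<N$, and $|x|=a(b/a)^t$ when $p=N$. *)

theory Defs
  imports "HOL-Analysis.Analysis"
begin

section \<open>Sobolev spaces on open subsets of a Euclidean space\<close>

text \<open>Functions are total; only their values on the open set \<open>\<Omega>\<close> (up to null sets) matter.
  The case of an interval is obtained by taking \<open>real\<close> as the Euclidean space: there
  \<open>Basis = {1}\<close>, the inner product is multiplication, and the weak gradient is the weak derivative.\<close>

primrec C_k :: "nat \<Rightarrow> ('a::euclidean_space \<Rightarrow> real) \<Rightarrow> bool" where
  "C_k 0 f \<longleftrightarrow> continuous_on UNIV f"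
| "C_k (Suc k) f \<longleftrightarrow> (\<forall>x. f differentiable (at x)) \<and>
     (\<forall>i\<in>Basis. C_k k (\<lambda>x. frechet_derivative f (at x) i))"

definition test_functions :: "'a::euclidean_space set \<Rightarrow> ('a \<Rightarrow> real) set" where
  "test_functions \<Omega> = {\<phi>. (\<forall>k. C_k k \<phi>) \<and>
     compact (closure {x. \<phi> x \<noteq> 0}) \<and> closure {x. \<phi> x \<noteq> 0} \<subseteq> \<Omega>}"

definition locally_integrable ::
  "'a::euclidean_space set \<Rightarrow> ('a \<Rightarrow> 'b::euclidean_space) \<Rightarrow> bool" where
  "locally_integrable \<Omega> g \<longleftrightarrow> (\<forall>K. compact K \<and> K \<subseteq> \<Omega> \<longrightarrow> integrable (lebesgue_on K) g)"

definition is_weak_gradient ::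
  "'a::euclidean_space set \<Rightarrow> ('a \<Rightarrow> real) \<Rightarrow> ('a \<Rightarrow> 'a) \<Rightarrow> bool" where
  "is_weak_gradient \<Omega> u g \<longleftrightarrow> locally_integrable \<Omega> u \<and> locally_integrable \<Omega> g \<and>
     (\<forall>\<phi>\<in>test_functions \<Omega>. \<forall>i\<in>Basis.
        (LINT x|lebesgue_on \<Omega>. u x * frechet_derivative \<phi> (at x) i) =
        - (LINT x|lebesgue_on \<Omega>. (g x \<bullet> i) * \<phi> x))"

text \<open>A weak gradient is unique up to null sets, and every notion below is insensitive to null
  sets, so any choice will do. The choice is only used where a weak gradient exists.\<close>

definition weak_gradient :: "'a::euclidean_space set \<Rightarrow> ('a \<Rightarrow> real) \<Rightarrow> 'a \<Rightarrow> 'a" where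
  "weak_gradient \<Omega> u = (SOME g. is_weak_gradient \<Omega> u g)"

definition Lp :: "real \<Rightarrow> 'a::euclidean_space set \<Rightarrow> ('a \<Rightarrow> 'b::euclidean_space) set" where
  "Lp p \<Omega> = {g. g \<in> borel_measurable (lebesgue_on \<Omega>) \<and>
     integrable (lebesgue_on \<Omega>) (\<lambda>x. norm (g x) powr p)}"

definition W1p :: "real \<Rightarrow> 'a::euclidean_space set \<Rightarrow> ('a \<Rightarrow> real) set" where
  "W1p p \<Omega> = {u \<in> Lp p \<Omega>. \<exists>g\<in>Lp p \<Omega>. is_weak_gradient \<Omega> u g}"

definition W1p_norm :: "real \<Rightarrow> 'a::euclidean_space set \<Rightarrow> ('a \<Rightarrow> real) \<Rightarrow> real" where
  "W1p_norm p \<Omega> u = ((LINT x|lebesgue_on \<Omega>. \<bar>u x\<bar> powr p) +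
     (LINT x|lebesgue_on \<Omega>. norm (weak_gradient \<Omega> u x) powr p)) powr (1 / p)"

definition W1p_0 :: "real \<Rightarrow> 'a::euclidean_space set \<Rightarrow> ('a \<Rightarrow> real) set" where
  "W1p_0 p \<Omega> = {u \<in> W1p p \<Omega>. \<exists>\<phi>. (\<forall>k::nat. \<phi> k \<in> test_functions \<Omega>) \<and>
     (\<lambda>k. W1p_norm p \<Omega> (\<lambda>x. u x - \<phi> k x)) \<longlonglongrightarrow> 0}"


section \<open>The two Dirichlet problems\<close>

text \<open>For \<open>1 < p < 2\<close> the factor \<open>norm 0 powr (p - 2)\<close> is \<open>0\<close>, so
  \<open>norm \<xi> powr (p - 2) *\<^sub>R \<xi>\<close> is the continuous vector field vanishing at the origin.\<close>

abbreviation weak_deriv01 :: "(real \<Rightarrow> real) \<Rightarrow> real \<Rightarrow> real" where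
  "weak_deriv01 \<equiv> weak_gradient {0<..<1}"

definition ode_norm :: "real \<Rightarrow> (real \<Rightarrow> real) \<Rightarrow> real" where
  "ode_norm p v = (LINT t|lebesgue_on {0<..<1}. \<bar>weak_deriv01 v t\<bar> powr p) powr (1 / p)"

definition ode_weak_solution ::
  "real \<Rightarrow> (real \<Rightarrow> real) \<Rightarrow> (real \<Rightarrow> real) \<Rightarrow> (real \<Rightarrow> real) \<Rightarrow> bool" where
  "ode_weak_solution p q f v \<longleftrightarrow> v \<in> W1p_0 p {0<..<1} \<and>
     (\<forall>w\<in>W1p_0 p {0<..<1}.
        (LINT t|lebesgue_on {0<..<1}.
           \<bar>weak_deriv01 v t\<bar> powr (p - 2) * weak_deriv01 v t * weak_deriv01 w t) -
        (LINT t|lebesgue_on {0<..<1}. q t * f (v t) * w t) = 0)"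

text \<open>Without growth conditions on \<open>f\<close> the product \<open>f(u) w\<close> need not be integrable in dimension
  at least two, and a non-integrable function would get integral \<open>0\<close>; hence integrability
  is part of the notion of a solution. (In the one-dimensional problem it is automatic, the
  elements of the Sobolev space being essentially bounded.)\<close>

definition p_laplace_weak_solution ::
  "real \<Rightarrow> 'a::euclidean_space set \<Rightarrow> (real \<Rightarrow> real) \<Rightarrow> ('a \<Rightarrow> real) \<Rightarrow> bool" where
  "p_laplace_weak_solution p \<Omega> f u \<longleftrightarrow> u \<in> W1p_0 p \<Omega> \<and>
     (\<forall>w\<in>W1p_0 p \<Omega>.
        integrable (lebesgue_on \<Omega>) (\<lambda>x. f (u x) * w x) \<and>
        (LINT x|lebesgue_on \<Omega>.
           (norm (weak_gradient \<Omega> u x) powr (p - 2) *\<^sub>R weak_gradient \<Omega> u x)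
             \<bullet> weak_gradient \<Omega> w x) =
        (LINT x|lebesgue_on \<Omega>. f (u x) * w x))"

definition annulus :: "real \<Rightarrow> real \<Rightarrow> 'a::euclidean_space set" where
  "annulus a b = {x. a < norm x \<and> norm x < b}"

definition annulus_weight :: "nat \<Rightarrow> real \<Rightarrow> real \<Rightarrow> real \<Rightarrow> real \<Rightarrow> real" where
  "annulus_weight N p a b t =
     (if p < real N then
        let \<alpha> = (real N - p) / (p - 1);
            A = (a * b) powr \<alpha> / (b powr \<alpha> - a powr \<alpha>);
            B = b powr \<alpha> / (b powr \<alpha> - a powr \<alpha>)
        in ((p - 1) / (real N - p)) powr p *
           (A powr ((p - 1) * p / (real N - p)) /
            (B - t) powr (p * (real N - 1) / (real N - p)))
      else (a * (b / a) powr t * ln (b / a)) powr p)"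


section \<open>Data of the nonlinearity\<close>

definition primitive :: "(real \<Rightarrow> real) \<Rightarrow> real \<Rightarrow> real" where
  "primitive f \<xi> = (LBINT t=0..ereal \<xi>. f t)"

definition sigma_const :: "real \<Rightarrow> real \<Rightarrow> real" where
  "sigma_const p q0 = (INF \<mu>\<in>{0<..<1}. 1 / (q0 * \<mu> * (1 - \<mu>) powr (p - 1)))"

end

theory Submission
  imports Defs "HOL-Complex_Analysis.Great_Picard" "HOL-Real_Asymp.Real_Asymp"
    "HOL-Computational_Algebra.Polynomial"
begin

text \<open>
  Pick \<open>\<alpha>\<close> small with \<open>f \<alpha> \<le> 0\<close>. On a grid with \<open>n\<close> cells the discretised energy has a minimiser over
  grid functions with values in \<open>[0, \<alpha>]\<close> that vanish at the end points. Since \<open>f 0 = 0\<close> and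
  \<open>f \<alpha> \<le> 0\<close>, the constraint creates no multiplier and the minimiser satisfies the discrete
  Euler-Lagrange equation; this bounds the discrete fluxes by the maximum of \<open>\<bar>q t * f y\<bar>\<close>. By
  Arzela-Ascoli a subsequence converges to a classical solution \<open>V\<close> with \<open>0 \<le> V \<le> \<alpha>\<close>. By the lower
  bound on the upper limit of \<open>F \<xi> / \<xi> powr p\<close> some trapezoidal function of height below \<open>\<alpha>\<close> has
  negative energy, so \<open>V\<close> is nonzero. As \<open>\<alpha>\<close> tends to \<open>0\<close> so do \<open>V\<close> and \<open>V'\<close>, uniformly.

  In the annulus \<open>u x = V (\<tau> \<bar>x\<bar>)\<close>, and the flux \<open>X = \<bar>\<nabla>u\<bar> powr (p - 2) * \<nabla>u\<close> is a continuously
  differentiable radial field with pointwise divergence \<open>- f u\<close>, so integration by parts against test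
  functions suffices; density extends the equation to the whole Sobolev space. In both problems the
  solution is a limit of test functions with bounded gradients converging pointwise.
\<close>

section \<open>Calculus of smooth functions\<close>

text \<open>Minimisation takes place on finite grids because there the admissible set is compact and
  the Euler-Lagrange equation is a computation in one variable at a time.

  The obstacle that shapes the rest is regularity: for p > 2 the equation degenerates where V' = 0,
  and V need not be twice differentiable. The unknown is therefore the pair of \<open>V\<close> and
  its flux \<open>R\<close>, with V' = \<open>spow (1 / (p - 1))\<close> R and R' = - q f(V), both
  right-hand sides being continuous. In the annulus, too, only the flux \<open>X\<close> is
  differentiated.

  The constant of hypothesis (iii): a trapezoid of height \<xi> with plateau length \<mu> and ramps
  of length l = (1 - \<mu>) / 2 has energy at most 2 l (\<xi> / l)^p / p - \<mu> q0 F(\<xi>), as q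
  \<ge> q0 and F \<ge> 0. This bound is negative iff F(\<xi>) / \<xi>^p exceeds 1 / (q0 \<mu> (1 -
  \<mu>)^(p - 1)) divided by p (1/2)^p. The infimum over \<mu> is \<open>sigma_const\<close>, and
  1/2 is the largest distance to the end points.

  The solutions are pairwise distinct because each new \<alpha> is chosen below a positive value of
  the preceding solution.\<close>

lemma C_k_SucI:
  assumes "\<And>x. (f has_derivative f' x) (at x)"
    and "\<And>i. i \<in> Basis \<Longrightarrow> C_k k (\<lambda>x. f' x i)"
  shows "C_k (Suc k) f"
proof -
  have "frechet_derivative f (at x) = f' x" for x
    using frechet_derivative_at[OF assms(1)] by simp
  then show ?thesis
    using assms by (auto simp: differentiable_def)
qed

lemma C_k_Suc_realI:
  fixes f :: "real \<Rightarrow> real"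
  assumes "\<And>x. (f has_real_derivative f' x) (at x)" and "C_k k f'"
  shows "C_k (Suc k) f"
  using assms by (intro C_k_SucI[where f' = "\<lambda>x h. f' x * h"])
    (auto simp: has_field_derivative_def)

lemma C_k_Suc_D:
  assumes "C_k (Suc k) f"
  shows "(f has_derivative frechet_derivative f (at x)) (at x)"
    and "i \<in> Basis \<Longrightarrow> C_k k (\<lambda>x. frechet_derivative f (at x) i)"
  using assms by (auto simp: frechet_derivative_works)

lemma C_k_SucD: "C_k (Suc k) f \<Longrightarrow> C_k k f"
proof (induction k arbitrary: f)
  case 0
  then show ?case
    by (auto simp: continuous_at_imp_continuous_on differentiable_imp_continuous_within)
next
  case (Suc k)
  then show ?case by (metis C_k.simps(2))
qed

lemma C_k_const: "C_k k (\<lambda>x. c)"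
proof (induction k arbitrary: c)
  case (Suc k)
  show ?case by (rule C_k_SucI[where f' = "\<lambda>x h. 0"]) (use Suc in auto)
qed auto

lemma C_k_bounded_linear: "bounded_linear f \<Longrightarrow> C_k k f"
proof (cases k)
  case 0
  then show "bounded_linear f \<Longrightarrow> C_k k f" by (simp add: linear_continuous_on)
next
  case (Suc n)
  show "bounded_linear f \<Longrightarrow> C_k k f"
    unfolding Suc by (rule C_k_SucI[where f' = "\<lambda>x. f"])
      (auto simp: bounded_linear_imp_has_derivative C_k_const)
qed

lemma C_k_add: "C_k k f \<Longrightarrow> C_k k g \<Longrightarrow> C_k k (\<lambda>x. f x + g x)"
proof (induction k arbitrary: f g)
  case 0
  then show ?case by (auto intro: continuous_intros)
next
  case (Suc k)
  show ?case
    by (rule C_k_SucI[OF has_derivative_add[OF C_k_Suc_D(1)[OF Suc.prems(1)] C_k_Suc_D(1)[OF Suc.prems(2)]]])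
      (intro Suc.IH C_k_Suc_D Suc.prems)
qed

lemma C_k_mult: "C_k k f \<Longrightarrow> C_k k g \<Longrightarrow> C_k k (\<lambda>x. f x * g x)"
proof (induction k arbitrary: f g)
  case 0
  then show ?case by (auto intro: continuous_intros)
next
  case (Suc k)
  show ?case
    by (rule C_k_SucI[OF has_derivative_mult[OF C_k_Suc_D(1)[OF Suc.prems(1)] C_k_Suc_D(1)[OF Suc.prems(2)]]])
      (intro C_k_add Suc.IH C_k_Suc_D Suc.prems C_k_SucD[OF Suc.prems(1)] C_k_SucD[OF Suc.prems(2)])
qed

lemma C_k_prod: "finite I \<Longrightarrow> (\<And>i. i \<in> I \<Longrightarrow> C_k k (f i)) \<Longrightarrow> C_k k (\<lambda>x. \<Prod>i\<in>I. f i x)"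
  by (induction I rule: finite_induct) (auto simp: C_k_const C_k_mult)

lemma C_k_sum: "finite I \<Longrightarrow> (\<And>i. i \<in> I \<Longrightarrow> C_k k (f i)) \<Longrightarrow> C_k k (\<lambda>x. \<Sum>i\<in>I. f i x)"
  by (induction I rule: finite_induct) (auto simp: C_k_const C_k_add)

text \<open>The outer function is real, so its Frechet derivative is multiplication by a number. A
  directional derivative is thus a composition of order \<open>k\<close> times a
  \<open>C_k k\<close> function, which is why \<open>f\<close> and \<open>g\<close> vary in the
  induction.\<close>

lemma C_k_compose:
  fixes g :: "real \<Rightarrow> real" and f :: "'a::euclidean_space \<Rightarrow> real"
  shows "C_k k g \<Longrightarrow> C_k k f \<Longrightarrow> C_k k (\<lambda>x. g (f x))"
proof (induction k arbitrary: f g)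
  case 0
  then show ?case by (auto intro: continuous_on_compose2)
next
  case (Suc k)
  have lin: "frechet_derivative g (at y) h = frechet_derivative g (at y) 1 * h" for y h
    using linear_scale[OF linear_frechet_derivative, of g "at y" h 1] Suc.prems(1) by simp
  show ?case
  proof (rule C_k_SucI)
    fix x
    show "((\<lambda>x. g (f x)) has_derivative
        (\<lambda>h. frechet_derivative g (at (f x)) 1 * frechet_derivative f (at x) h)) (at x)"
      unfolding lin[symmetric]
      by (rule has_derivative_compose[OF C_k_Suc_D(1)[OF Suc.prems(2)] C_k_Suc_D(1)[OF Suc.prems(1)]])
  next
    fix i :: 'a assume "i \<in> Basis"
    then show "C_k k (\<lambda>x. frechet_derivative g (at (f x)) 1 * frechet_derivative f (at x) i)"
      using C_k_mult[OF Suc.IH[OF C_k_Suc_D(2)[OF Suc.prems(1)] C_k_SucD[OF Suc.prems(2)]]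
          C_k_Suc_D(2)[OF Suc.prems(2)]] by simp
  qed
qed

lemma C_k_exp: "C_k k (exp :: real \<Rightarrow> real)"
proof (induction k)
  case (Suc k)
  show ?case by (rule C_k_Suc_realI[OF DERIV_exp Suc])
qed (auto intro: continuous_intros)

section \<open>A smooth function that is flat at the origin\<close>

lemma poly_times_exp_minus_tendsto_0:
  fixes p :: "real poly"
  shows "((\<lambda>z. z ^ n * poly p z * exp (- z)) \<longlongrightarrow> 0) at_top"
proof (induction p arbitrary: n)
  \<comment> \<open>The exponent \<open>n\<close> is free in the induction: splitting off the
    constant coefficient leaves a monomial and the claim for \<open>p\<close> with exponent
    \<open>Suc n\<close>.\<close>
  case (pCons a p)
  have "((\<lambda>z::real. a * (z ^ n / exp z)) \<longlongrightarrow> a * 0) at_top"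
    by (intro tendsto_intros tendsto_power_div_exp_0)
  from tendsto_add[OF this pCons.IH[of "Suc n"]]
  show ?case by (simp add: algebra_simps exp_minus divide_inverse)
qed auto

text \<open>All functions p(1/x) exp(-1/x) are treated at once: the derivative of a member is again
  a member, so the smoothness of the whole family is a single induction on the order.\<close>

definition flat_fun :: "real poly \<Rightarrow> real \<Rightarrow> real" where
  "flat_fun p x = (if x > 0 then poly p (1 / x) * exp (- (1 / x)) else 0)"

text \<open>In the variable z = 1/x the derivative acts as -z^2 d/dz and sends p(z) exp(-z) to z^2
  (p(z) - p'(z)) exp(-z); \<open>[:0, 0, 1:]\<close> is z^2. At the origin the difference quotient
  from the right is z p(z) exp(-z), which tends to 0 as z grows.\<close>

lemma flat_fun_has_derivative:
  "(flat_fun p has_real_derivative flat_fun ([:0, 0, 1:] * (p - pderiv p)) x) (at x)"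
proof -
  consider "x > 0" | "x < 0" | "x = 0" by linarith
  then show ?thesis
  proof cases
    case 1
    have "((\<lambda>x. poly p (1 / x) * exp (- (1 / x))) has_real_derivative
        flat_fun ([:0, 0, 1:] * (p - pderiv p)) x) (at x)"
      using 1 by (auto intro!: derivative_eq_intros DERIV_chain2[OF poly_DERIV]
          simp: flat_fun_def field_simps power2_eq_square)
    then show ?thesis
      by (rule DERIV_cong_ev[THEN iffD1, rotated -1])
        (use 1 eventually_nhds_in_open[of "{0<..}" x] in
          \<open>auto simp: flat_fun_def elim!: eventually_mono\<close>)
  next
    case 2
    have "((\<lambda>x. 0) has_real_derivative flat_fun ([:0, 0, 1:] * (p - pderiv p)) x) (at x)"
      using 2 by (auto simp: flat_fun_def)
    then show ?thesis
      by (rule DERIV_cong_ev[THEN iffD1, rotated -1])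
        (use 2 eventually_nhds_in_open[of "{..<0}" x] in
          \<open>auto simp: flat_fun_def elim!: eventually_mono\<close>)
  next
    case 3
    have "((\<lambda>h. flat_fun p h / h) \<longlongrightarrow> 0) (at_right 0)"
    proof -
      have "((\<lambda>h. (1/h) ^ 1 * poly p (1/h) * exp (- (1/h))) \<longlongrightarrow> 0) (at_right 0)"
        by (rule filterlim_compose[OF poly_times_exp_minus_tendsto_0]) real_asymp
      then show ?thesis
        by (rule Lim_transform_eventually)
          (auto simp: flat_fun_def eventually_at_right_field intro!: exI[of _ 1])
    qed
    moreover have "((\<lambda>h. flat_fun p h / h) \<longlongrightarrow> 0) (at_left 0)"
      by (rule tendsto_eventually)
        (auto simp: flat_fun_def eventually_at_left_field intro!: exI[of _ "-1"])
    ultimately have "((\<lambda>h. flat_fun p h / h) \<longlongrightarrow> 0) (at 0)"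
      by (simp add: filterlim_split_at)
    then show ?thesis
      using 3 by (simp add: DERIV_def flat_fun_def)
  qed
qed

lemma C_k_flat_fun: "C_k k (flat_fun p)"
proof (induction k arbitrary: p)
  case 0
  show ?case
    using DERIV_isCont[OF flat_fun_has_derivative] by (auto intro: continuous_at_imp_continuous_on)
next
  case (Suc k)
  show ?case by (rule C_k_Suc_realI[OF flat_fun_has_derivative Suc])
qed

definition flat_exp :: "real \<Rightarrow> real" where
  "flat_exp = flat_fun 1"

definition flat_exp' :: "real \<Rightarrow> real" where
  "flat_exp' = flat_fun [:0, 0, 1:]"

lemma flat_exp_deriv: "(flat_exp has_real_derivative flat_exp' x) (at x)"
  using flat_fun_has_derivative[of 1 x] by (simp add: flat_exp_def flat_exp'_def)

lemma C_k_flat_exp: "C_k k flat_exp"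
  by (simp add: flat_exp_def C_k_flat_fun)

lemma flat_exp_pos_iff: "flat_exp x > 0 \<longleftrightarrow> x > 0"
  by (simp add: flat_exp_def flat_fun_def)

lemma flat_exp_nonneg: "flat_exp x \<ge> 0"
  by (simp add: flat_exp_def flat_fun_def)

lemma flat_exp_le_1: "flat_exp x \<le> 1"
  by (simp add: flat_exp_def flat_fun_def)

lemma flat_exp_eq_0: "x \<le> 0 \<Longrightarrow> flat_exp x = 0"
  by (simp add: flat_exp_def flat_fun_def)

text \<open>Everything rests on exp z \<ge> 1 + z + z^2 / 2 at z = 1/x. The bound with weight
  \<open>x + 1\<close> is the one the cutoffs on an interval call for: their argument plus 1 equals
  the cutoff parameter times the distance to an end point.\<close>

lemma flat_exp'_bounds: "0 \<le> flat_exp' x" "flat_exp' x \<le> 2" "(x + 1) * flat_exp' x \<le> 2"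
proof -
  show "0 \<le> flat_exp' x"
    by (simp add: flat_exp'_def flat_fun_def)
  have *: "(z + z * z) * exp (- z) \<le> 2" "z * z * exp (- z) \<le> 2" if "z > 0" for z :: real
  proof -
    have "z + z * z \<le> 2 * exp z"
      using exp_lower_Taylor_quadratic[of z] that by (simp add: power2_eq_square)
    then show "(z + z * z) * exp (- z) \<le> 2"
      by (simp add: exp_minus field_simps)
    moreover have "z * z * exp (- z) \<le> (z + z * z) * exp (- z)"
      using that by simp
    ultimately show "z * z * exp (- z) \<le> 2" by linarith
  qed
  show "flat_exp' x \<le> 2"
    using *(2)[of "1/x"] by (simp add: flat_exp'_def flat_fun_def)
  show "(x + 1) * flat_exp' x \<le> 2"
  proof (cases "x > 0")
    case True
    then have "(x + 1) * flat_exp' x = (1/x + 1/x * (1/x)) * exp (- (1/x))"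
      by (simp add: flat_exp'_def flat_fun_def distrib_right add_divide_distrib)
    also have "\<dots> \<le> 2"
      using True by (intro *(1)) simp
    finally show ?thesis .
  qed (simp add: flat_exp'_def flat_fun_def)
qed

lemma flat_exp_tendsto: "(flat_exp \<longlongrightarrow> 1) at_top"
proof -
  have "((\<lambda>x::real. exp (- (1 / x))) \<longlongrightarrow> 1) at_top" by real_asymp
  then show ?thesis
    by (rule Lim_transform_eventually)
      (auto simp: flat_exp_def flat_fun_def eventually_at_top_dense intro!: exI[of _ 0])
qed

lemma flat_exp'_tendsto: "((\<lambda>x. (x + 1) * flat_exp' x) \<longlongrightarrow> 0) at_top"
proof -
  have "((\<lambda>x::real. (x + 1) * (1/x * (1/x) * exp (- (1 / x)))) \<longlongrightarrow> 0) at_top" by real_asymp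
  then show ?thesis
    by (rule Lim_transform_eventually)
      (auto simp: flat_exp'_def flat_fun_def eventually_at_top_dense intro!: exI[of _ 0])
qed

section \<open>Approximation by test functions on an interval\<close>

lemma C_k_real_polynomial_function: "real_polynomial_function p \<Longrightarrow> C_k k p"
  by (induction p rule: real_polynomial_function.induct)
    (auto intro: C_k_bounded_linear C_k_const C_k_add C_k_mult)

lemma polynomial_primitive:
  fixes p :: "real \<Rightarrow> real"
  assumes "real_polynomial_function p"
  obtains P where "\<And>x. (P has_real_derivative p x) (at x)" "P c = 0" "\<And>k. C_k k P"
proof -
  from real_polynomial_function_imp_sum[OF assms]
  obtain a and n :: nat where p: "p = (\<lambda>x. \<Sum>i\<le>n. a i * x ^ i)" by blast
  define Q where "Q x = (\<Sum>i\<le>n. a i / real (Suc i) * x ^ Suc i)" for x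
  have "((\<lambda>x. a i / real (Suc i) * x ^ Suc i) has_real_derivative a i * x ^ i) (at x)" for i x
    using DERIV_cmult[OF DERIV_pow[of "Suc i" x], of "a i / real (Suc i)"] by simp
  then have "(Q has_real_derivative p x) (at x)" for x
    unfolding Q_def[abs_def] p by (intro DERIV_sum)
  then have Q: "((\<lambda>x. Q x - Q c) has_real_derivative p x) (at x)" for x
    using DERIV_diff[OF _ DERIV_const, of Q "p x" x UNIV "Q c"] by simp
  show thesis
  proof (rule that[of "\<lambda>x. Q x - Q c"])
    show "C_k k (\<lambda>x. Q x - Q c)" for k
      by (rule C_k_SucD[OF C_k_Suc_realI[OF Q C_k_real_polynomial_function[OF assms]]])
  qed (use Q in auto)
qed

lemma abs_diff_le_of_deriv_bound:
  fixes g :: "real \<Rightarrow> real"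
  assumes "continuous_on {c..d} g"
    and "\<And>x. x \<in> {c<..<d} \<Longrightarrow> (g has_real_derivative g' x) (at x)"
    and "\<And>x. x \<in> {c<..<d} \<Longrightarrow> \<bar>g' x\<bar> \<le> B"
    and "c \<le> x" "x \<le> y" "y \<le> d"
  shows "\<bar>g y - g x\<bar> \<le> B * (y - x)"
proof (cases "x = y")
  case False
  then have xy: "x < y" using assms by simp
  obtain z where z: "x < z" "z < y" "g y - g x = g' z * (y - x)"
  proof (rule mvt[OF xy, of g "\<lambda>z h. g' z * h"])
    show "continuous_on {x..y} g"
      by (rule continuous_on_subset[OF assms(1)]) (use assms(4,6) in auto)
    show "(g has_derivative (*) (g' z)) (at z)" if "x < z" "z < y" for z
      using assms(2)[of z] assms(4,6) that by (simp add: has_field_derivative_def)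
  qed
  then have "\<bar>g' z\<bar> \<le> B" using assms(3)[of z] assms(4,6) by auto
  then show ?thesis
    unfolding z(3) using xy by (simp add: abs_mult mult.commute mult_right_mono)
qed simp

text \<open>Bounded pointwise convergence of functions and derivatives is what dominated convergence
  asks for, for all exponents at once. Weierstrass polynomials for \<open>D\<close>, integrated from
  \<open>c\<close>, give smooth functions close to \<open>V\<close>; a cutoff makes their supports
  compact.\<close>

lemma test_function_approx:
  fixes V D :: "real \<Rightarrow> real"
  assumes "c < d" and V: "continuous_on {c..d} V" and D: "continuous_on {c..d} D"
    and der: "\<And>x. x \<in> {c<..<d} \<Longrightarrow> (V has_real_derivative D x) (at x)"
    and zero: "V c = 0" "V d = 0"
  obtains W W' K where "\<And>j::nat. W j \<in> test_functions {c<..<d}"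
    and "\<And>j x. (W j has_real_derivative W' j x) (at x)"
    and "\<And>x. x \<in> {c<..<d} \<Longrightarrow> (\<lambda>j. W j x) \<longlonglongrightarrow> V x"
    and "\<And>x. x \<in> {c<..<d} \<Longrightarrow> (\<lambda>j. W' j x) \<longlonglongrightarrow> D x"
    and "\<And>j x. x \<in> {c<..<d} \<Longrightarrow> \<bar>W j x\<bar> \<le> K"
    and "\<And>j x. x \<in> {c<..<d} \<Longrightarrow> \<bar>W' j x\<bar> \<le> K"
proof -
  define L where "L = d - c"
  have L: "L > 0" using assms by (simp add: L_def)
  obtain M where M: "M \<ge> 0" "\<And>x. x \<in> {c..d} \<Longrightarrow> \<bar>D x\<bar> \<le> M"
  proof -
    obtain M where "\<forall>x\<in>{c..d}. norm (D x) \<le> M"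
      using compact_imp_bounded[OF compact_continuous_image[OF D compact_Icc]]
      by (auto simp: bounded_iff)
    then show ?thesis
      by (intro that[of "max M 0"]) fastforce+
  qed
  \<comment> \<open>Vanishing at both ends, \<open>V\<close> is dominated by a multiple of the
    distance to either end. This pays for the steep cutoff.\<close>
  have V1: "\<bar>V x\<bar> \<le> M * (x - c)" and V2: "\<bar>V x\<bar> \<le> M * (d - x)" if "x \<in> {c<..<d}" for x
    using abs_diff_le_of_deriv_bound[OF V der, of M c x]
      abs_diff_le_of_deriv_bound[OF V der, of M x d] M(2) that zero by auto
  define J where "J j = real j + 1" for j :: nat
  have J: "J j \<ge> 1" for j by (simp add: J_def)
  \<comment> \<open>The accuracy \<open>1 / (J j)\<^sup>2\<close> beats the cutoff slope of order
    \<open>J j\<close>: their product still tends to 0.\<close>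
  have "\<exists>P P'. (\<forall>k. C_k k P) \<and> (\<forall>x. (P has_real_derivative P' x) (at x)) \<and> P c = 0 \<and>
      (\<forall>x\<in>{c..d}. \<bar>P' x - D x\<bar> \<le> 1 / (J j)\<^sup>2)" for j
  proof -
    have "1 / (J j)\<^sup>2 > 0" using J[of j] by simp
    with Stone_Weierstrass_real_polynomial_function[OF compact_Icc D]
    obtain p where p: "real_polynomial_function p" "\<And>x. x \<in> {c..d} \<Longrightarrow> \<bar>D x - p x\<bar> < 1 / (J j)\<^sup>2"
      by metis
    from polynomial_primitive[OF p(1), of c] show ?thesis
      using p(2) by (metis abs_minus_commute less_imp_le)
  qed
  then obtain P P' where P: "\<And>j k. C_k k (P j)" "\<And>j x. (P j has_real_derivative P' j x) (at x)"
    "\<And>j. P j c = 0" "\<And>j x. x \<in> {c..d} \<Longrightarrow> \<bar>P' j x - D x\<bar> \<le> 1 / (J j)\<^sup>2"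
    by metis
  have P_cont: "continuous_on UNIV (P j)" for j
    using P(1)[of 0 j] by simp
  have PV: "\<bar>P j x - V x\<bar> \<le> L / (J j)\<^sup>2" if "x \<in> {c<..<d}" for j x
  proof -
    have "\<bar>(P j x - V x) - (P j c - V c)\<bar> \<le> 1 / (J j)\<^sup>2 * (x - c)"
      by (rule abs_diff_le_of_deriv_bound[where c=c and d=d and g' = "\<lambda>x. P' j x - D x"])
        (use that P(4) continuous_on_subset[OF P_cont subset_UNIV] in
          \<open>auto intro!: continuous_intros V DERIV_diff P(2) der\<close>)
    also have "\<dots> \<le> 1 / (J j)\<^sup>2 * L"
      using that by (intro mult_left_mono) (auto simp: L_def)
    finally show ?thesis using P(3) zero by simp
  qed
  \<comment> \<open>The cutoff \<open>h j\<close> has slope of order \<open>J j\<close> only within distance of order \<open>1 / J j\<close> from the end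
    points, where \<open>P j\<close> is of order \<open>1 / J j\<close>; hence the derivatives of \<open>h j * P j\<close> stay bounded.\<close>
  define u v where "u j x = J j * (x - c) - 1" and "v j x = J j * (d - x) - 1" for j x
  define h where "h j x = flat_exp (u j x) * flat_exp (v j x)" for j x
  define h' where "h' j x = J j * flat_exp' (u j x) * flat_exp (v j x)
      - J j * flat_exp' (v j x) * flat_exp (u j x)" for j x
  define W where "W j x = h j x * P j x" for j x
  define W' where "W' j x = h' j x * P j x + h j x * P' j x" for j x
  have h_deriv: "(h j has_real_derivative h' j x) (at x)" for j x
    unfolding h_def[abs_def] h'_def u_def v_def
    by (auto intro!: derivative_eq_intros DERIV_chain2[OF flat_exp_deriv])
  have W_deriv: "(W j has_real_derivative W' j x) (at x)" for j x
    unfolding W_def[abs_def] W'_def by (auto intro!: derivative_eq_intros h_deriv P(2))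
  have h_01: "0 \<le> h j x" "h j x \<le> 1" for j x
    unfolding h_def by (auto intro!: mult_nonneg_nonneg mult_le_one flat_exp_nonneg flat_exp_le_1)
  have C_W: "C_k k (W j)" for k j
  proof -
    have "C_k k (\<lambda>x. u j x)" "C_k k (\<lambda>x. v j x)"
      unfolding u_def v_def
      by (intro conjI C_k_real_polynomial_function real_polynomial_function_diff
          real_polynomial_function.intros(2,4) bounded_linear_ident[THEN real_polynomial_function.intros(1)])+
    then show ?thesis
      unfolding W_def[abs_def] h_def by (intro C_k_mult C_k_compose[OF C_k_flat_exp] P)
  qed
  have supp: "closure {x. W j x \<noteq> 0} \<subseteq> {c + 1 / J j..d - 1 / J j}" for j
  proof (rule closure_minimal)
    show "{x. W j x \<noteq> 0} \<subseteq> {c + 1 / J j..d - 1 / J j}"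
    proof
      fix x assume "x \<in> {x. W j x \<noteq> 0}"
      then have "u j x > 0" "v j x > 0"
        using flat_exp_eq_0 by (auto simp: W_def h_def not_le[symmetric])
      then show "x \<in> {c + 1 / J j..d - 1 / J j}"
        using J[of j] by (auto simp: u_def v_def field_simps)
    qed
  qed simp
  show thesis
  \<comment> \<open>\<open>M * L + L\<close> bounds \<open>W j\<close> and
    \<open>5 * M + 4 * L + 1\<close> bounds \<open>W' j\<close>; the sum serves both.\<close>
  proof (rule that[of W W' "M * L + L + 5 * M + 4 * L + 1"])
    show "W j \<in> test_functions {c<..<d}" for j
    proof -
      have "c < c + 1 / J j" "d - 1 / J j < d" using J[of j] by auto
      then have "{c + 1 / J j..d - 1 / J j} \<subseteq> {c<..<d}"
        unfolding subset_iff atLeastAtMost_iff greaterThanLessThan_iff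
        by (meson le_less_trans less_le_trans)
      with supp[of j] have "closure {x. W j x \<noteq> 0} \<subseteq> {c<..<d}" by (rule order_trans)
      moreover have "compact (closure {x. W j x \<noteq> 0})"
        using bounded_subset[OF compact_imp_bounded[OF compact_Icc] supp[of j]]
        by (simp add: compact_eq_bounded_closed)
      ultimately show ?thesis using C_W by (auto simp: test_functions_def)
    qed
  next
    show "(W j has_real_derivative W' j x) (at x)" for j x by (rule W_deriv)
  next
    fix x assume x: "x \<in> {c<..<d}"
    have J_lim: "filterlim J at_top sequentially"
      unfolding J_def by real_asymp
    have u_lim: "filterlim (\<lambda>j. u j x) at_top sequentially"
      unfolding u_def J_def using x by real_asymp
    have v_lim: "filterlim (\<lambda>j. v j x) at_top sequentially"
      unfolding v_def J_def using x by real_asymp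
    have h_lim: "(\<lambda>j. h j x) \<longlonglongrightarrow> 1"
      unfolding h_def using tendsto_mult[OF filterlim_compose[OF flat_exp_tendsto u_lim]
        filterlim_compose[OF flat_exp_tendsto v_lim]] by simp
    have e_lim: "(\<lambda>j. C / (J j)\<^sup>2) \<longlonglongrightarrow> 0" for C
      unfolding J_def by real_asymp
    have P_lim: "(\<lambda>j. P j x) \<longlonglongrightarrow> V x"
      by (rule LIM_zero_cancel, rule Lim_null_comparison[OF _ e_lim[of L]])
        (use PV x in auto)
    have P'_lim: "(\<lambda>j. P' j x) \<longlonglongrightarrow> D x"
      by (rule LIM_zero_cancel, rule Lim_null_comparison[OF _ e_lim[of 1]])
        (use P(4) x in auto)
    \<comment> \<open>\<open>J j\<close> equals both \<open>(u j x + 1) / (x - c)\<close> and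
      \<open>(v j x + 1) / (d - x)\<close>. In this form the growing factor of \<open>h' j x\<close>
      meets the weighted decay of \<open>flat_exp'\<close>.\<close>
    have "(\<lambda>j. (u j x + 1) * flat_exp' (u j x) / (x - c) * flat_exp (v j x)
        - (v j x + 1) * flat_exp' (v j x) / (d - x) * flat_exp (u j x)) \<longlonglongrightarrow> 0 / (x - c) * 1 - 0 / (d - x) * 1"
      by (intro tendsto_intros filterlim_compose[OF flat_exp_tendsto u_lim]
          filterlim_compose[OF flat_exp_tendsto v_lim]
          filterlim_compose[OF flat_exp'_tendsto u_lim] filterlim_compose[OF flat_exp'_tendsto v_lim])
        (use x in auto)
    moreover have "(u j x + 1) * flat_exp' (u j x) / (x - c) * flat_exp (v j x)
        - (v j x + 1) * flat_exp' (v j x) / (d - x) * flat_exp (u j x) = h' j x" for j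
      using x by (simp add: u_def v_def h'_def)
    ultimately have h'_lim: "(\<lambda>j. h' j x) \<longlonglongrightarrow> 0" by simp
    show "(\<lambda>j. W j x) \<longlonglongrightarrow> V x"
      unfolding W_def using tendsto_mult[OF h_lim P_lim] by simp
    show "(\<lambda>j. W' j x) \<longlonglongrightarrow> D x"
      unfolding W'_def
      using tendsto_add[OF tendsto_mult[OF h'_lim P_lim] tendsto_mult[OF h_lim P'_lim]] by simp
  next
    fix j x assume x: "x \<in> {c<..<d}"
    have J2: "1 / (J j)\<^sup>2 \<le> 1" "J j * (L / (J j)\<^sup>2) \<le> L"
      using J[of j] L mult_mono[of 1 "J j" 1 "J j"] by (auto simp: power2_eq_square field_simps)
    have Vx: "\<bar>V x\<bar> \<le> M * L"
      using V1[OF x] x M(1) mult_left_mono[of "x - c" L M] by (auto simp: L_def)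
    have Px: "\<bar>P j x\<bar> \<le> \<bar>V x\<bar> + L / (J j)\<^sup>2" using PV[OF x, of j] by linarith
    have "L / (J j)\<^sup>2 \<le> L" using mult_left_mono[OF J2(1), of L] L by simp
    then have "\<bar>P j x\<bar> \<le> M * L + L" using Px Vx by linarith
    moreover have "\<bar>W j x\<bar> \<le> 1 * \<bar>P j x\<bar>"
      unfolding W_def abs_mult using h_01[of j x] by (intro mult_right_mono) auto
    ultimately have "\<bar>W j x\<bar> \<le> M * L + L" by simp
    then show "\<bar>W j x\<bar> \<le> M * L + L + 5 * M + 4 * L + 1" using M L by simp
    have "\<bar>P' j x\<bar> \<le> M + 1" using P(4)[of x j] J2(1) M(2)[of x] x by force
    then have b3: "\<bar>h j x * P' j x\<bar> \<le> M + 1"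
      unfolding abs_mult using h_01[of j x] mult_mono[of "\<bar>h j x\<bar>" 1 "\<bar>P' j x\<bar>" "M + 1"] M by simp
    \<comment> \<open>\<open>s\<close> is the distance to an end point and \<open>y\<close> the
      cutoff argument there. In the bound M s + L / J^2 for |P| the first term turns J into J s = y
      + 1, which the weighted bound absorbs; the second one leaves L / J \<le> L.\<close>
    have aux: "\<bar>J j * flat_exp' y * flat_exp z * P j x\<bar> \<le> 2 * M + 2 * L"
      if "\<bar>V x\<bar> \<le> M * s" "J j * s = y + 1" for y z s
    proof -
      have "\<bar>J j * flat_exp' y * flat_exp z * P j x\<bar> = J j * flat_exp' y * flat_exp z * \<bar>P j x\<bar>"
        using J[of j] flat_exp'_bounds(1)[of y] flat_exp_nonneg[of z] by (simp add: abs_mult)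
      also have "\<dots> \<le> J j * flat_exp' y * 1 * (M * s + L / (J j)\<^sup>2)"
        using J[of j] flat_exp'_bounds(1)[of y] flat_exp_nonneg[of z] flat_exp_le_1 Px that(1)
        by (intro mult_mono) auto
      also have "\<dots> = M * ((y + 1) * flat_exp' y) + flat_exp' y * (J j * (L / (J j)\<^sup>2))"
        unfolding that(2)[symmetric] by (simp add: algebra_simps)
      also have "\<dots> \<le> M * 2 + 2 * L"
        using M(1) flat_exp'_bounds[of y] J2 L J[of j]
        by (intro add_mono mult_left_mono mult_mono) auto
      finally show ?thesis by simp
    qed
    have "\<bar>J j * flat_exp' (u j x) * flat_exp (v j x) * P j x\<bar> \<le> 2 * M + 2 * L"
      by (rule aux[OF V1[OF x]]) (simp add: u_def)
    moreover have "\<bar>J j * flat_exp' (v j x) * flat_exp (u j x) * P j x\<bar> \<le> 2 * M + 2 * L"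
      by (rule aux[OF V2[OF x]]) (simp add: v_def)
    ultimately have "\<bar>h' j x * P j x\<bar> \<le> 4 * M + 4 * L"
      unfolding h'_def left_diff_distrib by linarith
    with b3 have "\<bar>W' j x\<bar> \<le> 5 * M + 4 * L + 1"
      unfolding W'_def by linarith
    then show "\<bar>W' j x\<bar> \<le> M * L + L + 5 * M + 4 * L + 1"
      using mult_nonneg_nonneg[of M L] M(1) L by linarith
  qed
qed

section \<open>Integration by parts against test functions\<close>

text \<open>Translation invariance makes the integral of every difference quotient vanish, so no
  iterated integration is needed.\<close>

lemma integral_directional_derivative_eq_0:
  fixes \<psi> :: "'a::euclidean_space \<Rightarrow> real"
  assumes der: "\<And>x. (\<psi> has_derivative \<psi>' x) (at x)"
    and cont: "continuous_on UNIV (\<lambda>x. \<psi>' x e)"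
    and K: "compact K" and supp: "\<And>x. x \<notin> K \<Longrightarrow> \<psi> x = 0"
  shows "(\<integral>x. \<psi>' x e \<partial>lborel) = 0"
proof -
  \<comment> \<open>Enlarging \<open>K\<close> by \<open>norm e\<close> covers the supports of all
    translates by \<open>h n *\<^sub>R e\<close> with \<open>h n \<le> 1\<close>, so one integrable
    majorant serves for all difference quotients.\<close>
  define Q where "Q = {x + y | x y. x \<in> K \<and> y \<in> cball 0 (norm e)}"
  have Q: "compact Q"
    unfolding Q_def by (intro compact_sums K compact_cball)
  have \<psi>'0: "\<psi>' x e = 0" if "x \<notin> K" for x
  proof -
    have "open (- K)" using K by (simp add: compact_imp_closed open_Compl)
    then have "(\<psi> has_derivative (\<lambda>h. 0)) (at x)"
      by (rule has_derivative_transform_within_open[OF has_derivative_const[of 0]]) (use that supp in auto)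
    then show ?thesis using has_derivative_unique[OF der] by metis
  qed
  have cont_\<psi>: "continuous_on UNIV \<psi>"
    by (rule has_derivative_continuous_on) (use der in simp)
  have [measurable]: "\<psi> \<in> borel_measurable borel" "(\<lambda>x. \<psi>' x e) \<in> borel_measurable borel"
    using cont_\<psi> cont by (auto intro: borel_measurable_continuous_onI)
  have int_\<psi>: "integrable lborel \<psi>"
  proof -
    have "(\<lambda>x. indicator K x *\<^sub>R \<psi> x) = \<psi>" using supp by (auto simp: indicator_def fun_eq_iff)
    with borel_integrable_compact[OF K continuous_on_subset[OF cont_\<psi> subset_UNIV]]
    show ?thesis by metis
  qed
  obtain B where B: "B \<ge> 0" "\<And>x. \<bar>\<psi>' x e\<bar> \<le> B"
  proof -
    obtain B where B: "\<forall>x\<in>K. norm (\<psi>' x e) \<le> B"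
      using compact_imp_bounded[OF compact_continuous_image[OF continuous_on_subset[OF cont subset_UNIV] K]]
      by (auto simp: bounded_iff)
    show ?thesis
    proof (rule that[of "max B 0"])
      show "\<bar>\<psi>' x e\<bar> \<le> max B 0" for x
        using B \<psi>'0[of x] by (cases "x \<in> K") fastforce+
    qed simp
  qed
  define h where "h n = 1 / (real n + 1)" for n :: nat
  have h: "0 < h n" "h n \<le> 1" for n by (auto simp: h_def)
  have h_lim: "h \<longlonglongrightarrow> 0" unfolding h_def by real_asymp
  have line: "((\<lambda>s. \<psi> (x + s *\<^sub>R e)) has_real_derivative \<psi>' (x + s *\<^sub>R e) e) (at s)" for x s
  proof -
    have "((\<lambda>s. \<psi> (x + s *\<^sub>R e)) has_derivative (\<lambda>t. \<psi>' (x + s *\<^sub>R e) (t *\<^sub>R e))) (at s)"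
      by (rule has_derivative_compose[OF _ der]) (auto intro!: derivative_eq_intros)
    moreover have "\<psi>' (x + s *\<^sub>R e) (t *\<^sub>R e) = \<psi>' (x + s *\<^sub>R e) e * t" for t
      using linear_scale[OF has_derivative_linear[OF der]] by simp
    ultimately show ?thesis by (simp add: has_field_derivative_def)
  qed
  define g where "g n x = (\<psi> (h n *\<^sub>R e + x) - \<psi> x) / h n" for n x
  have "(\<lambda>n. \<integral>x. g n x \<partial>lborel) \<longlonglongrightarrow> (\<integral>x. \<psi>' x e \<partial>lborel)"
  proof (rule integral_dominated_convergence[where w = "\<lambda>x. B * indicator Q x"])
    show "integrable lborel (\<lambda>x. B * indicator Q x)"
      using emeasure_bounded_finite[OF compact_imp_bounded[OF Q]] compact_imp_closed[OF Q] 
      by (intro integrable_mult_right integrable_real_indicator) auto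
    show "AE x in lborel. (\<lambda>n. g n x) \<longlonglongrightarrow> \<psi>' x e"
    proof (rule AE_I2)
      fix x
      have "((\<lambda>s. (\<psi> (x + s *\<^sub>R e) - \<psi> x) / s) \<longlongrightarrow> \<psi>' x e) (at 0)"
        using line[of x 0] by (simp add: DERIV_def)
      moreover have "filterlim h (at 0) sequentially"
        using h_lim h by (auto simp: filterlim_at intro!: always_eventually)  (metis less_irrefl)
      ultimately show "(\<lambda>n. g n x) \<longlonglongrightarrow> \<psi>' x e"
        unfolding g_def add.commute[of _ x] by (rule filterlim_compose)
    qed
    show "AE x in lborel. norm (g n x) \<le> B * indicator Q x" for n
    proof (rule AE_I2)
      fix x
      have "\<bar>\<psi> (x + h n *\<^sub>R e) - \<psi> (x + 0 *\<^sub>R e)\<bar> \<le> B * (h n - 0)"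
        by (rule abs_diff_le_of_deriv_bound[where c = 0 and d = "h n"])
          (use h[of n] line B DERIV_isCont[OF line] in \<open>auto intro: continuous_at_imp_continuous_on\<close>)
      then have b: "\<bar>g n x\<bar> \<le> B"
        using h[of n] by (simp add: g_def abs_div field_simps)
      have "g n x = 0" if "x \<notin> Q"
      proof -
        have "x \<notin> K" using that by (force simp: Q_def)
        moreover have "h n *\<^sub>R e + x \<notin> K"
        proof
          assume "h n *\<^sub>R e + x \<in> K"
          moreover have "- (h n *\<^sub>R e) \<in> cball 0 (norm e)"
            using h[of n] by (simp add: mult_left_le_one_le)
          moreover have "x = (h n *\<^sub>R e + x) + (- (h n *\<^sub>R e))" by simp
          ultimately show False using that unfolding Q_def by blast
        qed
        ultimately show ?thesis by (simp add: g_def supp)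
      qed
      with b show "norm (g n x) \<le> B * indicator Q x" by (auto simp: indicator_def)
    qed
  qed (auto simp: g_def)
  moreover have "(\<integral>x. g n x \<partial>lborel) = 0" for n
  proof -
    have "integrable lborel (\<lambda>x. \<psi> (h n *\<^sub>R e + x))" "(\<integral>x. \<psi> (h n *\<^sub>R e + x) \<partial>lborel) = (\<integral>x. \<psi> x \<partial>lborel)"
      using integrable_distr_eq[of "(+) (h n *\<^sub>R e)" lborel borel \<psi>]
        integral_distr[of "(+) (h n *\<^sub>R e)" lborel borel \<psi>] int_\<psi> by (auto simp: lborel_distr_plus)
    then show ?thesis using int_\<psi> by (simp add: g_def)
  qed
  ultimately show ?thesis
    by (simp add: LIMSEQ_const_iff)
qed

text \<open>The open sets \<open>\<Omega>\<close> and \<open>- K\<close> cover the space; on the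
  first the extension is \<open>f\<close>, on the second it is 0.\<close>

lemma zero_extension_continuous:
  fixes f :: "'a::topological_space \<Rightarrow> 'b::{topological_space,zero}"
  assumes "open \<Omega>" "closed K" "K \<subseteq> \<Omega>" "continuous_on \<Omega> f" "\<And>x. x \<in> \<Omega> - K \<Longrightarrow> f x = 0"
  shows "continuous_on UNIV (\<lambda>x. if x \<in> \<Omega> then f x else 0)"
proof -
  let ?g = "\<lambda>x. if x \<in> \<Omega> then f x else 0"
  have "continuous_on \<Omega> ?g"
    by (rule continuous_on_cong[THEN iffD2, OF refl _ assms(4)]) simp
  moreover have "continuous_on (- K) ?g"
    by (rule continuous_on_cong[THEN iffD2, OF refl _ continuous_on_const[of _ 0]]) (use assms(5) in auto)
  ultimately have "continuous_on (\<Omega> \<union> - K) ?g"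
    using assms(1,2) by (intro continuous_on_open_Un) auto
  moreover have "\<Omega> \<union> - K = UNIV" using assms(3) by auto
  ultimately show ?thesis by simp
qed

text \<open>Links integrals over \<open>\<Omega>\<close> with respect to Lebesgue measure to
  integrals over the whole space with respect to \<open>lborel\<close>, where the translation
  argument applies.\<close>

lemma integral_compact_support:
  fixes f :: "'a::euclidean_space \<Rightarrow> real"
  assumes "open \<Omega>" "compact K" "K \<subseteq> \<Omega>" "continuous_on \<Omega> f" "\<And>x. x \<in> \<Omega> - K \<Longrightarrow> f x = 0"
  shows "integrable lborel (\<lambda>x. if x \<in> \<Omega> then f x else 0)"
    and "integrable (lebesgue_on \<Omega>) f"
    and "(LINT x|lebesgue_on \<Omega>. f x) = (\<integral>x. (if x \<in> \<Omega> then f x else 0) \<partial>lborel)"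
proof -
  let ?g = "\<lambda>x. if x \<in> \<Omega> then f x else 0"
  have c: "continuous_on UNIV ?g"
    using assms by (intro zero_extension_continuous[of \<Omega> K]) (auto intro: compact_imp_closed)
  have "(\<lambda>x. indicator K x *\<^sub>R ?g x) = ?g" using assms(3,5) by (auto simp: indicator_def fun_eq_iff)
  with borel_integrable_compact[OF assms(2) continuous_on_subset[OF c subset_UNIV]]
  show i: "integrable lborel ?g" by metis
  have m: "?g \<in> borel_measurable lborel" using i by auto
  have s: "\<Omega> \<in> sets lebesgue" using assms(1) by auto
  show "integrable (lebesgue_on \<Omega>) f"
    using i integrable_completion[OF m] Lebesgue_Measure.integrable_restrict_UNIV[OF s, of f] by blast
  show "(LINT x|lebesgue_on \<Omega>. f x) = (\<integral>x. ?g x \<partial>lborel)"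
    using integral_completion[OF m] Lebesgue_Measure.integral_restrict_UNIV[OF s, of f] by simp
qed

lemma test_functionsD:
  assumes "\<phi> \<in> test_functions \<Omega>"
  shows "(\<phi> has_derivative frechet_derivative \<phi> (at x)) (at x)"
    and "continuous_on UNIV \<phi>"
    and "i \<in> Basis \<Longrightarrow> continuous_on UNIV (\<lambda>x. frechet_derivative \<phi> (at x) i)"
proof -
  have C: "C_k k \<phi>" for k using assms by (simp add: test_functions_def)
  show "(\<phi> has_derivative frechet_derivative \<phi> (at x)) (at x)"
    by (rule C_k_Suc_D(1)[OF C])
  show "continuous_on UNIV \<phi>" using C[of 0] by simp
  show "i \<in> Basis \<Longrightarrow> continuous_on UNIV (\<lambda>x. frechet_derivative \<phi> (at x) i)"
    using C_k_Suc_D(2)[OF C[of "Suc 0"]] by simp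
qed

lemma test_functions_support:
  assumes "\<phi> \<in> test_functions \<Omega>"
  obtains K where "compact K" "K \<subseteq> \<Omega>" "\<And>x. x \<notin> K \<Longrightarrow> \<phi> x = 0"
    "\<And>x h. x \<notin> K \<Longrightarrow> frechet_derivative \<phi> (at x) h = 0"
proof -
  define K where "K = closure {x. \<phi> x \<noteq> 0}"
  have z: "\<phi> x = 0" if "x \<notin> K" for x
    using that closure_subset[of "{x. \<phi> x \<noteq> 0}"] unfolding K_def by blast
  have K: "compact K" "K \<subseteq> \<Omega>"
    using assms by (auto simp: test_functions_def K_def)
  show thesis
  proof (rule that[OF K z])
    show "frechet_derivative \<phi> (at x) h = 0" if "x \<notin> K" for x h
    proof -
      have "open (- K)" using K by (simp add: compact_imp_closed open_Compl)
      then have "(\<phi> has_derivative (\<lambda>h. 0)) (at x)"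
        by (rule has_derivative_transform_within_open[OF has_derivative_const[of 0]]) (use that z in auto)
      then show ?thesis
        using has_derivative_unique[OF test_functionsD(1)[OF assms]] by metis
    qed
  qed
qed

text \<open>\<open>X\<close> is controlled only inside \<open>\<Omega>\<close>, but X \<phi>
  extended by 0 is differentiable everywhere, as the support of \<open>\<phi>\<close> is a compact
  part of \<open>\<Omega>\<close>. The integral of its derivative in the direction \<open>e\<close>
  vanishes, and the product rule splits it into the two sides.\<close>

lemma integral_by_parts_test_function:
  fixes X :: "'a::euclidean_space \<Rightarrow> real"
  assumes "open \<Omega>" and X: "\<And>x. x \<in> \<Omega> \<Longrightarrow> (X has_derivative X' x) (at x)"
    and X': "continuous_on \<Omega> (\<lambda>x. X' x e)" and \<phi>: "\<phi> \<in> test_functions \<Omega>" and e: "e \<in> Basis"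
  shows "integrable (lebesgue_on \<Omega>) (\<lambda>x. X x * frechet_derivative \<phi> (at x) e)"
    and "integrable (lebesgue_on \<Omega>) (\<lambda>x. X' x e * \<phi> x)"
    and "(LINT x|lebesgue_on \<Omega>. X x * frechet_derivative \<phi> (at x) e) =
      - (LINT x|lebesgue_on \<Omega>. X' x e * \<phi> x)"
proof -
  note T = test_functionsD[OF \<phi>]
  obtain K where K: "compact K" "K \<subseteq> \<Omega>" "\<And>x. x \<notin> K \<Longrightarrow> \<phi> x = 0"
    "\<And>x h. x \<notin> K \<Longrightarrow> frechet_derivative \<phi> (at x) h = 0"
    by (rule test_functions_support[OF \<phi>]) metis
  have contX: "continuous_on \<Omega> X"
    by (rule has_derivative_continuous_on) (use X in \<open>auto intro: has_derivative_at_withinI\<close>)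
  have 1: "continuous_on \<Omega> (\<lambda>x. X x * frechet_derivative \<phi> (at x) e)"
    by (intro continuous_intros contX continuous_on_subset[OF T(3)[OF e]]) auto
  have 2: "continuous_on \<Omega> (\<lambda>x. X' x e * \<phi> x)"
    by (intro continuous_intros X' continuous_on_subset[OF T(2)]) auto
  have z1: "X x * frechet_derivative \<phi> (at x) e = 0" and z2: "X' x e * \<phi> x = 0" if "x \<in> \<Omega> - K" for x
    using that K(3,4) by auto
  note I1 = integral_compact_support[OF assms(1) K(1,2) 1 z1, simplified]
  note I2 = integral_compact_support[OF assms(1) K(1,2) 2 z2, simplified]
  show "integrable (lebesgue_on \<Omega>) (\<lambda>x. X x * frechet_derivative \<phi> (at x) e)"
    by (rule I1(2))
  show "integrable (lebesgue_on \<Omega>) (\<lambda>x. X' x e * \<phi> x)"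
    by (rule I2(2))
  \<comment> \<open>The product rule term by term, each term extended by 0 on its own, so that each
    matches one of the integrals over \<open>\<Omega>\<close>.\<close>
  define \<psi>' where "\<psi>' x h = (if x \<in> \<Omega> then X x * frechet_derivative \<phi> (at x) h else 0) +
      (if x \<in> \<Omega> then X' x h * \<phi> x else 0)" for x h
  have "(\<integral>x. \<psi>' x e \<partial>lborel) = 0"
  proof (rule integral_directional_derivative_eq_0[OF _ _ K(1)])
    show "((\<lambda>x. if x \<in> \<Omega> then X x * \<phi> x else 0) has_derivative \<psi>' x) (at x)" for x
    proof (cases "x \<in> \<Omega>")
      case True
      have "((\<lambda>x. X x * \<phi> x) has_derivative \<psi>' x) (at x)"
        using has_derivative_mult[OF X[OF True] T(1)] True by (simp add: \<psi>'_def[abs_def])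
      then show ?thesis
        by (rule has_derivative_transform_within_open[OF _ assms(1) True]) auto
    next
      case False
      then have x: "x \<in> - K" using K(2) by auto
      have "\<psi>' x = (\<lambda>h. 0)" using False by (simp add: \<psi>'_def[abs_def])
      have "open (- K)" using K by (simp add: compact_imp_closed open_Compl)
      then show ?thesis
        unfolding \<open>\<psi>' x = (\<lambda>h. 0)\<close>
        by (rule has_derivative_transform_within_open[OF has_derivative_const[of 0] _ x]) (use K(3) in auto)
    qed
    show "continuous_on UNIV (\<lambda>x. \<psi>' x e)"
      unfolding \<psi>'_def using K(3,4) compact_imp_closed[OF K(1)]
      by (intro continuous_on_add zero_extension_continuous[OF assms(1) _ K(2)] 1 2) auto
  qed (use K(3) in auto)
  moreover have "(\<integral>x. \<psi>' x e \<partial>lborel) = (LINT x|lebesgue_on \<Omega>. X x * frechet_derivative \<phi> (at x) e) +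
      (LINT x|lebesgue_on \<Omega>. X' x e * \<phi> x)"
    unfolding \<psi>'_def I1(3) I2(3) by (rule Bochner_Integration.integral_add[OF I1(1) I2(1)])
  ultimately show "(LINT x|lebesgue_on \<Omega>. X x * frechet_derivative \<phi> (at x) e) =
      - (LINT x|lebesgue_on \<Omega>. X' x e * \<phi> x)" by simp
qed

lemma locally_integrable_continuous:
  fixes f :: "'a::euclidean_space \<Rightarrow> 'b::euclidean_space"
  assumes "continuous_on \<Omega> f"
  shows "locally_integrable \<Omega> f"
  unfolding locally_integrable_def
proof safe
  fix K assume K: "compact K" "K \<subseteq> \<Omega>"
  have "integrable lborel (\<lambda>x. indicator K x *\<^sub>R f x)"
    using K assms by (intro borel_integrable_compact) (auto intro: continuous_on_subset)
  then have "integrable lebesgue (\<lambda>x. indicator K x *\<^sub>R f x)"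
    by (subst integrable_completion) auto
  also have "(\<lambda>x. indicator K x *\<^sub>R f x) = (\<lambda>x. if x \<in> K then f x else 0)"
    by (auto simp: indicator_def)
  finally show "integrable (lebesgue_on K) f"
    using lmeasurable_compact[OF K(1)]
    by (subst (asm) Lebesgue_Measure.integrable_restrict_UNIV) (auto simp: fmeasurable_def)
qed

lemma is_weak_gradient_classical:
  fixes u :: "'a::euclidean_space \<Rightarrow> real"
  assumes "open \<Omega>" and u: "\<And>x. x \<in> \<Omega> \<Longrightarrow> (u has_derivative (\<lambda>h. G x \<bullet> h)) (at x)"
    and G: "continuous_on \<Omega> G"
  shows "is_weak_gradient \<Omega> u G"
  unfolding is_weak_gradient_def
proof (intro conjI ballI)
  have "continuous_on \<Omega> u"
    by (rule has_derivative_continuous_on) (use u in \<open>auto intro: has_derivative_at_withinI\<close>)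
  then show "locally_integrable \<Omega> u" "locally_integrable \<Omega> G"
    using G by (auto intro: locally_integrable_continuous)
  show "(LINT x|lebesgue_on \<Omega>. u x * frechet_derivative \<phi> (at x) i) =
        - (LINT x|lebesgue_on \<Omega>. (G x \<bullet> i) * \<phi> x)" if "\<phi> \<in> test_functions \<Omega>" "i \<in> Basis" for \<phi> i
    by (rule integral_by_parts_test_function[OF assms(1) u _ that]) (use G in \<open>auto intro!: continuous_intros\<close>)
qed

section \<open>Uniqueness of weak gradients\<close>

definition box_bump :: "'a::euclidean_space \<Rightarrow> 'a \<Rightarrow> 'a \<Rightarrow> real" where
  "box_bump c d x = (\<Prod>i\<in>Basis. flat_exp (x \<bullet> i - c \<bullet> i) * flat_exp (d \<bullet> i - x \<bullet> i))"

lemma C_k_box_bump: "C_k k (box_bump c d)"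
  unfolding box_bump_def[abs_def]
proof (intro C_k_prod C_k_mult C_k_compose[OF C_k_flat_exp])
  fix i :: 'a
  have "C_k k (\<lambda>x::'a. x \<bullet> i)"
    by (intro C_k_bounded_linear bounded_linear_inner_left)
  moreover have "C_k k (\<lambda>x::'a. (-1) * (x \<bullet> i))"
    by (intro C_k_mult C_k_const C_k_bounded_linear bounded_linear_inner_left)
  ultimately show "C_k k (\<lambda>x. x \<bullet> i - c \<bullet> i)" "C_k k (\<lambda>x. d \<bullet> i - x \<bullet> i)"
    using C_k_add[OF _ C_k_const, of k "\<lambda>x. x \<bullet> i" "- (c \<bullet> i)"]
      C_k_add[OF C_k_const, of k "\<lambda>x. (-1) * (x \<bullet> i)" "d \<bullet> i"] by simp_all
qed simp

lemma box_bump_nonneg: "box_bump c d x \<ge> 0"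
  by (auto simp: box_bump_def intro!: prod_nonneg mult_nonneg_nonneg flat_exp_nonneg)

lemma box_bump_pos: "x \<in> box c d \<Longrightarrow> box_bump c d x > 0"
  by (auto simp: box_bump_def mem_box flat_exp_pos_iff intro!: prod_pos mult_pos_pos)

lemma box_bump_eq_0: "x \<notin> box c d \<Longrightarrow> box_bump c d x = 0"
  by (auto simp: box_bump_def mem_box not_less intro!: flat_exp_eq_0)

lemma sigma_finite_lebesgue: "sigma_finite_measure (lebesgue :: 'a::euclidean_space measure)"
proof
  show "\<exists>A::'a set set. countable A \<and> A \<subseteq> sets lebesgue \<and> \<Union> A = space lebesgue \<and>
      (\<forall>a\<in>A. emeasure lebesgue a \<noteq> \<infinity>)"
    using UN_box_eq_UNIV[where 'a = 'a] fmeasurableD2[OF lmeasurable_box]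
    by (intro exI[of _ "range (\<lambda>i::nat. box (- (real i *\<^sub>R One)) (real i *\<^sub>R One))"]) auto
qed

text \<open>Dynkin's argument: the open boxes are closed under intersection and generate the Borel
  sets, and the sets over which \<open>h\<close> has integral 0 are closed under disjoint countable
  unions and, because of \<open>total\<close>, under complements. A function whose integral over
  every measurable set vanishes is 0 almost everywhere.\<close>

lemma AE_eq_0_if_integral_box_eq_0:
  fixes h :: "'a::euclidean_space \<Rightarrow> real"
  assumes h: "integrable lebesgue h" and total: "(LINT x|lebesgue. h x) = 0"
    and box: "\<And>c d. (LINT x:box c d|lebesgue. h x) = 0"
  shows "AE x in lebesgue. h x = 0"
proof (rule sigma_finite_measure.density_zero[OF sigma_finite_lebesgue h])
  have si: "set_integrable lebesgue A h" if "A \<in> sets lebesgue" for A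
    unfolding set_integrable_def by (rule integrable_mult_indicator[OF that h])
  have borel: "A \<in> sets lebesgue \<and> (LINT x:A|lebesgue. h x) = 0" if "A \<in> sets borel" for A
  proof -
    have "A \<in> sigma_sets UNIV (range (\<lambda>(a, b). box a b :: 'a set))"
      using that by (simp add: borel_eq_box)
    then show ?thesis
    proof (induction rule: sigma_sets_induct_disjoint[rotated 2, consumes 1])
      case (4 A)
      have "(LINT x:(\<Union>i. A i)|lebesgue. h x) = (\<Sum>i. (LINT x:(A i)|lebesgue. h x))"
        using 4 by (intro lebesgue_integral_countable_add si) (auto simp: disjoint_family_on_def)
      then show ?case using 4 by auto
    next
      case (3 A)
      have "(LINT x:UNIV - A|lebesgue. h x) = (LINT x:UNIV|lebesgue. h x) - (LINT x:A|lebesgue. h x)"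
      proof -
        have "(LINT x:(UNIV - A) \<union> A|lebesgue. h x) = (LINT x:UNIV - A|lebesgue. h x) + (LINT x:A|lebesgue. h x)"
          using 3 by (intro set_integral_Un si) auto
        then show ?thesis by simp
      qed
      then show ?case using 3 total by (auto simp: set_lebesgue_integral_def)
    qed (use box in \<open>auto simp: Int_stable_def box_Int_box set_lebesgue_integral_def\<close>)
  qed
  \<comment> \<open>A Lebesgue set differs from a Borel set by a subset of a null set, which the
    integral does not see.\<close>
  fix A :: "'a set" assume A: "A \<in> sets lebesgue"
  then obtain S N N' where N: "A = S \<union> N" "N \<subseteq> N'" "N' \<in> null_sets lborel" "S \<in> sets lborel"
    by (rule sets_completionE)
  have S: "S \<in> sets lebesgue" using N(4) by auto
  have "(LINT x:A|lebesgue. h x) = (LINT x:S|lebesgue. h x)"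
  proof (rule set_integral_cong_set)
    have "AE x in lebesgue. x \<notin> N'"
      using N(3) by (intro AE_not_in) (simp add: null_sets_completionI)
    then show "AE x in lebesgue. x \<in> S \<longleftrightarrow> x \<in> A"
      by (rule eventually_mono) (use N in auto)
  qed (use si[OF S] si[OF A] in \<open>auto simp: set_integrable_def set_borel_measurable_def\<close>)
  then show "(LINT x:A|lebesgue. h x) = 0" using borel[of S] N(4) by simp
qed

text \<open>Inside a closed box contained in \<open>\<Omega>\<close>, indicators of open boxes are
  bounded pointwise limits of test functions; hence \<open>h\<close> integrates to 0 over all
  smaller boxes and vanishes there almost everywhere. Countably many closed boxes fill
  \<open>\<Omega>\<close>.\<close>

lemma fundamental_lemma_calculus_of_variations:
  fixes h :: "'a::euclidean_space \<Rightarrow> real"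
  assumes "open \<Omega>" and h: "locally_integrable \<Omega> h"
    and 0: "\<And>\<phi>. \<phi> \<in> test_functions \<Omega> \<Longrightarrow> (LINT x|lebesgue_on \<Omega>. h x * \<phi> x) = 0"
  shows "AE x in lebesgue_on \<Omega>. h x = 0"
proof -
  have \<Omega>: "\<Omega> \<in> sets lebesgue" using assms(1) by auto
  have cb: "AE x in lebesgue. x \<in> cbox a b \<longrightarrow> h x = 0" if ab: "cbox a b \<subseteq> \<Omega>" for a b
  proof -
    have "integrable (lebesgue_on (cbox a b)) h"
      using h ab by (auto simp: locally_integrable_def)
    then have hc: "integrable lebesgue (\<lambda>x. if x \<in> cbox a b then h x else 0)"
      by (subst Lebesgue_Measure.integrable_restrict_UNIV) auto
    have "integrable lebesgue (\<lambda>x. indicator (box a b) x *\<^sub>R (if x \<in> cbox a b then h x else 0))"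
      by (intro integrable_mult_indicator hc) auto
    also have "(\<lambda>x. indicator (box a b) x *\<^sub>R (if x \<in> cbox a b then h x else 0)) =
        (\<lambda>x. if x \<in> box a b then h x else 0)"
      using box_subset_cbox[of a b] by (auto simp: indicator_def fun_eq_iff)
    finally have hb: "integrable lebesgue (\<lambda>x. if x \<in> box a b then h x else 0)" .
    have I: "(LINT x:box c d|lebesgue. (if x \<in> box a b then h x else 0)) = 0" for c d
    proof -
      \<comment> \<open>The product of the two bumps is positive exactly on the intersection of the
        boxes; 1 - exp(-n r) is smooth in r, lies in [0, 1] for r \<ge> 0, and tends to 1 for r > 0
        while staying 0 at r = 0.\<close>
      define \<phi> where "\<phi> n x = 1 - exp (- real n * (box_bump a b x * box_bump c d x))" for n x
      have \<phi>0: "\<phi> n x = 0" if "x \<notin> box a b \<or> x \<notin> box c d" for n x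
        using that box_bump_eq_0[of x a b] box_bump_eq_0[of x c d] by (auto simp: \<phi>_def)
      have test: "\<phi> n \<in> test_functions \<Omega>" for n
      proof -
        have "C_k k (\<lambda>x. 1 + (-1) * exp ((- real n) * (box_bump a b x * box_bump c d x)))" for k
          by (intro C_k_add C_k_mult C_k_const C_k_compose[OF C_k_exp] C_k_box_bump)
        moreover have "closure {x. \<phi> n x \<noteq> 0} \<subseteq> cbox a b"
          using \<phi>0 box_subset_cbox[of a b] by (intro closure_minimal) auto
        moreover from this have "compact (closure {x. \<phi> n x \<noteq> 0})"
          using bounded_subset[OF bounded_cbox] by (simp add: compact_eq_bounded_closed)
        ultimately show ?thesis using ab by (auto simp: test_functions_def \<phi>_def[abs_def])
      qed
      have e: "(LINT x|lebesgue_on \<Omega>. h x * \<phi> n x) =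
          (LINT x|lebesgue. (if x \<in> box a b then h x else 0) * \<phi> n x)" for n
      proof -
        have "(LINT x|lebesgue_on \<Omega>. h x * \<phi> n x) = (LINT x|lebesgue. (if x \<in> \<Omega> then h x * \<phi> n x else 0))"
          by (rule Lebesgue_Measure.integral_restrict_UNIV[OF \<Omega>, symmetric])
        also have "(\<lambda>x. if x \<in> \<Omega> then h x * \<phi> n x else 0) =
            (\<lambda>x. (if x \<in> box a b then h x else 0) * \<phi> n x)"
          using \<phi>0[of _ n] ab box_subset_cbox[of a b] by (auto simp: fun_eq_iff)
        finally show ?thesis .
      qed
      have \<phi>_meas: "\<phi> n \<in> borel_measurable lebesgue" for n
        using test_functionsD(2)[OF test[of n]]
        by (intro measurable_completion) (simp add: borel_measurable_continuous_onI)
      have "(\<lambda>n. LINT x|lebesgue. (if x \<in> box a b then h x else 0) * \<phi> n x) \<longlonglongrightarrow>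
          (LINT x|lebesgue. indicator (box c d) x *\<^sub>R (if x \<in> box a b then h x else 0))"
      proof (rule integral_dominated_convergence[where w = "\<lambda>x. \<bar>if x \<in> box a b then h x else 0\<bar>"])
        show "AE x in lebesgue. (\<lambda>n. (if x \<in> box a b then h x else 0) * \<phi> n x) \<longlonglongrightarrow>
          indicator (box c d) x *\<^sub>R (if x \<in> box a b then h x else 0)"
        proof (rule AE_I2)
          fix x
          show "(\<lambda>n. (if x \<in> box a b then h x else 0) * \<phi> n x) \<longlonglongrightarrow>
            indicator (box c d) x *\<^sub>R (if x \<in> box a b then h x else 0)"
          proof (cases "x \<in> box a b \<and> x \<in> box c d")
            case True
            then have "box_bump a b x * box_bump c d x > 0"
              by (simp add: box_bump_pos)
            moreover have "(\<lambda>n. 1 - exp (- real n * r)) \<longlonglongrightarrow> 1" if "r > 0" for r :: real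
              using that by real_asymp
            ultimately have "(\<lambda>n. h x * \<phi> n x) \<longlonglongrightarrow> h x * 1"
              unfolding \<phi>_def by (intro tendsto_intros)
            then show ?thesis using True by simp
          next
            case False
            then show ?thesis using \<phi>0[of x] by (auto simp: indicator_def)
          qed
        qed
        have "\<bar>\<phi> n x\<bar> \<le> 1" for n x
          using box_bump_nonneg[of a b x] box_bump_nonneg[of c d x] by (simp add: \<phi>_def)
        then show "AE x in lebesgue. norm ((if x \<in> box a b then h x else 0) * \<phi> n x)
            \<le> \<bar>if x \<in> box a b then h x else 0\<bar>" for n
          by (auto simp: abs_mult intro!: mult_left_le)
      qed (use hb \<phi>_meas in \<open>auto intro!: borel_measurable_times borel_measurable_scaleR borel_measurable_indicator\<close>)
      moreover have "(\<lambda>n. LINT x|lebesgue. (if x \<in> box a b then h x else 0) * \<phi> n x) = (\<lambda>n. 0)"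
        using 0[OF test] e by simp
      ultimately show ?thesis
        by (simp add: set_lebesgue_integral_def LIMSEQ_const_iff)
    qed
    have "(LINT x|lebesgue. (if x \<in> box a b then h x else 0)) = 0"
    proof -
      have "(\<lambda>x. if x \<in> box a b then h x else 0) =
          (\<lambda>x. indicator (box a b) x *\<^sub>R (if x \<in> box a b then h x else 0))"
        by (auto simp: indicator_def fun_eq_iff)
      with I[of a b] show ?thesis unfolding set_lebesgue_integral_def by metis
    qed
    from AE_eq_0_if_integral_box_eq_0[OF hb this I]
    have "AE x in lebesgue. (if x \<in> box a b then h x else 0) = 0" .
    \<comment> \<open>The bumps only reach the open box; its faces form a null set.\<close>
    moreover have "AE x in lebesgue. x \<notin> cbox a b - box a b"
      using negligible_frontier_interval[of a b] by (intro AE_not_in) (simp add: negligible_iff_null_sets)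
    ultimately show ?thesis by eventually_elim (auto split: if_splits)
  qed
  obtain D where D: "countable D" "D \<subseteq> Pow \<Omega>"
    "\<And>X. X \<in> D \<Longrightarrow> \<exists>a b. X = cbox a b" "\<Union> D = \<Omega>"
    by (rule open_countable_Union_open_cbox[OF assms(1)]) (rule that)
  have "AE x in lebesgue. x \<in> X \<longrightarrow> h x = 0" if X: "X \<in> D" for X
  proof -
    obtain a b where "X = cbox a b" using D(3)[OF X] by blast
    with cb[of a b] D(2) X show ?thesis by blast
  qed
  then have "AE x in lebesgue. \<forall>X\<in>D. x \<in> X \<longrightarrow> h x = 0"
    using AE_ball_countable[OF D(1), of "\<lambda>x X. x \<in> X \<longrightarrow> h x = 0" lebesgue] by blast
  then have "AE x in lebesgue. x \<in> \<Omega> \<longrightarrow> h x = 0"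
    by (rule eventually_mono) (use D(4) in auto)
  then show ?thesis using \<Omega> by (simp add: AE_restrict_space_iff)
qed

lemma integrable_mult_compact_support:
  fixes f :: "'a::euclidean_space \<Rightarrow> real"
  assumes "open \<Omega>" and f: "locally_integrable \<Omega> f" and c: "continuous_on UNIV \<phi>"
    and K: "compact K" "K \<subseteq> \<Omega>" "\<And>x. x \<notin> K \<Longrightarrow> \<phi> x = 0"
  shows "integrable (lebesgue_on \<Omega>) (\<lambda>x. f x * \<phi> x)"
proof -
  have Ks: "K \<in> sets lebesgue" using lmeasurable_compact[OF K(1)] by (simp add: fmeasurable_def)
  obtain B where B: "\<forall>x\<in>K. norm (\<phi> x) \<le> B"
    using compact_imp_bounded[OF compact_continuous_image[OF continuous_on_subset[OF c subset_UNIV] K(1)]]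
    by (auto simp: bounded_iff)
  have fK: "integrable lebesgue (\<lambda>x. if x \<in> K then f x else 0)"
    using f K by (subst Lebesgue_Measure.integrable_restrict_UNIV[OF Ks]) (auto simp: locally_integrable_def)
  have \<phi>m: "\<phi> \<in> borel_measurable lebesgue"
    using c by (intro measurable_completion) (simp add: borel_measurable_continuous_onI)
  have "integrable lebesgue (\<lambda>x. (if x \<in> K then f x else 0) * \<phi> x)"
  proof (rule Bochner_Integration.integrable_bound)
    show "integrable lebesgue (\<lambda>x. B * (if x \<in> K then f x else 0))"
      using fK by (rule integrable_mult_right)
    show "AE x in lebesgue. norm ((if x \<in> K then f x else 0) * \<phi> x) \<le> norm (B * (if x \<in> K then f x else 0))"
    proof (rule AE_I2)
      fix x
      have "\<bar>\<phi> x\<bar> * \<bar>f x\<bar> \<le> \<bar>B\<bar> * \<bar>f x\<bar>" if "x \<in> K"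
        using B that by (intro mult_right_mono) force+
      then show "norm ((if x \<in> K then f x else 0) * \<phi> x) \<le> norm (B * (if x \<in> K then f x else 0))"
        by (simp add: abs_mult mult.commute)
    qed
  qed (use fK \<phi>m in \<open>auto intro!: borel_measurable_times\<close>)
  also have "(\<lambda>x. (if x \<in> K then f x else 0) * \<phi> x) = (\<lambda>x. if x \<in> \<Omega> then f x * \<phi> x else 0)"
    using K by (auto simp: fun_eq_iff)
  finally show ?thesis
    using assms(1) by (subst (asm) Lebesgue_Measure.integrable_restrict_UNIV) auto
qed

lemma integrable_mult_test_function:
  fixes f :: "'a::euclidean_space \<Rightarrow> real"
  assumes "open \<Omega>" and f: "locally_integrable \<Omega> f" and \<phi>: "\<phi> \<in> test_functions \<Omega>"
  shows "integrable (lebesgue_on \<Omega>) (\<lambda>x. f x * \<phi> x)"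
    and "i \<in> Basis \<Longrightarrow> integrable (lebesgue_on \<Omega>) (\<lambda>x. f x * frechet_derivative \<phi> (at x) i)"
proof -
  obtain K where K: "compact K" "K \<subseteq> \<Omega>" "\<And>x. x \<notin> K \<Longrightarrow> \<phi> x = 0"
    "\<And>x h. x \<notin> K \<Longrightarrow> frechet_derivative \<phi> (at x) h = 0"
    by (rule test_functions_support[OF \<phi>]) metis
  show "integrable (lebesgue_on \<Omega>) (\<lambda>x. f x * \<phi> x)"
    by (rule integrable_mult_compact_support[OF assms(1) f test_functionsD(2)[OF \<phi>] K(1-3)])
  show "integrable (lebesgue_on \<Omega>) (\<lambda>x. f x * frechet_derivative \<phi> (at x) i)" if "i \<in> Basis"
    by (rule integrable_mult_compact_support[OF assms(1) f test_functionsD(3)[OF \<phi> that] K(1,2,4)])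
qed

text \<open>This gives \<open>weak_gradient\<close> its meaning: whatever function the choice
  operator returns, under an integral it may be replaced by any weak gradient at hand.\<close>

lemma is_weak_gradient_unique:
  fixes u :: "'a::euclidean_space \<Rightarrow> real"
  assumes "open \<Omega>" and g: "is_weak_gradient \<Omega> u g" and g': "is_weak_gradient \<Omega> u g'"
  shows "AE x in lebesgue_on \<Omega>. g x = g' x"
proof -
  have "AE x in lebesgue_on \<Omega>. (g x - g' x) \<bullet> i = 0" if i: "i \<in> Basis" for i
  proof (rule fundamental_lemma_calculus_of_variations[OF assms(1)])
    have L: "locally_integrable \<Omega> (\<lambda>x. g x \<bullet> i)" "locally_integrable \<Omega> (\<lambda>x. g' x \<bullet> i)"
      using g g' by (auto simp: is_weak_gradient_def locally_integrable_def)
    then show "locally_integrable \<Omega> (\<lambda>x. (g x - g' x) \<bullet> i)"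
      by (auto simp: locally_integrable_def inner_diff_left)
    fix \<phi> :: "'a \<Rightarrow> real" assume \<phi>: "\<phi> \<in> test_functions \<Omega>"
    note I = integrable_mult_test_function(1)[OF assms(1) _ \<phi>]
    have "(LINT x|lebesgue_on \<Omega>. (g x \<bullet> i) * \<phi> x) = (LINT x|lebesgue_on \<Omega>. (g' x \<bullet> i) * \<phi> x)"
      using g g' \<phi> i by (auto simp: is_weak_gradient_def)
    then show "(LINT x|lebesgue_on \<Omega>. ((g x - g' x) \<bullet> i) * \<phi> x) = 0"
      using I[OF L(1)] I[OF L(2)] by (simp add: inner_diff_left left_diff_distrib)
  qed
  then have "AE x in lebesgue_on \<Omega>. \<forall>i\<in>Basis. (g x - g' x) \<bullet> i = 0"
    by (intro AE_finite_allI) auto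
  then show ?thesis
  proof eventually_elim
    case (elim x)
    then have "g x \<bullet> i = g' x \<bullet> i" if "i \<in> Basis" for i
      using that by (simp add: inner_diff_left)
    then show "g x = g' x" by (rule euclidean_eqI)
  qed
qed

section \<open>Sobolev spaces on bounded open sets\<close>

text \<open>A chosen weak gradient is known only up to a null set. Lebesgue measure is complete, so
  measurability carries over from a representative.\<close>

lemma borel_measurable_lebesgue_on_cong_AE:
  fixes f g :: "'a::euclidean_space \<Rightarrow> 'b::euclidean_space"
  assumes S: "S \<in> sets lebesgue" and ae: "AE x in lebesgue_on S. f x = g x"
    and g: "g \<in> borel_measurable (lebesgue_on S)"
  shows "f \<in> borel_measurable (lebesgue_on S)"
proof -
  obtain N where N: "N \<in> null_sets (lebesgue_on S)" "{x \<in> space (lebesgue_on S). f x \<noteq> g x} \<subseteq> N"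
    using ae by (auto simp: eventually_ae_filter)
  have "g \<in> borel_measurable (lebesgue_on (S - N))"
    using borel_measurable_diff_null[OF N(1) S] g by blast
  then have "f \<in> borel_measurable (lebesgue_on (S - N))"
    by (subst measurable_cong[of _ _ g]) (use N(2) in auto)
  then show ?thesis
    using borel_measurable_diff_null[OF N(1) S] by blast
qed

lemma Lp_cong_AE:
  fixes f g :: "'a::euclidean_space \<Rightarrow> 'b::euclidean_space"
  assumes S: "S \<in> sets lebesgue" and ae: "AE x in lebesgue_on S. f x = g x" and g: "g \<in> Lp p S"
  shows "f \<in> Lp p S"
proof -
  have f: "f \<in> borel_measurable (lebesgue_on S)"
    using borel_measurable_lebesgue_on_cong_AE[OF S ae] g by (simp add: Lp_def)
  have "integrable (lebesgue_on S) (\<lambda>x. norm (f x) powr p)"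
  proof (rule integrable_cong_AE_imp)
    show "integrable (lebesgue_on S) (\<lambda>x. norm (g x) powr p)" using g by (simp add: Lp_def)
    show "(\<lambda>x. norm (f x) powr p) \<in> borel_measurable (lebesgue_on S)" using f by measurable
    show "AE x in lebesgue_on S. norm (g x) powr p = norm (f x) powr p"
      using ae by eventually_elim simp
  qed
  then show ?thesis using f by (simp add: Lp_def)
qed

lemma Lp_diff:
  fixes f g :: "'a::euclidean_space \<Rightarrow> 'b::euclidean_space"
  assumes "f \<in> Lp p S" "g \<in> Lp p S" "p > 0"
  shows "(\<lambda>x. f x - g x) \<in> Lp p S"
proof -
  have m: "f \<in> borel_measurable (lebesgue_on S)" "g \<in> borel_measurable (lebesgue_on S)"
    and i: "integrable (lebesgue_on S) (\<lambda>x. norm (f x) powr p)" "integrable (lebesgue_on S) (\<lambda>x. norm (g x) powr p)"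
    using assms by (auto simp: Lp_def)
  have le: "norm (a - b) powr p \<le> 2 powr p * (norm a powr p + norm b powr p)" for a b :: 'b
  proof -
    have "norm (a - b) powr p \<le> (2 * max (norm a) (norm b)) powr p"
      using norm_triangle_ineq4[of a b] assms(3) by (intro powr_mono2) auto
    also have "\<dots> \<le> 2 powr p * (norm a powr p + norm b powr p)"
      by (simp add: powr_mult max_def)
    finally show ?thesis .
  qed
  have "integrable (lebesgue_on S) (\<lambda>x. norm (f x - g x) powr p)"
  proof (rule Bochner_Integration.integrable_bound)
    show "integrable (lebesgue_on S) (\<lambda>x. 2 powr p * (norm (f x) powr p + norm (g x) powr p))"
      using i by simp
    show "(\<lambda>x. norm (f x - g x) powr p) \<in> borel_measurable (lebesgue_on S)"
      using m by measurable
    show "AE x in lebesgue_on S. norm (norm (f x - g x) powr p) \<le>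
        norm (2 powr p * (norm (f x) powr p + norm (g x) powr p))"
      using le by (intro AE_I2) (simp add: abs_mult)
  qed
  then show ?thesis using m by (simp add: Lp_def)
qed

lemma integrable_bounded_on_lmeasurable:
  fixes f :: "'a::euclidean_space \<Rightarrow> 'b::euclidean_space"
  assumes "S \<in> lmeasurable" "f \<in> borel_measurable (lebesgue_on S)" "\<And>x. x \<in> S \<Longrightarrow> norm (f x) \<le> K"
  shows "integrable (lebesgue_on S) f"
proof -
  interpret finite_measure "lebesgue_on S" by (rule finite_measure_lebesgue_on[OF assms(1)])
  show ?thesis
    by (rule integrable_const_bound[of _ K]) (use assms in \<open>auto intro!: AE_I2\<close>)
qed

lemma Lp_bounded:
  fixes f :: "'a::euclidean_space \<Rightarrow> 'b::euclidean_space"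
  assumes "S \<in> lmeasurable" "f \<in> borel_measurable (lebesgue_on S)" "\<And>x. x \<in> S \<Longrightarrow> norm (f x) \<le> K" "p > 0"
  shows "f \<in> Lp p S"
proof -
  have "(\<lambda>x. norm (f x) powr p) \<in> borel_measurable (lebesgue_on S)"
    using assms(2) by measurable
  then have "integrable (lebesgue_on S) (\<lambda>x. norm (f x) powr p)"
    by (rule integrable_bounded_on_lmeasurable[OF assms(1), of _ "K powr p"])
      (use assms(3,4) in \<open>auto intro!: powr_mono2\<close>)
  then show ?thesis using assms by (simp add: Lp_def)
qed

lemma borel_measurable_continuous_on_open:
  fixes f :: "'a::euclidean_space \<Rightarrow> 'b::euclidean_space"
  assumes "open \<Omega>" "continuous_on \<Omega> f"
  shows "f \<in> borel_measurable (lebesgue_on \<Omega>)"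
  using assms by (intro continuous_imp_measurable_on_sets_lebesgue) auto

lemma weak_gradient_AE_eq:
  fixes u :: "'a::euclidean_space \<Rightarrow> real"
  assumes "open \<Omega>" "is_weak_gradient \<Omega> u g"
  shows "AE x in lebesgue_on \<Omega>. weak_gradient \<Omega> u x = g x"
  using is_weak_gradient_unique[OF assms(1) _ assms(2)] someI[of "is_weak_gradient \<Omega> u" g] assms(2)
  by (simp add: weak_gradient_def)

lemma W1p_weak_gradient:
  fixes u :: "'a::euclidean_space \<Rightarrow> real"
  assumes "open \<Omega>" "u \<in> W1p p \<Omega>"
  shows "is_weak_gradient \<Omega> u (weak_gradient \<Omega> u)" "weak_gradient \<Omega> u \<in> Lp p \<Omega>"
proof -
  obtain g where g: "g \<in> Lp p \<Omega>" "is_weak_gradient \<Omega> u g" using assms(2) by (auto simp: W1p_def)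
  show "is_weak_gradient \<Omega> u (weak_gradient \<Omega> u)"
    unfolding weak_gradient_def using g(2) by (rule someI[of "is_weak_gradient \<Omega> u"])
  show "weak_gradient \<Omega> u \<in> Lp p \<Omega>"
    by (rule Lp_cong_AE[OF _ weak_gradient_AE_eq[OF assms(1) g(2)] g(1)]) (use assms(1) in auto)
qed

lemma W1p_norm_eq:
  fixes u :: "'a::euclidean_space \<Rightarrow> real"
  assumes "open \<Omega>" "is_weak_gradient \<Omega> u g" "g \<in> borel_measurable (lebesgue_on \<Omega>)"
  shows "W1p_norm p \<Omega> u = ((LINT x|lebesgue_on \<Omega>. \<bar>u x\<bar> powr p) +
     (LINT x|lebesgue_on \<Omega>. norm (g x) powr p)) powr (1 / p)"
proof -
  have ae: "AE x in lebesgue_on \<Omega>. weak_gradient \<Omega> u x = g x"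
    by (rule weak_gradient_AE_eq[OF assms(1,2)])
  have "weak_gradient \<Omega> u \<in> borel_measurable (lebesgue_on \<Omega>)"
    by (rule borel_measurable_lebesgue_on_cong_AE[OF _ ae assms(3)]) (use assms(1) in auto)
  then have "(LINT x|lebesgue_on \<Omega>. norm (weak_gradient \<Omega> u x) powr p) =
      (LINT x|lebesgue_on \<Omega>. norm (g x) powr p)"
    by (intro integral_cong_AE) (use assms(3) ae in \<open>auto elim!: eventually_mono\<close>)
  then show ?thesis by (simp add: W1p_norm_def)
qed

lemma is_weak_gradient_diff:
  fixes u v :: "'a::euclidean_space \<Rightarrow> real"
  assumes "open \<Omega>" and u: "is_weak_gradient \<Omega> u g" and v: "is_weak_gradient \<Omega> v h"
  shows "is_weak_gradient \<Omega> (\<lambda>x. u x - v x) (\<lambda>x. g x - h x)"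
  unfolding is_weak_gradient_def
proof (intro conjI ballI)
  have L: "locally_integrable \<Omega> u" "locally_integrable \<Omega> v"
    "locally_integrable \<Omega> g" "locally_integrable \<Omega> h"
    using u v by (auto simp: is_weak_gradient_def)
  then show "locally_integrable \<Omega> (\<lambda>x. u x - v x)" "locally_integrable \<Omega> (\<lambda>x. g x - h x)"
    by (auto simp: locally_integrable_def)
  fix \<phi> :: "'a \<Rightarrow> real" and i :: 'a assume \<phi>: "\<phi> \<in> test_functions \<Omega>" and i: "i \<in> Basis"
  have "locally_integrable \<Omega> (\<lambda>x. g x \<bullet> i)" "locally_integrable \<Omega> (\<lambda>x. h x \<bullet> i)"
    using L(3,4) by (auto simp: locally_integrable_def)
  note I = this[THEN integrable_mult_test_function(1)[OF assms(1) _ \<phi>]]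
    L(1,2)[THEN integrable_mult_test_function(2)[OF assms(1) _ \<phi> i]]
  have "(LINT x|lebesgue_on \<Omega>. u x * frechet_derivative \<phi> (at x) i) = - (LINT x|lebesgue_on \<Omega>. (g x \<bullet> i) * \<phi> x)"
    "(LINT x|lebesgue_on \<Omega>. v x * frechet_derivative \<phi> (at x) i) = - (LINT x|lebesgue_on \<Omega>. (h x \<bullet> i) * \<phi> x)"
    using u v \<phi> i by (auto simp: is_weak_gradient_def)
  then show "(LINT x|lebesgue_on \<Omega>. (u x - v x) * frechet_derivative \<phi> (at x) i) =
      - (LINT x|lebesgue_on \<Omega>. ((g x - h x) \<bullet> i) * \<phi> x)"
    using I by (simp add: left_diff_distrib inner_diff_left)
qed

section \<open>Classical gradients and convergence in the Sobolev norm\<close>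

definition grad :: "('a::euclidean_space \<Rightarrow> real) \<Rightarrow> 'a \<Rightarrow> 'a" where
  "grad \<phi> x = (\<Sum>i\<in>Basis. frechet_derivative \<phi> (at x) i *\<^sub>R i)"

lemma has_derivative_grad:
  assumes "\<phi> differentiable (at x)"
  shows "(\<phi> has_derivative (\<lambda>h. grad \<phi> x \<bullet> h)) (at x)"
proof -
  have d: "(\<phi> has_derivative frechet_derivative \<phi> (at x)) (at x)"
    using assms by (simp add: frechet_derivative_works)
  have "frechet_derivative \<phi> (at x) h = grad \<phi> x \<bullet> h" for h
  proof -
    have "frechet_derivative \<phi> (at x) (\<Sum>i\<in>Basis. (h \<bullet> i) *\<^sub>R i) = (\<Sum>i\<in>Basis. (h \<bullet> i) * frechet_derivative \<phi> (at x) i)"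
      by (simp add: linear_sum[OF has_derivative_linear[OF d]] linear_scale[OF has_derivative_linear[OF d]])
    then show ?thesis
      unfolding euclidean_representation
      by (simp add: grad_def inner_sum_left inner_commute[of h] mult.commute)
  qed
  then have "frechet_derivative \<phi> (at x) = (\<lambda>h. grad \<phi> x \<bullet> h)" by blast
  then show ?thesis using d by simp
qed

lemma grad_eqI:
  assumes "(\<phi> has_derivative (\<lambda>h. g \<bullet> h)) (at x)"
  shows "grad \<phi> x = g"
proof -
  have "frechet_derivative \<phi> (at x) = (\<lambda>h. g \<bullet> h)"
    using frechet_derivative_at[OF assms] by simp
  then show ?thesis by (simp add: grad_def euclidean_representation)
qed

lemma test_function_grad:
  assumes "\<phi> \<in> test_functions \<Omega>"
  shows "(\<phi> has_derivative (\<lambda>h. grad \<phi> x \<bullet> h)) (at x)" "continuous_on S (grad \<phi>)"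
proof -
  show "(\<phi> has_derivative (\<lambda>h. grad \<phi> x \<bullet> h)) (at x)"
    using test_functionsD(1)[OF assms] by (intro has_derivative_grad) (auto simp: differentiable_def)
  have "continuous_on UNIV (grad \<phi>)"
    unfolding grad_def[abs_def] by (intro continuous_intros test_functionsD(3)[OF assms])
  then show "continuous_on S (grad \<phi>)" by (rule continuous_on_subset) simp
qed

lemma test_function_bounded:
  assumes "\<phi> \<in> test_functions \<Omega>"
  obtains B where "\<And>x. \<bar>\<phi> x\<bar> \<le> B" "\<And>x. norm (grad \<phi> x) \<le> B"
proof -
  obtain K where K: "compact K" "K \<subseteq> \<Omega>" "\<And>x. x \<notin> K \<Longrightarrow> \<phi> x = 0"
    "\<And>x h. x \<notin> K \<Longrightarrow> frechet_derivative \<phi> (at x) h = 0"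
    by (rule test_functions_support[OF assms]) metis
  have "continuous_on K (\<lambda>x. (\<phi> x, grad \<phi> x))"
    by (intro continuous_intros test_function_grad(2)[OF assms] continuous_on_subset[OF test_functionsD(2)[OF assms]]) auto
  from compact_imp_bounded[OF compact_continuous_image[OF this K(1)]]
  obtain B where B: "\<And>x. x \<in> K \<Longrightarrow> norm (\<phi> x, grad \<phi> x) \<le> B" by (auto simp: bounded_iff)
  have "\<bar>\<phi> x\<bar> \<le> max B 0 \<and> norm (grad \<phi> x) \<le> max B 0" for x
  proof (cases "x \<in> K")
    case True
    with B[OF this] norm_fst_le[of "\<phi> x" "grad \<phi> x"] norm_snd_le[of "grad \<phi> x" "\<phi> x"]
    show ?thesis by auto
  next
    case False
    then show ?thesis by (simp add: K grad_def)
  qed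
  then show thesis using that by blast
qed

lemma W1p_classical:
  fixes u :: "'a::euclidean_space \<Rightarrow> real"
  assumes "open \<Omega>" "bounded \<Omega>" "p > 0"
    and u: "\<And>x. x \<in> \<Omega> \<Longrightarrow> (u has_derivative (\<lambda>h. G x \<bullet> h)) (at x)"
    and G: "continuous_on \<Omega> G"
    and K: "\<And>x. x \<in> \<Omega> \<Longrightarrow> \<bar>u x\<bar> \<le> K" "\<And>x. x \<in> \<Omega> \<Longrightarrow> norm (G x) \<le> K"
  shows "u \<in> W1p p \<Omega>" "is_weak_gradient \<Omega> u G" "G \<in> borel_measurable (lebesgue_on \<Omega>)"
    "u \<in> borel_measurable (lebesgue_on \<Omega>)"
proof -
  have l: "\<Omega> \<in> lmeasurable" using assms by (intro lmeasurable_open)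
  show G': "is_weak_gradient \<Omega> u G" by (rule is_weak_gradient_classical[OF assms(1) u G])
  show Gm: "G \<in> borel_measurable (lebesgue_on \<Omega>)"
    by (rule borel_measurable_continuous_on_open[OF assms(1) G])
  have "continuous_on \<Omega> u"
    by (rule has_derivative_continuous_on) (use u in \<open>auto intro: has_derivative_at_withinI\<close>)
  then show um: "u \<in> borel_measurable (lebesgue_on \<Omega>)"
    by (rule borel_measurable_continuous_on_open[OF assms(1)])
  have "u \<in> Lp p \<Omega>" "G \<in> Lp p \<Omega>"
    using K by (auto intro!: Lp_bounded[OF l um _ assms(3), of K] Lp_bounded[OF l Gm _ assms(3), of K])
  then show "u \<in> W1p p \<Omega>" using G' by (auto simp: W1p_def)
qed

text \<open>On a set of finite measure the constant \<open>(2 * K) powr p\<close> is an integrable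
  majorant, so bounded pointwise convergence of \<open>\<phi> j\<close> and its gradient sends both
  integrals of the norm to 0.\<close>

lemma W1p_0_classical:
  fixes u :: "'a::euclidean_space \<Rightarrow> real"
  assumes "open \<Omega>" "bounded \<Omega>" "p > 0"
    and u: "\<And>x. x \<in> \<Omega> \<Longrightarrow> (u has_derivative (\<lambda>h. G x \<bullet> h)) (at x)"
    and G: "continuous_on \<Omega> G"
    and K: "\<And>x. x \<in> \<Omega> \<Longrightarrow> \<bar>u x\<bar> \<le> K" "\<And>x. x \<in> \<Omega> \<Longrightarrow> norm (G x) \<le> K"
    and \<phi>: "\<And>j::nat. \<phi> j \<in> test_functions \<Omega>"
    and \<phi>K: "\<And>j x. x \<in> \<Omega> \<Longrightarrow> \<bar>\<phi> j x\<bar> \<le> K" "\<And>j x. x \<in> \<Omega> \<Longrightarrow> norm (grad (\<phi> j) x) \<le> K"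
    and lim: "\<And>x. x \<in> \<Omega> \<Longrightarrow> (\<lambda>j. \<phi> j x) \<longlonglongrightarrow> u x"
      "\<And>x. x \<in> \<Omega> \<Longrightarrow> (\<lambda>j. grad (\<phi> j) x) \<longlonglongrightarrow> G x"
  shows "u \<in> W1p_0 p \<Omega>"
proof -
  have l: "\<Omega> \<in> lmeasurable" using assms by (intro lmeasurable_open)
  interpret finite_measure "lebesgue_on \<Omega>" by (rule finite_measure_lebesgue_on[OF l])
  note U = W1p_classical[OF assms(1-3) u G K]
  note F = W1p_classical[OF assms(1-3) test_function_grad[OF \<phi>] \<phi>K]
  have conv: "(\<lambda>j. LINT x|lebesgue_on \<Omega>. norm (g x - h j x) powr p) \<longlonglongrightarrow> 0"
    if g: "g \<in> borel_measurable (lebesgue_on \<Omega>)" and h: "\<And>j. h j \<in> borel_measurable (lebesgue_on \<Omega>)"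
      and gK: "\<And>x. x \<in> \<Omega> \<Longrightarrow> norm (g x) \<le> K" and hK: "\<And>j x. x \<in> \<Omega> \<Longrightarrow> norm (h j x) \<le> K"
      and gh: "\<And>x. x \<in> \<Omega> \<Longrightarrow> (\<lambda>j. h j x) \<longlonglongrightarrow> g x"
    for g :: "'a \<Rightarrow> 'b::euclidean_space" and h :: "nat \<Rightarrow> 'a \<Rightarrow> 'b"
  proof -
    have "(\<lambda>j. LINT x|lebesgue_on \<Omega>. norm (g x - h j x) powr p) \<longlonglongrightarrow> (LINT x|lebesgue_on \<Omega>. 0)"
    proof (rule integral_dominated_convergence[where w = "\<lambda>x. (2 * K) powr p"])
      show "AE x in lebesgue_on \<Omega>. (\<lambda>j. norm (g x - h j x) powr p) \<longlonglongrightarrow> 0"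
      proof (rule AE_I2)
        fix x assume "x \<in> space (lebesgue_on \<Omega>)"
        then have "(\<lambda>j. norm (g x - h j x)) \<longlonglongrightarrow> norm (g x - g x)"
          by (intro tendsto_intros gh) simp
        then have "(\<lambda>j. norm (g x - h j x) powr p) \<longlonglongrightarrow> norm (g x - g x) powr p"
          using assms(3) by (intro tendsto_powr') auto
        then show "(\<lambda>j. norm (g x - h j x) powr p) \<longlonglongrightarrow> 0" by simp
      qed
      show "AE x in lebesgue_on \<Omega>. norm (norm (g x - h j x) powr p) \<le> (2 * K) powr p" for j
      proof (rule AE_I2)
        fix x assume x: "x \<in> space (lebesgue_on \<Omega>)"
        have "norm (g x - h j x) \<le> 2 * K"
          using norm_triangle_ineq4[of "g x" "h j x"] gK[of x] hK[of x j] x by simp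
        then show "norm (norm (g x - h j x) powr p) \<le> (2 * K) powr p"
          using assms(3) by (simp add: powr_mono2)
      qed
    qed (use g h in measurable)
    then show ?thesis by simp
  qed
  have "(\<lambda>j. ((LINT x|lebesgue_on \<Omega>. norm (u x - \<phi> j x) powr p) +
     (LINT x|lebesgue_on \<Omega>. norm (G x - grad (\<phi> j) x) powr p)) powr (1 / p)) \<longlonglongrightarrow> (0 + 0) powr (1 / p)"
    using assms(3) by (intro tendsto_powr' tendsto_add conv tendsto_const U F K \<phi>K lim)
      (auto intro!: always_eventually add_nonneg_nonneg K \<phi>K)
  moreover have "W1p_norm p \<Omega> (\<lambda>x. u x - \<phi> j x) = ((LINT x|lebesgue_on \<Omega>. norm (u x - \<phi> j x) powr p) +
     (LINT x|lebesgue_on \<Omega>. norm (G x - grad (\<phi> j) x) powr p)) powr (1 / p)" for j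
    by (subst W1p_norm_eq[OF assms(1) is_weak_gradient_diff[OF assms(1) U(2) F(2)]])
      (use U(3) F(3) in \<open>auto intro: borel_measurable_diff\<close>)
  ultimately have "(\<lambda>j. W1p_norm p \<Omega> (\<lambda>x. u x - \<phi> j x)) \<longlonglongrightarrow> 0" by simp
  then show ?thesis using U(1) \<phi> by (auto simp: W1p_0_def)
qed

text \<open>A substitute for Hoelder's inequality.\<close>

lemma le_add_powr_mult:
  fixes y \<epsilon> p :: real
  assumes "p \<ge> 1" "\<epsilon> > 0" "y \<ge> 0"
  shows "y \<le> \<epsilon> + \<epsilon> powr (1 - p) * y powr p"
proof (cases "y \<le> \<epsilon>")
  case False
  then have "y powr (1 - p) \<le> \<epsilon> powr (1 - p)"
    using assms by (intro powr_mono2') auto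
  then have "y powr (1 - p) * y powr p \<le> \<epsilon> powr (1 - p) * y powr p"
    by (intro mult_right_mono) auto
  moreover have "y powr (1 - p) * y powr p = y"
    using False assms by (simp flip: powr_add)
  ultimately show ?thesis using assms(2) by simp
qed (use assms in \<open>simp add: add_increasing2\<close>)

text \<open>Integrates \<open>le_add_powr_mult\<close>. If p-th power integrals tend to 0, sending
  them to 0 for fixed \<open>\<epsilon>\<close> and then \<open>\<epsilon>\<close> to 0 shows that
  the integrals of the norm tend to 0 as well.\<close>

lemma Lp_integrable_norm:
  fixes f :: "'a::euclidean_space \<Rightarrow> 'b::euclidean_space"
  assumes "S \<in> lmeasurable" "p \<ge> 1" "f \<in> Lp p S" "\<epsilon> > 0"
  shows "integrable (lebesgue_on S) f"
    and "(LINT x|lebesgue_on S. norm (f x)) \<le>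
      \<epsilon> * measure lebesgue S + \<epsilon> powr (1 - p) * (LINT x|lebesgue_on S. norm (f x) powr p)"
proof -
  interpret finite_measure "lebesgue_on S" by (rule finite_measure_lebesgue_on[OF assms(1)])
  have S: "S \<in> sets lebesgue" using assms(1) by (simp add: fmeasurable_def)
  have f: "f \<in> borel_measurable (lebesgue_on S)" "integrable (lebesgue_on S) (\<lambda>x. norm (f x) powr p)"
    using assms(3) by (auto simp: Lp_def)
  have i: "integrable (lebesgue_on S) (\<lambda>x. \<epsilon> + \<epsilon> powr (1 - p) * norm (f x) powr p)" if "\<epsilon> > 0" for \<epsilon>
    using f(2) by simp
  have le: "norm (f x) \<le> \<epsilon> + \<epsilon> powr (1 - p) * norm (f x) powr p" for x
    by (rule le_add_powr_mult[OF assms(2,4)]) simp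
  show "integrable (lebesgue_on S) f"
    by (rule Bochner_Integration.integrable_bound[OF i[OF assms(4)] f(1)])
      (use le assms(4) in \<open>auto intro!: AE_I2\<close>)
  then have "(LINT x|lebesgue_on S. norm (f x)) \<le>
      (LINT x|lebesgue_on S. \<epsilon> + \<epsilon> powr (1 - p) * norm (f x) powr p)"
    by (intro integral_mono i assms(4) le) auto
  also have "\<dots> = \<epsilon> * measure lebesgue S + \<epsilon> powr (1 - p) * (LINT x|lebesgue_on S. norm (f x) powr p)"
    using f(2) S by (simp add: measure_restrict_space mult.commute)
  finally show "(LINT x|lebesgue_on S. norm (f x)) \<le>
      \<epsilon> * measure lebesgue S + \<epsilon> powr (1 - p) * (LINT x|lebesgue_on S. norm (f x) powr p)" .
qed

lemma integral_abs_le_of_bound: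
  fixes f :: "'a \<Rightarrow> 'b::{banach, second_countable_topology}" and h :: "'a \<Rightarrow> real"
  assumes f: "integrable M f" and h: "h \<in> borel_measurable M"
    and b: "\<And>x. x \<in> space M \<Longrightarrow> \<bar>h x\<bar> \<le> K * norm (f x)"
  shows "integrable M h" and "\<bar>integral\<^sup>L M h\<bar> \<le> K * (\<integral>x. norm (f x) \<partial>M)"
proof -
  have Kf: "integrable M (\<lambda>x. K * norm (f x))"
    by (intro integrable_mult_right integrable_norm f)
  show i: "integrable M h"
  proof (rule Bochner_Integration.integrable_bound[OF Kf h], rule AE_I2)
    show "norm (h x) \<le> norm (K * norm (f x))" if "x \<in> space M" for x
      using b[OF that] abs_ge_self[of "K * norm (f x)"] unfolding real_norm_def by linarith
  qed
  have "\<bar>integral\<^sup>L M h\<bar> \<le> (\<integral>x. \<bar>h x\<bar> \<partial>M)"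
    by (rule integral_abs_bound)
  also have "\<dots> \<le> (\<integral>x. K * norm (f x) \<partial>M)"
    by (intro integral_mono Kf integrable_abs i b)
  finally show "\<bar>integral\<^sup>L M h\<bar> \<le> K * (\<integral>x. norm (f x) \<partial>M)" by simp
qed

text \<open>As \<open>X\<close> and \<open>g\<close> are bounded, both sides are continuous in
  \<open>w\<close> for convergence of \<open>w\<close> and its gradient in the mean. Approximation
  of \<open>w\<close> by test functions in the Sobolev norm implies this, since
  \<open>\<Omega>\<close> has finite measure.\<close>

lemma weak_equation_W1p_0:
  fixes X :: "'a::euclidean_space \<Rightarrow> 'a" and g w :: "'a \<Rightarrow> real"
  assumes "open \<Omega>" "bounded \<Omega>" and p: "p \<ge> 1"
    and X: "X \<in> borel_measurable (lebesgue_on \<Omega>)" "\<And>x. x \<in> \<Omega> \<Longrightarrow> norm (X x) \<le> K"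
    and g: "g \<in> borel_measurable (lebesgue_on \<Omega>)" "\<And>x. x \<in> \<Omega> \<Longrightarrow> \<bar>g x\<bar> \<le> K"
    and test: "\<And>\<phi>. \<phi> \<in> test_functions \<Omega> \<Longrightarrow>
      (LINT x|lebesgue_on \<Omega>. X x \<bullet> grad \<phi> x) = (LINT x|lebesgue_on \<Omega>. g x * \<phi> x)"
    and w: "w \<in> W1p_0 p \<Omega>"
  shows "integrable (lebesgue_on \<Omega>) (\<lambda>x. g x * w x)"
    and "(LINT x|lebesgue_on \<Omega>. X x \<bullet> weak_gradient \<Omega> w x) = (LINT x|lebesgue_on \<Omega>. g x * w x)"
proof -
  have l: "\<Omega> \<in> lmeasurable" using assms by (intro lmeasurable_open)
  have \<Omega>: "\<Omega> \<in> sets lebesgue" using assms(1) by auto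
  have w1: "w \<in> W1p p \<Omega>" and wLp: "w \<in> Lp p \<Omega>" using w by (auto simp: W1p_0_def W1p_def)
  obtain \<phi> where \<phi>: "\<And>j::nat. \<phi> j \<in> test_functions \<Omega>"
    "(\<lambda>j. W1p_norm p \<Omega> (\<lambda>x. w x - \<phi> j x)) \<longlonglongrightarrow> 0"
    using w by (auto simp: W1p_0_def)
  let ?D = "weak_gradient \<Omega> w"
  note W = W1p_weak_gradient[OF assms(1) w1]
  have int_mult: "integrable (lebesgue_on \<Omega>) (\<lambda>x. g x * f x)"
    "\<bar>LINT x|lebesgue_on \<Omega>. g x * f x\<bar> \<le> K * (LINT x|lebesgue_on \<Omega>. norm (f x))"
    if f: "integrable (lebesgue_on \<Omega>) f" for f :: "'a \<Rightarrow> real"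
    by (rule integral_abs_le_of_bound[OF f, where K = K]; use f g in \<open>simp add: abs_mult mult_right_mono\<close>)+
  have int_inner: "integrable (lebesgue_on \<Omega>) (\<lambda>x. X x \<bullet> f x)"
    "\<bar>LINT x|lebesgue_on \<Omega>. X x \<bullet> f x\<bar> \<le> K * (LINT x|lebesgue_on \<Omega>. norm (f x))"
    if f: "integrable (lebesgue_on \<Omega>) f" for f :: "'a \<Rightarrow> 'a"
  proof -
    have b: "\<bar>X x \<bullet> f x\<bar> \<le> K * norm (f x)" if "x \<in> \<Omega>" for x
      using Cauchy_Schwarz_ineq2[of "X x" "f x"] mult_right_mono[OF X(2)[OF that], of "norm (f x)"] by simp
    show "integrable (lebesgue_on \<Omega>) (\<lambda>x. X x \<bullet> f x)"
      "\<bar>LINT x|lebesgue_on \<Omega>. X x \<bullet> f x\<bar> \<le> K * (LINT x|lebesgue_on \<Omega>. norm (f x))"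
      by (rule integral_abs_le_of_bound[OF f, where K = K]; use f X(1) b in simp)+
  qed
  note Lint = Lp_integrable_norm(1)[OF l p _ zero_less_one]
  show "integrable (lebesgue_on \<Omega>) (\<lambda>x. g x * w x)"
    by (rule int_mult(1)[OF Lint[OF wLp]])
  let ?d = "\<bar>(LINT x|lebesgue_on \<Omega>. X x \<bullet> ?D x) - (LINT x|lebesgue_on \<Omega>. g x * w x)\<bar>"
  \<comment> \<open>The p-th power undoes the root in the norm: \<open>T j\<close> is the sum of the
    two integrals that appear in \<open>Lp_integrable_norm\<close>.\<close>
  define T where "T j = (W1p_norm p \<Omega> (\<lambda>x. w x - \<phi> j x)) powr p" for j
  have bound: "?d \<le> K * (2 * \<epsilon> * measure lebesgue \<Omega> + \<epsilon> powr (1 - p) * T j)" if "\<epsilon> > 0" "K \<ge> 0" for \<epsilon> j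
  proof -
    obtain B where B: "\<And>x. \<bar>\<phi> j x\<bar> \<le> B" "\<And>x. norm (grad (\<phi> j) x) \<le> B"
      by (rule test_function_bounded[OF \<phi>(1)[of j]]) (rule that)
    have p0: "p > 0" using p by simp
    note F = W1p_classical[OF assms(1,2) p0 test_function_grad[OF \<phi>(1)] B]
    have F1: "\<phi> j \<in> Lp p \<Omega>" "grad (\<phi> j) \<in> Lp p \<Omega>"
      using p B by (auto intro!: Lp_bounded[OF l, of _ B] F(3,4))
    have i: "integrable (lebesgue_on \<Omega>) w" "integrable (lebesgue_on \<Omega>) ?D"
      "integrable (lebesgue_on \<Omega>) (\<phi> j)" "integrable (lebesgue_on \<Omega>) (grad (\<phi> j))"
      using Lint wLp W(2) F1 by auto
    have iwg: "is_weak_gradient \<Omega> (\<lambda>x. w x - \<phi> j x) (\<lambda>x. ?D x - grad (\<phi> j) x)"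
      by (rule is_weak_gradient_diff[OF assms(1) W(1) F(2)])
    have Lpd: "(\<lambda>x. w x - \<phi> j x) \<in> Lp p \<Omega>" "(\<lambda>x. ?D x - grad (\<phi> j) x) \<in> Lp p \<Omega>"
      using p by (auto intro!: Lp_diff wLp W(2) F1)
    have n: "W1p_norm p \<Omega> (\<lambda>x. w x - \<phi> j x) = ((LINT x|lebesgue_on \<Omega>. norm (w x - \<phi> j x) powr p) +
        (LINT x|lebesgue_on \<Omega>. norm (?D x - grad (\<phi> j) x) powr p)) powr (1 / p)"
      by (subst W1p_norm_eq[OF assms(1) iwg]) (use i in auto)
    have T: "T j = (LINT x|lebesgue_on \<Omega>. norm (w x - \<phi> j x) powr p) +
        (LINT x|lebesgue_on \<Omega>. norm (?D x - grad (\<phi> j) x) powr p)"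
      unfolding T_def n using p by (simp add: powr_powr)
    have "(LINT x|lebesgue_on \<Omega>. X x \<bullet> ?D x) - (LINT x|lebesgue_on \<Omega>. g x * w x) =
        (LINT x|lebesgue_on \<Omega>. X x \<bullet> (?D x - grad (\<phi> j) x)) - (LINT x|lebesgue_on \<Omega>. g x * (w x - \<phi> j x))"
      using test[OF \<phi>(1), of j] int_mult(1)[OF i(1)] int_mult(1)[OF i(3)] int_inner(1)[OF i(2)] int_inner(1)[OF i(4)]
      by (simp add: inner_diff_right right_diff_distrib)
    then have "?d \<le> K * (LINT x|lebesgue_on \<Omega>. norm (?D x - grad (\<phi> j) x)) +
        K * (LINT x|lebesgue_on \<Omega>. norm (w x - \<phi> j x))"
      using int_inner(2)[OF Bochner_Integration.integrable_diff[OF i(2,4)]]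
        int_mult(2)[OF Bochner_Integration.integrable_diff[OF i(1,3)]] by linarith
    also have "\<dots> = K * ((LINT x|lebesgue_on \<Omega>. norm (?D x - grad (\<phi> j) x)) +
        (LINT x|lebesgue_on \<Omega>. norm (w x - \<phi> j x)))" by (simp add: distrib_left)
    also have "\<dots> \<le> K * (2 * \<epsilon> * measure lebesgue \<Omega> + \<epsilon> powr (1 - p) * T j)"
      using Lp_integrable_norm(2)[OF l p Lpd(1) that(1)] Lp_integrable_norm(2)[OF l p Lpd(2) that(1)]
      unfolding T by (intro mult_left_mono that(2)) (simp add: algebra_simps)
    finally show ?thesis .
  qed
  have "?d \<le> 0"
  \<comment> \<open>A negative \<open>K\<close> cannot bound an absolute value, so then
    \<open>\<Omega>\<close> is empty.\<close>
  proof (cases "K \<ge> 0")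
    case True
    have T0: "T \<longlonglongrightarrow> 0"
      using tendsto_powr'[OF \<phi>(2) tendsto_const[of p]] p by (simp add: T_def[abs_def] W1p_norm_def)
    \<comment> \<open>First \<open>j\<close> tends to infinity with \<open>\<epsilon>\<close> fixed,
      afterwards \<open>\<epsilon>\<close> tends to 0.\<close>
    have "?d \<le> K * (2 * \<epsilon> * measure lebesgue \<Omega> + \<epsilon> powr (1 - p) * 0)" if "\<epsilon> > 0" for \<epsilon>
    proof (rule LIMSEQ_le_const)
      show "(\<lambda>j. K * (2 * \<epsilon> * measure lebesgue \<Omega> + \<epsilon> powr (1 - p) * T j)) \<longlonglongrightarrow>
          K * (2 * \<epsilon> * measure lebesgue \<Omega> + \<epsilon> powr (1 - p) * 0)"
        by (intro tendsto_intros T0)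
    qed (use bound[OF that True] in blast)
    moreover have "K * (2 * \<epsilon> * measure lebesgue \<Omega> + \<epsilon> powr (1 - p) * 0) = (2 * K * measure lebesgue \<Omega>) * \<epsilon>" for \<epsilon>
      by simp
    ultimately have "?d \<le> (2 * K * measure lebesgue \<Omega>) * \<epsilon>" if "\<epsilon> > 0" for \<epsilon>
      using that by metis
    then have "eventually (\<lambda>\<epsilon>. ?d \<le> (2 * K * measure lebesgue \<Omega>) * \<epsilon>) (at_right 0)"
      unfolding eventually_at_right_field by (intro exI[of _ 1]) auto
    moreover have "((\<lambda>\<epsilon>. (2 * K * measure lebesgue \<Omega>) * \<epsilon>) \<longlongrightarrow> (2 * K * measure lebesgue \<Omega>) * 0) (at_right 0)"
      by (intro tendsto_intros)
    ultimately have "?d \<le> (2 * K * measure lebesgue \<Omega>) * 0"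
      by (intro tendsto_lowerbound) auto
    then show ?thesis by simp
  next
    case False
    then have "\<Omega> = {}" using g(2) by (metis abs_ge_zero all_not_in_conv order_trans)
    then show ?thesis by simp
  qed
  then show "(LINT x|lebesgue_on \<Omega>. X x \<bullet> ?D x) = (LINT x|lebesgue_on \<Omega>. g x * w x)" by simp
qed

text \<open>Differentiability is asked of the flux \<open>X\<close>, while the gradient
  \<open>G\<close> is merely continuous: at zeros of the gradient the flux may be smoother than
  \<open>G\<close>. Integration by parts in each coordinate and the divergence identity give the
  equation for test functions, density gives it for \<open>w\<close>, and uniqueness of weak
  gradients replaces \<open>G\<close> by \<open>weak_gradient\<close>.\<close>

lemma weak_solution_classical:
  fixes u g w :: "'a::euclidean_space \<Rightarrow> real" and X :: "'a \<Rightarrow> 'a"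
  assumes "open \<Omega>" "bounded \<Omega>" and p: "p \<ge> 1"
    and u: "\<And>x. x \<in> \<Omega> \<Longrightarrow> (u has_derivative (\<lambda>h. G x \<bullet> h)) (at x)"
    and G: "continuous_on \<Omega> G"
    and X: "\<And>x. x \<in> \<Omega> \<Longrightarrow> norm (G x) powr (p - 2) *\<^sub>R G x = X x" "\<And>x. x \<in> \<Omega> \<Longrightarrow> norm (X x) \<le> K"
    and X': "\<And>x. x \<in> \<Omega> \<Longrightarrow> (X has_derivative X' x) (at x)"
      "\<And>i. i \<in> Basis \<Longrightarrow> continuous_on \<Omega> (\<lambda>x. X' x i)"
    and g: "continuous_on \<Omega> g" "\<And>x. x \<in> \<Omega> \<Longrightarrow> \<bar>g x\<bar> \<le> K"
    and div: "\<And>x. x \<in> \<Omega> \<Longrightarrow> (\<Sum>i\<in>Basis. X' x i \<bullet> i) = - g x"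
    and w: "w \<in> W1p_0 p \<Omega>"
  shows "integrable (lebesgue_on \<Omega>) (\<lambda>x. g x * w x)"
    and "(LINT x|lebesgue_on \<Omega>. (norm (weak_gradient \<Omega> u x) powr (p - 2) *\<^sub>R weak_gradient \<Omega> u x)
      \<bullet> weak_gradient \<Omega> w x) = (LINT x|lebesgue_on \<Omega>. g x * w x)"
proof -
  have \<Omega>: "\<Omega> \<in> sets lebesgue" using assms(1) by auto
  have contX: "continuous_on \<Omega> X"
    by (rule has_derivative_continuous_on) (use X'(1) in \<open>auto intro: has_derivative_at_withinI\<close>)
  have Xm: "X \<in> borel_measurable (lebesgue_on \<Omega>)" and gm: "g \<in> borel_measurable (lebesgue_on \<Omega>)"
    using assms(1) contX g(1) by (auto intro: borel_measurable_continuous_on_open)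
  have test: "(LINT x|lebesgue_on \<Omega>. X x \<bullet> grad \<phi> x) = (LINT x|lebesgue_on \<Omega>. g x * \<phi> x)"
    if \<phi>: "\<phi> \<in> test_functions \<Omega>" for \<phi>
  proof -
    have Xi: "((\<lambda>x. X x \<bullet> i) has_derivative (\<lambda>h. X' x h \<bullet> i)) (at x)" if "x \<in> \<Omega>" for x i
      using X'(1)[OF that] by (rule has_derivative_inner_left)
    have cX': "continuous_on \<Omega> (\<lambda>x. X' x i \<bullet> i)" if "i \<in> Basis" for i
      by (intro continuous_intros X'(2) that)
    note P = integral_by_parts_test_function[OF assms(1) Xi cX' \<phi>]
    have "(LINT x|lebesgue_on \<Omega>. X x \<bullet> grad \<phi> x) =
        (LINT x|lebesgue_on \<Omega>. (\<Sum>i\<in>Basis. (X x \<bullet> i) * frechet_derivative \<phi> (at x) i))"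
      by (simp add: grad_def inner_sum_right mult.commute)
    also have "\<dots> = (\<Sum>i\<in>Basis. - (LINT x|lebesgue_on \<Omega>. (X' x i \<bullet> i) * \<phi> x))"
      using P by (subst Bochner_Integration.integral_sum) auto
    also have "\<dots> = - (LINT x|lebesgue_on \<Omega>. (\<Sum>i\<in>Basis. (X' x i \<bullet> i) * \<phi> x))"
      using P(2) by (subst Bochner_Integration.integral_sum) (auto simp: sum_negf)
    also have "\<dots> = - (LINT x|lebesgue_on \<Omega>. - (g x * \<phi> x))"
      using div by (intro arg_cong[of _ _ uminus] Bochner_Integration.integral_cong)
        (auto simp: sum_distrib_right[symmetric])
    finally show ?thesis by simp
  qed
  note E = weak_equation_W1p_0[OF assms(1,2) p Xm X(2) gm g(2) test w]
  show "integrable (lebesgue_on \<Omega>) (\<lambda>x. g x * w x)" by (rule E)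
  let ?D = "weak_gradient \<Omega> u"
  have ae: "AE x in lebesgue_on \<Omega>. (norm (?D x) powr (p - 2) *\<^sub>R ?D x) \<bullet> weak_gradient \<Omega> w x = X x \<bullet> weak_gradient \<Omega> w x"
    using weak_gradient_AE_eq[OF assms(1) is_weak_gradient_classical[OF assms(1) u G, simplified]]
      AE_space[of "lebesgue_on \<Omega>"] by eventually_elim (use X(1) in simp)
  have "weak_gradient \<Omega> w \<in> borel_measurable (lebesgue_on \<Omega>)"
    using W1p_weak_gradient(2)[OF assms(1), of w p] w by (auto simp: W1p_0_def Lp_def)
  then have m: "(\<lambda>x. X x \<bullet> weak_gradient \<Omega> w x) \<in> borel_measurable (lebesgue_on \<Omega>)"
    using Xm by measurable
  have "(LINT x|lebesgue_on \<Omega>. (norm (?D x) powr (p - 2) *\<^sub>R ?D x) \<bullet> weak_gradient \<Omega> w x) =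
      (LINT x|lebesgue_on \<Omega>. X x \<bullet> weak_gradient \<Omega> w x)"
    by (rule integral_cong_AE[OF borel_measurable_lebesgue_on_cong_AE[OF \<Omega> ae m] m ae])
  with E(2) show "(LINT x|lebesgue_on \<Omega>. (norm (?D x) powr (p - 2) *\<^sub>R ?D x) \<bullet> weak_gradient \<Omega> w x) =
    (LINT x|lebesgue_on \<Omega>. g x * w x)" by simp
qed

text \<open>A difference at one point persists on a nonempty open set, which is not negligible. Thus
  nontriviality and distinctness of solutions can be read off at single points.\<close>

lemma continuous_AE_eq_imp_eq:
  fixes u v :: "'a::euclidean_space \<Rightarrow> real"
  assumes "open \<Omega>" "continuous_on \<Omega> u" "continuous_on \<Omega> v"
    and ae: "AE x in lebesgue_on \<Omega>. u x = v x" and "x \<in> \<Omega>"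
  shows "u x = v x"
proof (rule ccontr)
  assume "u x \<noteq> v x"
  let ?U = "{x \<in> \<Omega>. u x \<noteq> v x}"
  have "open ?U"
  proof -
    have "open (\<Omega> \<inter> (\<lambda>x. u x - v x) -` (- {0}))"
      by (intro continuous_open_preimage continuous_on_diff assms) auto
    also have "\<Omega> \<inter> (\<lambda>x. u x - v x) -` (- {0}) = ?U" by auto
    finally show ?thesis .
  qed
  moreover have "negligible ?U"
  proof -
    have "AE x in lebesgue. x \<notin> ?U"
      using ae assms(1) by (auto simp: AE_restrict_space_iff elim!: eventually_mono)
    then show ?thesis
      by (simp add: completion.AE_iff_null_sets negligible_iff_null_sets)
  qed
  ultimately show False
    using \<open>u x \<noteq> v x\<close> assms(5) open_not_negligible by blast
qed

section \<open>Discretised variational problem\<close>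

text \<open>The signed power. \<open>spow (p - 1)\<close> is the map s |s|^(p - 2) of the
  one-dimensional p-Laplacian; for p > 1 it is an odd bijection of the line with inverse
  \<open>spow (1 / (p - 1))\<close>.\<close>

definition spow :: "real \<Rightarrow> real \<Rightarrow> real" where
  "spow r s = sgn s * \<bar>s\<bar> powr r"

lemma abs_spow: "\<bar>spow r s\<bar> = \<bar>s\<bar> powr r"
  by (auto simp: spow_def abs_mult sgn_if)

lemma spow_nonneg: "s \<ge> 0 \<Longrightarrow> spow r s \<ge> 0" and spow_nonpos: "s \<le> 0 \<Longrightarrow> spow r s \<le> 0"
  by (auto simp: spow_def sgn_if)

lemma spow_0 [simp]: "spow r 0 = 0"
  by (simp add: spow_def)

lemma spow_spow: "spow r (spow r' s) = spow (r' * r) s"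
  by (auto simp: spow_def sgn_if powr_powr abs_mult)

lemma spow_1: "spow 1 s = s"
  by (auto simp: spow_def sgn_if)

lemma continuous_on_spow: "r > 0 \<Longrightarrow> continuous_on S (spow r)"
proof -
  assume r: "r > 0"
  have "continuous_on S (\<lambda>s. max s 0 powr r - max (- s) 0 powr r)"
    using r by (intro continuous_intros continuous_on_powr') auto
  moreover have "(\<lambda>s. max s 0 powr r - max (- s) 0 powr r) = spow r"
    by (auto simp: spow_def sgn_if max_def fun_eq_iff)
  ultimately show "continuous_on S (spow r)" by metis
qed

lemma abs_powr_has_derivative:
  assumes p: "p > 1"
  shows "((\<lambda>s. \<bar>s\<bar> powr p / p) has_real_derivative spow (p - 1) s) (at s)"
proof -
  consider "s > 0" | "s < 0" | "s = 0" by linarith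
  then show ?thesis
  proof cases
    case 1
    have "((\<lambda>s. s powr p / p) has_real_derivative spow (p - 1) s) (at s)"
      using 1 p by (auto intro!: derivative_eq_intros simp: spow_def)
    then show ?thesis
      by (rule has_field_derivative_transform_within_open[of _ _ _ "{0<..}"]) (use 1 in auto)
  next
    case 2
    have "((\<lambda>s. (- s) powr p / p) has_real_derivative spow (p - 1) s) (at s)"
      using 2 p by (auto intro!: derivative_eq_intros simp: spow_def)
    then show ?thesis
      by (rule has_field_derivative_transform_within_open[of _ _ _ "{..<0}"]) (use 2 in auto)
  next
    case 3
    \<comment> \<open>The difference quotient of |h|^p / p at 0 is
      \<open>spow (p - 1) h / p\<close>, so continuity of the signed power suffices.\<close>
    have "isCont (spow (p - 1)) 0"
      using continuous_on_spow[of "p - 1" UNIV] p by (simp add: continuous_on_eq_continuous_at)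
    then have "((\<lambda>h. spow (p - 1) h / p) \<longlongrightarrow> spow (p - 1) 0 / p) (at 0)"
      using p by (intro tendsto_intros) (auto simp: isCont_def)
    then have lim: "((\<lambda>h. spow (p - 1) h / p) \<longlongrightarrow> 0) (at 0)" by simp
    have "spow (p - 1) h / p = \<bar>h\<bar> powr p / p / h" if "h \<noteq> 0" for h
      using that by (auto simp: spow_def sgn_if powr_diff)
    then have "eventually (\<lambda>h. spow (p - 1) h / p = \<bar>h\<bar> powr p / p / h) (at 0)"
      by (simp add: eventually_at_filter)
    with lim have "((\<lambda>h. \<bar>h\<bar> powr p / p / h) \<longlongrightarrow> 0) (at 0)"
      by (rule Lim_transform_eventually)
    then show ?thesis using 3 by (simp add: DERIV_def)
  qed
qed

section \<open>Constrained minimisation over grid functions\<close>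

lemma constrained_min_derivative:
  fixes e :: "real \<Rightarrow> real"
  assumes "(e has_real_derivative D) (at y)" "y \<in> {a..b}" "\<And>z. z \<in> {a..b} \<Longrightarrow> e y \<le> e z"
  shows "y < b \<Longrightarrow> D \<ge> 0" "y > a \<Longrightarrow> D \<le> 0"
proof -
  show "D \<ge> 0" if "y < b"
  proof (rule ccontr)
    assume "\<not> D \<ge> 0"
    then obtain d where d: "d > 0" "\<forall>h>0. h < d \<longrightarrow> e (y + h) < e y"
      using DERIV_neg_dec_right[OF assms(1)] by auto
    define h where "h = min (d / 2) (b - y)"
    have "h > 0" "h < d" "y + h \<in> {a..b}" using d that assms(2) by (auto simp: h_def)
    then show False using d(2) assms(3) by force
  qed
  show "D \<le> 0" if "y > a"
  proof (rule ccontr)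
    assume "\<not> D \<le> 0"
    then obtain d where d: "d > 0" "\<forall>h>0. h < d \<longrightarrow> e (y - h) < e y"
      using DERIV_pos_inc_left[OF assms(1)] by auto
    define h where "h = min (d / 2) (y - a)"
    have "h > 0" "h < d" "y - h \<in> {a..b}" using d that assms(2) by (auto simp: h_def)
    then show False using d(2) assms(3) by force
  qed
qed

text \<open>Grid functions live on all natural numbers and vanish off the inner nodes. The set is
  then a product of compact sets, to which Tychonoff's theorem applies, and the Dirichlet condition
  at the nodes 0 and \<open>n\<close> is built in.\<close>

definition grid_box :: "real \<Rightarrow> nat \<Rightarrow> (nat \<Rightarrow> real) set" where
  "grid_box \<alpha> n = {v. \<forall>i. if 0 < i \<and> i < n then v i \<in> {0..\<alpha>} else v i = 0}"

definition grid_slope :: "nat \<Rightarrow> (nat \<Rightarrow> real) \<Rightarrow> nat \<Rightarrow> real" where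
  "grid_slope n v i = real n * (v (Suc i) - v i)"

text \<open>This is \<open>n\<close> times the energy of the piecewise linear interpolant, up to a Riemann sum.\<close>

definition grid_energy ::
  "real \<Rightarrow> (real \<Rightarrow> real) \<Rightarrow> (real \<Rightarrow> real) \<Rightarrow> nat \<Rightarrow> (nat \<Rightarrow> real) \<Rightarrow> real" where
  "grid_energy p q F n v =
    (\<Sum>i<n. \<bar>grid_slope n v i\<bar> powr p / p) - (\<Sum>i<n. q (real i / real n) * F (v i))"

lemma grid_boxD:
  assumes "v \<in> grid_box \<alpha> n" "\<alpha> \<ge> 0"
  shows "0 \<le> v i" "v i \<le> \<alpha>" "v 0 = 0" "i \<ge> n \<Longrightarrow> v i = 0"
  using assms by (auto simp: grid_box_def split: if_splits dest: spec[of _ i] spec[of _ 0])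

lemma compact_grid_box: "compact (grid_box \<alpha> n)"
proof -
  define K where "K i = (if 0 < i \<and> i < n then {0..\<alpha>} else {0::real})" for i
  have "compactin (product_topology (\<lambda>i. euclidean) UNIV) (PiE UNIV K)"
    by (subst compactin_PiE) (auto simp: K_def)
  moreover have "PiE UNIV K = grid_box \<alpha> n"
    by (force simp: PiE_def Pi_def K_def grid_box_def split: if_splits)
  ultimately show ?thesis by (simp add: euclidean_product_topology)
qed

lemma grid_energy_minimiser:
  assumes "p > 1" "\<alpha> \<ge> 0" "continuous_on UNIV F"
  obtains v where "v \<in> grid_box \<alpha> n" "\<And>w. w \<in> grid_box \<alpha> n \<Longrightarrow> grid_energy p q F n v \<le> grid_energy p q F n w"
proof -
  have "(\<lambda>i. 0) \<in> grid_box \<alpha> n" using assms by (simp add: grid_box_def)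
  moreover have "continuous_on (grid_box \<alpha> n) (grid_energy p q F n)"
  proof -
    have c: "continuous_on (grid_box \<alpha> n) (\<lambda>v. v i)" for i
      by (rule continuous_on_subset[OF continuous_on_product_coordinates]) simp
    have "continuous_on (grid_box \<alpha> n) (\<lambda>v. F (v i))" for i
      by (rule continuous_on_compose2[OF assms(3) c]) simp
    moreover have "continuous_on (grid_box \<alpha> n) (\<lambda>v. \<bar>grid_slope n v i\<bar> powr p)" for i
      unfolding grid_slope_def using assms(1)
      by (intro continuous_on_powr' continuous_on_rabs continuous_on_mult continuous_on_diff c continuous_on_const) simp
    ultimately show ?thesis
      unfolding grid_energy_def[abs_def] using assms(1)
      by (intro continuous_on_diff continuous_on_sum continuous_on_divide continuous_on_mult continuous_on_const) auto
  qed
  ultimately obtain v where "v \<in> grid_box \<alpha> n"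
    "\<forall>w\<in>grid_box \<alpha> n. grid_energy p q F n v \<le> grid_energy p q F n w"
    using continuous_attains_inf[OF compact_grid_box] by blast
  then show ?thesis using that by blast
qed

text \<open>The value at node \<open>i\<close> enters only the slopes of the cells
  \<open>i - 1\<close> and \<open>i\<close>, with opposite signs, and one summand of the potential.
  The Kronecker symbols pick out these contributions.\<close>

lemma grid_energy_update_derivative:
  assumes p: "p > 1" and F: "\<And>y. (F has_real_derivative f y) (at y)" and i: "0 < i" "i < n"
  shows "((\<lambda>y. grid_energy p q F n (v(i := y))) has_real_derivative
    real n * spow (p - 1) (grid_slope n v (i - 1)) - real n * spow (p - 1) (grid_slope n v i)
      - q (real i / real n) * f (v i)) (at (v i))"
proof -
  let ?\<delta> = "\<lambda>j. if j = i then 1 else 0 :: real"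
  have upd: "((\<lambda>y. (v(i := y)) j) has_real_derivative ?\<delta> j) (at (v i))" for j
    by (cases "j = i") auto
  have slope: "((\<lambda>y. \<bar>grid_slope n (v(i := y)) j\<bar> powr p / p) has_real_derivative
      spow (p - 1) (grid_slope n v j) * (real n * (?\<delta> (Suc j) - ?\<delta> j))) (at (v i))" for j
  proof (rule DERIV_chain2[of "\<lambda>s. \<bar>s\<bar> powr p / p"])
    show "((\<lambda>y. grid_slope n (v(i := y)) j) has_real_derivative real n * (?\<delta> (Suc j) - ?\<delta> j)) (at (v i))"
      unfolding grid_slope_def by (intro DERIV_cmult DERIV_diff upd)
    show "((\<lambda>s. \<bar>s\<bar> powr p / p) has_real_derivative spow (p - 1) (grid_slope n v j))
        (at (grid_slope n (v(i := v i)) j))"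
      using abs_powr_has_derivative[OF p] by simp
  qed
  have pot: "((\<lambda>y. q (real j / real n) * F ((v(i := y)) j)) has_real_derivative
      q (real j / real n) * (f (v j) * ?\<delta> j)) (at (v i))" for j
    by (intro DERIV_cmult DERIV_chain2[of F, OF _ upd]) (use F in simp)
  have "(\<Sum>j<n. spow (p - 1) (grid_slope n v j) * (real n * (?\<delta> (Suc j) - ?\<delta> j))) =
      (\<Sum>j<n. if j = i - 1 then real n * spow (p - 1) (grid_slope n v (i - 1)) else 0) -
      (\<Sum>j<n. if j = i then real n * spow (p - 1) (grid_slope n v i) else 0)"
    unfolding sum_subtractf[symmetric] using i by (intro sum.cong) (auto split: if_splits)
  also have "\<dots> = real n * spow (p - 1) (grid_slope n v (i - 1)) - real n * spow (p - 1) (grid_slope n v i)"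
    using i by (subst (1 2) sum.delta) auto
  finally have 1: "(\<Sum>j<n. spow (p - 1) (grid_slope n v j) * (real n * (?\<delta> (Suc j) - ?\<delta> j))) = \<dots>" .
  have 2: "(\<Sum>j<n. q (real j / real n) * (f (v j) * ?\<delta> j)) = q (real i / real n) * f (v i)"
    using i by (simp add: sum.delta' if_distrib cong: if_cong)
  show ?thesis
    unfolding grid_energy_def 1[symmetric] 2[symmetric]
    by (intro DERIV_diff DERIV_sum slope pot)
qed

text \<open>The constraint \<open>0 \<le> v i \<le> \<alpha>\<close> is harmless: at both ends the sign of \<open>f\<close>
  makes the one-sided optimality condition an equality.\<close>

lemma grid_Euler_Lagrange:
  assumes p: "p > 1" and F: "\<And>y. (F has_real_derivative f y) (at y)" and \<alpha>: "\<alpha> > 0"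
    and f: "f 0 = 0" "f \<alpha> \<le> 0" and q: "\<And>t. t \<in> {0..1} \<Longrightarrow> q t \<ge> 0"
    and v: "v \<in> grid_box \<alpha> n"
    and min: "\<And>w. w \<in> grid_box \<alpha> n \<Longrightarrow> grid_energy p q F n v \<le> grid_energy p q F n w"
    and i: "0 < i" "i < n"
  shows "spow (p - 1) (grid_slope n v i) =
    spow (p - 1) (grid_slope n v (i - 1)) - q (real i / real n) * f (v i) / real n"
proof -
  note V = grid_boxD[OF v less_imp_le[OF \<alpha>]]
  let ?D = "real n * spow (p - 1) (grid_slope n v (i - 1)) - real n * spow (p - 1) (grid_slope n v i)
      - q (real i / real n) * f (v i)"
  have upd: "v(i := y) \<in> grid_box \<alpha> n" if "y \<in> {0..\<alpha>}" for y
    using V i that by (auto simp: grid_box_def not_less)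
  have D: "v i < \<alpha> \<Longrightarrow> ?D \<ge> 0" "v i > 0 \<Longrightarrow> ?D \<le> 0"
    using constrained_min_derivative[OF grid_energy_update_derivative[OF p F i, where v = v and q = q], of 0 \<alpha>]
      V min[OF upd] by auto
  have qi: "q (real i / real n) \<ge> 0" using q i by simp
  have "?D = 0"
  proof (rule antisym)
    show "?D \<le> 0"
    proof (cases "v i > 0")
      case False
      \<comment> \<open>The neighbouring values are nonnegative, so the slope does not increase into
        the node nor decrease after it: both flux terms are at most 0, and the potential term
        vanishes because \<open>f 0 = 0\<close>.\<close>
      then have vi: "v i = 0" using V(1)[of i] by simp
      have "grid_slope n v (i - 1) \<le> 0" "grid_slope n v i \<ge> 0"
        using i V(1) by (auto simp: grid_slope_def vi intro: mult_nonneg_nonneg mult_nonneg_nonpos)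
      then show ?thesis
        using vi f(1) spow_nonneg spow_nonpos by (simp add: mult_left_mono order_trans[of _ 0])
    qed (use D in simp)
    show "0 \<le> ?D"
    proof (cases "v i < \<alpha>")
      case False
      \<comment> \<open>The mirror image: no neighbour exceeds \<open>\<alpha>\<close>, so both flux
        terms are nonnegative, and so is the contribution of
        \<open>f \<alpha> \<le> 0\<close>.\<close>
      then have vi: "v i = \<alpha>" using V(2)[of i] by simp
      have "grid_slope n v (i - 1) \<ge> 0" "grid_slope n v i \<le> 0"
        using i V(2) by (auto simp: grid_slope_def vi intro: mult_nonneg_nonneg mult_nonneg_nonpos)
      then have "0 \<le> real n * spow (p - 1) (grid_slope n v (i - 1))" "real n * spow (p - 1) (grid_slope n v i) \<le> 0"
        using spow_nonneg spow_nonpos by (auto intro: mult_nonneg_nonneg mult_nonneg_nonpos)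
      moreover have "q (real i / real n) * f (v i) \<le> 0"
        using qi f(2) vi by (simp add: mult_nonneg_nonpos)
      ultimately show ?thesis by linarith
    qed (use D in simp)
  qed
  then show ?thesis using i by (simp add: field_simps)
qed

text \<open>A discrete Rolle argument. A nonnegative grid function that vanishes at both ends starts
  with flux \<ge> 0 and ends with flux \<le> 0. By the Euler-Lagrange equation the flux changes by
  at most C / n per node, hence by at most \<open>C\<close> in total, so every flux lies between -C
  and C.\<close>

lemma grid_minimiser_slopes:
  assumes p: "p > 1" and F: "\<And>y. (F has_real_derivative f y) (at y)" and \<alpha>: "\<alpha> > 0"
    and f: "f 0 = 0" "f \<alpha> \<le> 0" and q: "\<And>t. t \<in> {0..1} \<Longrightarrow> q t \<ge> 0"
    and C: "\<And>t y. t \<in> {0..1} \<Longrightarrow> y \<in> {0..\<alpha>} \<Longrightarrow> \<bar>q t * f y\<bar> \<le> C"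
    and v: "v \<in> grid_box \<alpha> n"
    and min: "\<And>w. w \<in> grid_box \<alpha> n \<Longrightarrow> grid_energy p q F n v \<le> grid_energy p q F n w"
    and j: "j < n"
  shows "spow (p - 1) (grid_slope n v j) =
      spow (p - 1) (grid_slope n v 0) - (\<Sum>i<Suc j. q (real i / real n) * f (v i) / real n)"
    and "\<bar>spow (p - 1) (grid_slope n v j)\<bar> \<le> C"
proof -
  note V = grid_boxD[OF v less_imp_le[OF \<alpha>]]
  let ?\<phi> = "\<lambda>j. spow (p - 1) (grid_slope n v j)"
  have step: "?\<phi> j = ?\<phi> (j - 1) - q (real j / real n) * f (v j) / real n" if "0 < j" "j < n" for j
    by (rule grid_Euler_Lagrange[OF p F \<alpha> f q v min that])
  \<comment> \<open>The summand \<open>i = 0\<close> is 0 because \<open>v 0 = 0\<close> and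
    \<open>f 0 = 0\<close>; with it the sum is a left Riemann sum starting at 0.\<close>
  have sum: "?\<phi> j = ?\<phi> 0 - (\<Sum>i<Suc j. q (real i / real n) * f (v i) / real n)" if "j < n" for j
    using that
  proof (induction j)
    case 0
    then show ?case using V(3) f(1) by simp
  next
    case (Suc j)
    then show ?case using step[of "Suc j"] by simp
  qed
  show "?\<phi> j = ?\<phi> 0 - (\<Sum>i<Suc j. q (real i / real n) * f (v i) / real n)" by (rule sum[OF j])
  have tm: "\<bar>q (real i / real n) * f (v i) / real n\<bar> \<le> C / real n" if "i < n" for i
    using C[of "real i / real n" "v i"] V that by (simp add: divide_right_mono)
  have diff: "\<bar>?\<phi> j - ?\<phi> k\<bar> \<le> C" if "j \<le> k" "k < n" for j k
  proof -
    have "?\<phi> j - ?\<phi> k = (\<Sum>i=Suc j..<Suc k. q (real i / real n) * f (v i) / real n)"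
      using sum[of j] sum[of k] that sum_diff_nat_ivl[of 0 "Suc j" "Suc k" "\<lambda>i. q (real i / real n) * f (v i) / real n"]
      by (simp add: atLeast0LessThan)
    also have "\<bar>\<dots>\<bar> \<le> (\<Sum>i=Suc j..<Suc k. C / real n)"
      using that tm by (intro order_trans[OF sum_abs] sum_mono) auto
    also have "\<dots> = real (k - j) / real n * C" by simp
    also have "\<dots> \<le> 1 * C"
    proof (rule mult_right_mono)
      show "real (k - j) / real n \<le> 1" using that by simp
      show "0 \<le> C" using C[of 0 0] \<alpha> by simp
    qed
    finally show ?thesis by simp
  qed
  have "grid_slope n v 0 \<ge> 0" "grid_slope n v (n - 1) \<le> 0"
    using V(1) V(3) V(4)[of n] j by (auto simp: grid_slope_def mult_nonneg_nonpos)
  then have "?\<phi> 0 \<ge> 0" "?\<phi> (n - 1) \<le> 0" by (auto intro: spow_nonneg spow_nonpos)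
  moreover have "j \<le> n - 1" "n - 1 < n" using j by auto
  ultimately show "\<bar>?\<phi> j\<bar> \<le> C"
    using diff[of 0 j] diff[of j "n - 1"] j by linarith
qed

section \<open>Trapezoidal competitors of negative energy\<close>

lemma sum_plateau:
  fixes a b :: real
  assumes "2 * m \<le> n"
  shows "(\<Sum>i<n. if m \<le> i \<and> i < n - m then a else b) = 2 * real m * b + (real n - 2 * real m) * a"
proof -
  have 1: "{..<n} \<inter> {i. m \<le> i \<and> i < n - m} = {m..<n - m}" by auto
  have "{..<n} \<inter> - {i. m \<le> i \<and> i < n - m} = {..<m} \<union> {n - m..<n}" using assms by auto
  moreover have "card ({..<m} \<union> {n - m..<n}) = m + m"
    using assms by (subst card_Un_disjoint) auto
  ultimately show ?thesis
    using assms by (simp add: sum.If_cases 1 of_nat_diff algebra_simps)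
qed

text \<open>Each ramp consists of \<open>m\<close> cells of slope \<xi> n / m in absolute value; on
  these the potential is nonnegative and is dropped. The potential of a cell is sampled at its left
  node, so exactly the \<open>n - 2 * m\<close> cells with \<open>m \<le> i < n - m\<close> have
  slope 0 and contribute at least \<open>q0 * F \<xi>\<close>.\<close>

lemma grid_trapezoid:
  assumes p: "p > 1" and q: "\<And>t. t \<in> {0..1} \<Longrightarrow> q t \<ge> q0" "q0 \<ge> 0"
    and \<xi>: "0 < \<xi>" "\<xi> \<le> \<alpha>" and F: "\<And>y. y \<in> {0..\<xi>} \<Longrightarrow> F y \<ge> 0"
    and m: "0 < m" "2 * m \<le> n"
  obtains w where "w \<in> grid_box \<alpha> n" "grid_energy p q F n w \<le>
    2 * real m * ((\<xi> / (real m / real n)) powr p / p) - (real n - 2 * real m) * (q0 * F \<xi>)"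
proof -
  define w where "w i = (if i < m then \<xi> * real i / real m else if i \<le> n - m then \<xi>
    else if i < n then \<xi> * (real n - real i) / real m else 0)" for i
  have w01: "w i \<in> {0..\<xi>}" for i
  proof -
    have "\<xi> * (real n - real i) \<le> \<xi> * real m" if "\<not> i \<le> n - m"
      using that \<xi>(1) m by (intro mult_left_mono) auto
    moreover have "\<xi> * real i \<le> \<xi> * real m" if "i < m"
      using that \<xi>(1) by (intro mult_left_mono) auto
    ultimately show ?thesis using \<xi>(1) m by (auto simp: w_def pos_divide_le_eq)
  qed
  have "w \<in> grid_box \<alpha> n"
    unfolding grid_box_def mem_Collect_eq
  proof (intro allI)
    fix i
    have "w i = 0" if "\<not> (0 < i \<and> i < n)" using that m by (auto simp: w_def)
    then show "if 0 < i \<and> i < n then w i \<in> {0..\<alpha>} else w i = 0"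
      using w01[of i] \<xi>(2) by auto
  qed
  moreover have "grid_energy p q F n w \<le> 2 * real m * ((\<xi> / (real m / real n)) powr p / p)
    - (real n - 2 * real m) * (q0 * F \<xi>)"
  proof -
    let ?S = "(\<xi> / (real m / real n)) powr p / p"
    have "\<bar>grid_slope n w i\<bar> powr p / p - q (real i / real n) * F (w i) \<le>
        (if m \<le> i \<and> i < n - m then - (q0 * F \<xi>) else ?S)" if i: "i < n" for i
    proof (cases "m \<le> i \<and> i < n - m")
      case True
      then have "w i = \<xi>" "w (Suc i) = \<xi>" by (auto simp: w_def)
      then show ?thesis
        using True p q(1)[of "real i / real n"] i F[of \<xi>] \<xi>
        by (simp add: grid_slope_def mult_right_mono)
    next
      case False
      have "\<bar>grid_slope n w i\<bar> = \<xi> / (real m / real n)"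
      proof (cases "i < m")
        case True
        then have "w (Suc i) - w i = \<xi> / real m"
          using m by (cases "Suc i = m") (auto simp: w_def field_simps)
        then show ?thesis using \<xi> by (simp add: grid_slope_def)
      next
        case F: False
        then have "i \<ge> n - m" using False by auto
        then have "w (Suc i) - w i = - (\<xi> / real m)"
          using m i F by (cases "Suc i = n"; cases "i = n - m") (auto simp: w_def field_simps of_nat_diff)
        then show ?thesis using \<xi> by (simp add: grid_slope_def)
      qed
      moreover have "q (real i / real n) * F (w i) \<ge> 0"
        using q(1)[of "real i / real n"] q(2) i F[OF w01] by (intro mult_nonneg_nonneg) auto
      ultimately show ?thesis unfolding if_not_P[OF False] by simp
    qed
    then have "grid_energy p q F n w \<le> (\<Sum>i<n. if m \<le> i \<and> i < n - m then - (q0 * F \<xi>) else ?S)"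
      unfolding grid_energy_def sum_subtractf[symmetric] by (intro sum_mono) auto
    also have "\<dots> = 2 * real m * ?S - (real n - 2 * real m) * (q0 * F \<xi>)"
      unfolding sum_plateau[OF m(2)] by simp
    finally show ?thesis .
  qed
  ultimately show thesis using that by blast
qed

text \<open>With m the integer part of l n, the trapezoid bound is n H(m / n) for a function H
  continuous at l, and \<open>neg\<close> says H(l) < 0. Half of this gap survives for large n; it
  is linear in n because \<open>grid_energy\<close> is scaled by n.\<close>

lemma grid_energy_negative:
  assumes p: "p > 1" and q: "\<And>t. t \<in> {0..1} \<Longrightarrow> q t \<ge> q0" "q0 \<ge> 0"
    and \<xi>: "0 < \<xi>" "\<xi> \<le> \<alpha>" and F: "\<And>y. y \<in> {0..\<xi>} \<Longrightarrow> F y \<ge> 0"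
    and l: "0 < l" "l < 1/2" and neg: "2 * l * ((\<xi> / l) powr p / p) < (1 - 2 * l) * (q0 * F \<xi>)"
  obtains \<delta> where "\<delta> > 0"
    "eventually (\<lambda>n. \<exists>w\<in>grid_box \<alpha> n. grid_energy p q F n w \<le> - \<delta> * real n) sequentially"
proof -
  define H where "H x = 2 * x * ((\<xi> / x) powr p / p) - (1 - 2 * x) * (q0 * F \<xi>)" for x
  define m where "m n = nat \<lfloor>l * real n\<rfloor>" for n
  have m_lim: "(\<lambda>n. real (m n) / real n) \<longlonglongrightarrow> l"
  proof -
    have "(\<lambda>n. of_int \<lfloor>l * real n\<rfloor> / real n) \<longlonglongrightarrow> l" using l(1) by real_asymp
    moreover have "of_int \<lfloor>l * real n\<rfloor> = real (m n)" for n using l(1) by (simp add: m_def)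
    ultimately show ?thesis by simp
  qed
  have "(\<lambda>n. H (real (m n) / real n)) \<longlonglongrightarrow> H l"
    unfolding H_def using l \<xi> p by (intro tendsto_intros m_lim) auto
  moreover have "H l < 0" using neg by (simp add: H_def)
  then have "H l < H l / 2" by simp
  ultimately have "eventually (\<lambda>n. H (real (m n) / real n) < H l / 2) sequentially"
    by (rule order_tendstoD(2))
  moreover have "eventually (\<lambda>n. real (m n) / real n > 0) sequentially"
    by (rule order_tendstoD(1)[OF m_lim l(1)])
  ultimately have "eventually (\<lambda>n. \<exists>w\<in>grid_box \<alpha> n. grid_energy p q F n w \<le> - (- H l / 2) * real n) sequentially"
  proof eventually_elim
    case (elim n)
    have n: "real n > 0" and mn: "0 < m n" using elim(2) by (auto simp: zero_less_divide_iff)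
    have "real (m n) \<le> l * real n" using l(1) by (simp add: m_def)
    also have "\<dots> \<le> 1/2 * real n" using l by (intro mult_right_mono) auto
    finally have "2 * m n \<le> n" by simp
    from grid_trapezoid[where F = F and q = q, OF p q \<xi> F mn this] obtain w
      where w: "w \<in> grid_box \<alpha> n" "grid_energy p q F n w \<le>
      2 * real (m n) * ((\<xi> / (real (m n) / real n)) powr p / p) - (real n - 2 * real (m n)) * (q0 * F \<xi>)"
      by blast
    note w(2)
    also have "2 * real (m n) * ((\<xi> / (real (m n) / real n)) powr p / p) - (real n - 2 * real (m n)) * (q0 * F \<xi>)
        = H (real (m n) / real n) * real n"
      using n by (simp add: H_def left_diff_distrib)
    also have "\<dots> \<le> H l / 2 * real n" using elim(1) n by (intro mult_right_mono) auto
    finally show ?case using w(1) by (intro bexI[of _ w]) auto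
  qed
  moreover have "- H l / 2 > 0" using neg by (simp add: H_def)
  ultimately show thesis using that by blast
qed

section \<open>Passage to the continuum limit\<close>

text \<open>Uniform convergence of node values along the grids with \<open>N m\<close> cells.
  Values, slopes, fluxes and partial sums can all be compared with their limits in this form; the
  last node is left out because slopes belong to cells, numbered by their left node.\<close>

definition grid_close :: "(nat \<Rightarrow> nat) \<Rightarrow> (nat \<Rightarrow> nat \<Rightarrow> real) \<Rightarrow> (real \<Rightarrow> real) \<Rightarrow> bool" where
  "grid_close N a A \<longleftrightarrow> (\<forall>\<epsilon>>0. eventually (\<lambda>m. \<forall>i<N m. \<bar>a m i - A (real i / real (N m))\<bar> \<le> \<epsilon>) sequentially)"

lemma grid_closeD:
  "grid_close N a A \<Longrightarrow> \<epsilon> > 0 \<Longrightarrow>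
    eventually (\<lambda>m. \<forall>i<N m. \<bar>a m i - A (real i / real (N m))\<bar> \<le> \<epsilon>) sequentially"
  by (simp add: grid_close_def)

text \<open>The chosen node is within \<open>2 / N m\<close> of \<open>t\<close>; the cap
  \<open>N m - 1\<close> takes care of \<open>t = 1\<close>, where the rounded index would be the
  excluded last node.\<close>

lemma grid_close_tendsto:
  assumes "grid_close N a A" and N: "filterlim N at_top sequentially"
    and A: "continuous_on {0..1} A" and t: "t \<in> {0..1}"
  shows "(\<lambda>m. a m (min (nat \<lfloor>t * real (N m)\<rfloor>) (N m - 1))) \<longlonglongrightarrow> A t"
proof -
  define j where "j n = min (nat \<lfloor>t * real n\<rfloor>) (n - 1)" for n
  have j: "j n < n" if "n > 0" for n using that by (auto simp: j_def)
  have "(\<lambda>n. real (j n) / real n) \<longlonglongrightarrow> t"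
  proof (rule real_tendsto_sandwich)
    show "eventually (\<lambda>n. t - 2 / real n \<le> real (j n) / real n) sequentially"
      using eventually_gt_at_top[of 0]
    proof eventually_elim
      case (elim n)
      have "t * real n \<le> real n" using t by (simp add: mult_left_le_one_le)
      moreover have "real (nat \<lfloor>t * real n\<rfloor>) \<ge> t * real n - 1" using t by linarith
      ultimately have "t * real n - 2 \<le> real (j n)"
        using elim unfolding j_def by linarith
      then have "t \<le> (real (j n) + 2) / real n" using elim by (simp add: pos_le_divide_eq)
      then show ?case by (simp add: add_divide_distrib)
    qed
    show "eventually (\<lambda>n. real (j n) / real n \<le> t) sequentially"
      using eventually_gt_at_top[of 0]
    proof eventually_elim
      case (elim n)
      have "real (nat \<lfloor>t * real n\<rfloor>) \<le> t * real n" using t by simp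
      then have "real (j n) \<le> t * real n" unfolding j_def by linarith
      then show ?case using elim by (simp add: field_simps)
    qed
    show "(\<lambda>n. t - 2 / real n) \<longlonglongrightarrow> t" by real_asymp
  qed simp
  then have "(\<lambda>m. real (j (N m)) / real (N m)) \<longlonglongrightarrow> t" by (rule filterlim_compose[OF _ N])
  moreover have N0: "eventually (\<lambda>m. N m > 0) sequentially"
    by (rule eventually_compose_filterlim[OF eventually_gt_at_top N])
  moreover have "eventually (\<lambda>m. real (j (N m)) / real (N m) \<in> {0..1}) sequentially"
    using N0 by eventually_elim (use j in \<open>auto simp: field_simps less_imp_le\<close>)
  ultimately have "(\<lambda>m. A (real (j (N m)) / real (N m))) \<longlonglongrightarrow> A t"
    using A t by (intro continuous_on_tendsto_compose[OF A]) auto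
  moreover have "(\<lambda>m. a m (j (N m)) - A (real (j (N m)) / real (N m))) \<longlonglongrightarrow> 0"
  proof (rule tendstoI)
    fix e :: real assume "e > 0"
    with grid_closeD[OF assms(1), of "e / 2"]
    have "eventually (\<lambda>m. \<forall>i<N m. \<bar>a m i - A (real i / real (N m))\<bar> \<le> e / 2) sequentially" by simp
    with N0 show "eventually (\<lambda>m. dist (a m (j (N m)) - A (real (j (N m)) / real (N m))) 0 < e) sequentially"
    proof eventually_elim
      case (elim m)
      then have "\<bar>a m (j (N m)) - A (real (j (N m)) / real (N m))\<bar> \<le> e / 2" using j by blast
      then show ?case using \<open>e > 0\<close> by (simp add: dist_real_def)
    qed
  qed
  ultimately have "(\<lambda>m. (a m (j (N m)) - A (real (j (N m)) / real (N m))) + A (real (j (N m)) / real (N m))) \<longlonglongrightarrow> 0 + A t"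
    by (intro tendsto_add)
  then show ?thesis by (simp add: j_def)
qed

lemma grid_close_unique:
  assumes "grid_close N a A" "grid_close N a B" "filterlim N at_top sequentially"
    "continuous_on {0..1} A" "continuous_on {0..1} B" "t \<in> {0..1}"
  shows "A t = B t"
  using grid_close_tendsto[OF assms(1,3,4,6)] grid_close_tendsto[OF assms(2,3,5,6)] LIMSEQ_unique by blast

lemma grid_close_compose:
  assumes a: "grid_close N a A" and A: "\<And>t. t \<in> {0..1} \<Longrightarrow> \<bar>A t\<bar> \<le> B" and h: "continuous_on UNIV h"
  shows "grid_close N (\<lambda>m i. h (a m i)) (\<lambda>t. h (A t))"
  unfolding grid_close_def
proof (intro allI impI)
  fix \<epsilon> :: real assume "\<epsilon> > 0"
  \<comment> \<open>The margin 1 makes room for grid values, which may exceed the bound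
    \<open>B\<close> of their limit.\<close>
  have "uniformly_continuous_on {- (B + 1)..B + 1} h"
    by (intro compact_uniformly_continuous continuous_on_subset[OF h]) auto
  then obtain d where d: "d > 0" "\<And>x y. x \<in> {- (B + 1)..B + 1} \<Longrightarrow> y \<in> {- (B + 1)..B + 1} \<Longrightarrow>
      \<bar>x - y\<bar> < d \<Longrightarrow> \<bar>h x - h y\<bar> < \<epsilon>"
    using \<open>\<epsilon> > 0\<close> unfolding uniformly_continuous_on_def dist_real_def by metis
  have "min (d / 2) 1 > 0" using d by simp
  from grid_closeD[OF a this]
  show "eventually (\<lambda>m. \<forall>i<N m. \<bar>h (a m i) - h (A (real i / real (N m)))\<bar> \<le> \<epsilon>) sequentially"
  proof eventually_elim
    case (elim m)
    show ?case
    proof (intro allI impI)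
      fix i assume i: "i < N m"
      then have "\<bar>A (real i / real (N m))\<bar> \<le> B" by (intro A) auto
      moreover have "\<bar>a m i - A (real i / real (N m))\<bar> \<le> min (d / 2) 1" using elim i by blast
      ultimately show "\<bar>h (a m i) - h (A (real i / real (N m)))\<bar> \<le> \<epsilon>"
        using d(1) by (intro less_imp_le[OF d(2)]) (auto simp: abs_le_iff)
    qed
  qed
qed

lemma grid_close_mult:
  assumes a: "grid_close N a A" and q: "\<And>t. t \<in> {0..1} \<Longrightarrow> \<bar>q t\<bar> \<le> Q"
  shows "grid_close N (\<lambda>m i. q (real i / real (N m)) * a m i) (\<lambda>t. q t * A t)"
  unfolding grid_close_def
proof (intro allI impI)
  fix \<epsilon> :: real assume "\<epsilon> > 0"
  have Q: "Q \<ge> 0" using q[of 0] by simp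
  have "\<epsilon> / (Q + 1) > 0" using \<open>\<epsilon> > 0\<close> Q by simp
  from grid_closeD[OF a this]
  show "eventually (\<lambda>m. \<forall>i<N m. \<bar>q (real i / real (N m)) * a m i - q (real i / real (N m)) * A (real i / real (N m))\<bar> \<le> \<epsilon>) sequentially"
  proof eventually_elim
    case (elim m)
    show ?case
    proof (intro allI impI)
      fix i assume i: "i < N m"
      have "\<bar>q (real i / real (N m)) * (a m i - A (real i / real (N m)))\<bar> \<le> Q * (\<epsilon> / (Q + 1))"
        unfolding abs_mult using elim i q by (intro mult_mono Q) auto
      also have "\<dots> \<le> \<epsilon>" using Q \<open>\<epsilon> > 0\<close> by (simp add: field_simps)
      finally show "\<bar>q (real i / real (N m)) * a m i - q (real i / real (N m)) * A (real i / real (N m))\<bar> \<le> \<epsilon>"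
        by (simp add: right_diff_distrib)
    qed
  qed
qed

text \<open>Left Riemann sums of perturbed values. On a cell the error of the integrand is at most
  \<epsilon>, one half from \<open>x\<close> against \<open>g\<close> at the node and one half from
  the oscillation of \<open>g\<close>; so after \<open>j\<close> cells the error is at most
  \<epsilon> j / n.\<close>

lemma grid_close_integral:
  assumes x: "grid_close N x g" and g: "continuous_on {0..1} g" and N: "filterlim N at_top sequentially"
  shows "grid_close N (\<lambda>m j. \<Sum>i<j. x m i / real (N m)) (\<lambda>t. integral {0..t} g)"
  unfolding grid_close_def
proof (intro allI impI)
  fix \<epsilon> :: real assume e: "\<epsilon> > 0"
  have "uniformly_continuous_on {0..1} g" by (intro compact_uniformly_continuous g) auto
  then obtain d where d: "d > 0" "\<And>s t. s \<in> {0..1} \<Longrightarrow> t \<in> {0..1} \<Longrightarrow> \<bar>s - t\<bar> < d \<Longrightarrow> \<bar>g s - g t\<bar> < \<epsilon> / 2"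
    using e unfolding uniformly_continuous_on_def dist_real_def by (metis half_gt_zero)
  have "eventually (\<lambda>m. \<forall>i<N m. \<bar>x m i - g (real i / real (N m))\<bar> \<le> \<epsilon> / 2) sequentially"
    by (rule grid_closeD[OF x half_gt_zero[OF e]])
  moreover have "eventually (\<lambda>m. N m > nat \<lceil>1 / d\<rceil>) sequentially"
    by (rule eventually_compose_filterlim[OF eventually_gt_at_top N])
  ultimately show "eventually (\<lambda>m. \<forall>j<N m. \<bar>(\<Sum>i<j. x m i / real (N m)) - integral {0..real j / real (N m)} g\<bar> \<le> \<epsilon>) sequentially"
  proof eventually_elim
    case (elim m)
    define n where "n = N m"
    have n: "real n > 1 / d" using elim(2) unfolding n_def by linarith
    have n0: "real n > 0" using n d(1) less_trans[of 0 "1 / d" "real n"] by simp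
    have "\<bar>(\<Sum>i<j. x m i / real n) - integral {0..real j / real n} g\<bar> \<le> real j / real n * \<epsilon>" if "j \<le> n" for j
      using that
    proof (induction j)
      case 0
      then show ?case by simp
    next
      case (Suc j)
      let ?a = "real j / real n" and ?b = "real (Suc j) / real n"
      have ab: "0 \<le> ?a" "?a \<le> ?b" "?b \<le> 1" "?b - ?a = 1 / real n" using Suc n0 by (auto simp: field_simps)
      have sub: "{0..?b} \<subseteq> {0..1}" "{?a..?b} \<subseteq> {0..1}"
        unfolding atLeastatMost_subset_iff using ab(1-3) by simp_all
      have gi: "g integrable_on {0..?b}" and gc: "continuous_on {?a..?b} g"
        using continuous_on_subset[OF g sub(1)] continuous_on_subset[OF g sub(2)]
        by (auto intro: integrable_continuous_real)
      have split: "integral {0..?b} g = integral {0..?a} g + integral {?a..?b} g"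
        using Henstock_Kurzweil_Integration.integral_combine[OF ab(1,2) gi] by simp
      have "\<bar>integral {?a..?b} (\<lambda>s. x m j - g s)\<bar> \<le> \<epsilon> * (?b - ?a)"
        unfolding real_norm_def[symmetric]
      proof (rule integral_bound[OF ab(2)])
        show "continuous_on {?a..?b} (\<lambda>s. x m j - g s)" by (intro continuous_intros gc)
        fix s assume s: "s \<in> {?a..?b}"
        have "1 / real n < d" using n d(1) n0 by (simp add: field_simps)
        moreover have "\<bar>?a - s\<bar> \<le> ?b - ?a" using s by simp
        ultimately have "\<bar>?a - s\<bar> < d" using ab(4) by linarith
        moreover have "s \<in> {0..1}" "?a \<in> {0..1}"
          using subsetD[OF sub(2)] s ab(2) atLeastAtMost_iff order_refl by blast+
        ultimately have "\<bar>g ?a - g s\<bar> < \<epsilon> / 2" by (intro d(2))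
        moreover have "\<bar>x m j - g ?a\<bar> \<le> \<epsilon> / 2" using elim(1) Suc.prems by (simp add: n_def)
        ultimately show "norm (x m j - g s) \<le> \<epsilon>" unfolding real_norm_def by linarith
      qed
      also have "integral {?a..?b} (\<lambda>s. x m j - g s) = x m j / real n - integral {?a..?b} g"
        using ab gc by (subst Henstock_Kurzweil_Integration.integral_diff)
          (auto intro: integrable_continuous_real)
      finally have "\<bar>x m j / real n - integral {?a..?b} g\<bar> \<le> \<epsilon> / real n" using ab(4) by simp
      moreover have "real (Suc j) / real n * \<epsilon> = real j / real n * \<epsilon> + \<epsilon> / real n"
        by (simp add: add_divide_distrib distrib_right)
      ultimately show ?case
        using Suc unfolding split by simp
    qed note * = this
    show ?case unfolding n_def[symmetric]
    proof (intro allI impI)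
      fix j assume j: "j < n"
      note *[OF less_imp_le[OF j]]
      also have "real j / real n * \<epsilon> \<le> 1 * \<epsilon>"
        using j e n0 by (intro mult_right_mono) auto
      finally show "\<bar>(\<Sum>i<j. x m i / real n) - integral {0..real j / real n} g\<bar> \<le> \<epsilon>" by simp
    qed
  qed
qed

text \<open>McShane's extension formula, with a maximum over finitely many nodes. It turns grid
  functions into equi-Lipschitz functions on the line, the input for Arzela-Ascoli.\<close>

lemma Lipschitz_interpolation:
  fixes a x :: "nat \<Rightarrow> real"
  assumes "\<And>i j. i \<le> n \<Longrightarrow> j \<le> n \<Longrightarrow> \<bar>a i - a j\<bar> \<le> M * \<bar>x i - x j\<bar>" and M: "M \<ge> 0"
  obtains g where "\<And>i. i \<le> n \<Longrightarrow> g (x i) = a i" "\<And>s t. \<bar>g s - g t\<bar> \<le> M * \<bar>s - t\<bar>"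
proof -
  define g where "g t = Max ((\<lambda>i. a i - M * \<bar>t - x i\<bar>) ` {..n})" for t
  have g_ge: "a i - M * \<bar>t - x i\<bar> \<le> g t" if "i \<le> n" for i t
    unfolding g_def using that by (intro Max_ge) auto
  have g_le: "g t \<le> c" if "\<And>i. i \<le> n \<Longrightarrow> a i - M * \<bar>t - x i\<bar> \<le> c" for t c
    unfolding g_def using that by (intro Max.boundedI) auto
  have lip: "g s \<le> g t + M * \<bar>s - t\<bar>" for s t
  proof (rule g_le)
    fix i assume "i \<le> n"
    have "\<bar>t - x i\<bar> \<le> \<bar>s - x i\<bar> + \<bar>s - t\<bar>" by linarith
    from mult_left_mono[OF this M] g_ge[OF \<open>i \<le> n\<close>, of t]
    show "a i - M * \<bar>s - x i\<bar> \<le> g t + M * \<bar>s - t\<bar>" by (simp add: distrib_left)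
  qed
  show thesis
  proof (rule that)
    show "g (x i) = a i" if i: "i \<le> n" for i
    proof (rule antisym)
      show "g (x i) \<le> a i"
      proof (rule g_le)
        show "a j - M * \<bar>x i - x j\<bar> \<le> a i" if "j \<le> n" for j
          using assms(1)[OF i that] by linarith
      qed
      show "a i \<le> g (x i)" using g_ge[OF i, of "x i"] by simp
    qed
    show "\<bar>g s - g t\<bar> \<le> M * \<bar>s - t\<bar>" for s t
      using lip[of s t] lip[of t s] by (simp add: abs_minus_commute abs_le_iff)
  qed
qed

text \<open>Compactness is invoked only for the values and for the number \<open>c n\<close>, the
  flux in the first cell. The summed Euler-Lagrange equation then forces uniform convergence of all
  fluxes, the inverse signed power that of the slopes, and summing the slopes gives V as the
  integral of its limiting slope. Both differential equations follow from the fundamental theorem of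
  calculus.\<close>

lemma Dirichlet_solution_exists:
  fixes f q F :: "real \<Rightarrow> real"
  assumes p: "p > 1" and qc: "continuous_on {0..1} q" and q: "\<And>t. t \<in> {0..1} \<Longrightarrow> q t \<ge> q0" "q0 \<ge> 0"
    and fc: "continuous_on UNIV f" and F: "\<And>y. (F has_real_derivative f y) (at y)" and F0: "F 0 = 0"
    and \<alpha>: "\<alpha> > 0" and f: "f 0 = 0" "f \<alpha> \<le> 0"
    and C: "\<And>t y. t \<in> {0..1} \<Longrightarrow> y \<in> {0..\<alpha>} \<Longrightarrow> \<bar>q t * f y\<bar> \<le> C"
    and \<xi>: "0 < \<xi>" "\<xi> \<le> \<alpha>" and Fpos: "\<And>y. y \<in> {0..\<xi>} \<Longrightarrow> F y \<ge> 0"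
    and l: "0 < l" "l < 1/2" and neg: "2 * l * ((\<xi> / l) powr p / p) < (1 - 2 * l) * (q0 * F \<xi>)"
  obtains V R where "continuous_on {0..1} V" "continuous_on {0..1} R" "V 0 = 0" "V 1 = 0"
    "\<And>t. t \<in> {0..1} \<Longrightarrow> V t \<in> {0..\<alpha>}" "\<And>t. t \<in> {0..1} \<Longrightarrow> \<bar>R t\<bar> \<le> C"
    "\<And>t. t \<in> {0<..<1} \<Longrightarrow> (V has_real_derivative spow (1 / (p - 1)) (R t)) (at t)"
    "\<And>t. t \<in> {0<..<1} \<Longrightarrow> (R has_real_derivative - (q t * f (V t))) (at t)"
    "\<exists>t\<in>{0<..<1}. V t \<noteq> 0"
proof -
  have q_nonneg: "q t \<ge> 0" if "t \<in> {0..1}" for t using q that by force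
  obtain Q where Q: "\<And>t. t \<in> {0..1} \<Longrightarrow> \<bar>q t\<bar> \<le> Q"
    using compact_imp_bounded[OF compact_continuous_image[OF qc compact_Icc]] by (force simp: bounded_iff)
  have C0: "C \<ge> 0" using C[of 0 0] \<alpha> by simp
  have Fc: "continuous_on UNIV F"
    using DERIV_isCont[OF F] by (simp add: continuous_at_imp_continuous_on)
  have "\<exists>v. v \<in> grid_box \<alpha> n \<and> (\<forall>w\<in>grid_box \<alpha> n. grid_energy p q F n v \<le> grid_energy p q F n w)" for n
    using grid_energy_minimiser[OF p less_imp_le[OF \<alpha>] Fc] by metis
  then obtain v where v: "\<And>n. v n \<in> grid_box \<alpha> n"
    and min: "\<And>n w. w \<in> grid_box \<alpha> n \<Longrightarrow> grid_energy p q F n (v n) \<le> grid_energy p q F n w"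
    by metis
  note vD = grid_boxD[OF v less_imp_le[OF \<alpha>]]
  define s where "s n i = grid_slope n (v n) i" for n i
  have slopes: "spow (p - 1) (s n j) = spow (p - 1) (s n 0) - (\<Sum>i<Suc j. q (real i / real n) * f (v n i) / real n)"
    "\<bar>spow (p - 1) (s n j)\<bar> \<le> C" if "j < n" for n j
    unfolding s_def by (rule grid_minimiser_slopes[OF p F \<alpha> f q_nonneg C v min that]; assumption)+
  have v_sum: "v n j = (\<Sum>i<j. s n i / real n)" if "n > 0" for n j
  proof -
    have "(\<Sum>i<j. s n i / real n) = (\<Sum>i<j. v n (Suc i) - v n i)"
      using that by (simp add: s_def grid_slope_def)
    then show ?thesis using vD(3) by (simp add: sum_lessThan_telescope)
  qed
  define M where "M = C powr (1 / (p - 1))"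
  have M: "M \<ge> 0" by (simp add: M_def)
  have \<psi>\<phi>: "spow (1 / (p - 1)) (spow (p - 1) x) = x" for x
    using p by (simp add: spow_spow spow_1)
  have sM: "\<bar>s n i\<bar> \<le> M" if "i < n" for n i
  proof -
    have "\<bar>s n i\<bar> = \<bar>spow (p - 1) (s n i)\<bar> powr (1 / (p - 1))"
      using \<psi>\<phi>[of "s n i"] abs_spow by metis
    also have "\<dots> \<le> M" unfolding M_def using slopes(2)[OF that] p by (intro powr_mono2) auto
    finally show ?thesis .
  qed
  have v_lip': "\<bar>v n j - v n i\<bar> \<le> M * \<bar>real j / real n - real i / real n\<bar>" if "i \<le> j" "j \<le> n" for n i j
  proof (cases "n = 0")
    case False
    have "v n j - v n i = (\<Sum>k=i..<j. s n k / real n)"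
      using v_sum[of n j] v_sum[of n i] False that sum_diff_nat_ivl[of 0 i j "\<lambda>k. s n k / real n"]
      by (simp add: atLeast0LessThan)
    also have "\<bar>\<dots>\<bar> \<le> (\<Sum>k=i..<j. M / real n)"
      using that sM False by (intro order_trans[OF sum_abs] sum_mono) (simp add: divide_right_mono)
    also have "\<dots> = M * \<bar>real j / real n - real i / real n\<bar>"
      using that by (simp add: of_nat_diff diff_divide_distrib[symmetric])
    finally show ?thesis .
  qed (use that in simp)
  have v_lip: "\<bar>v n i - v n j\<bar> \<le> M * \<bar>real i / real n - real j / real n\<bar>" if "i \<le> n" "j \<le> n" for n i j
    using v_lip'[of i j n] v_lip'[of j i n] that by (cases "i \<le> j") (auto simp: abs_minus_commute)
  have "\<exists>g. (\<forall>i\<le>n. g (real i / real n) = v n i) \<and> (\<forall>s t. \<bar>g s - g t\<bar> \<le> M * \<bar>s - t\<bar>)" for n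
    using Lipschitz_interpolation[of n "v n" M "\<lambda>i. real i / real n", OF v_lip M] by metis
  then obtain W where W: "\<And>n i. i \<le> n \<Longrightarrow> W n (real i / real n) = v n i"
    and W_lip: "\<And>n s t. \<bar>W n s - W n t\<bar> \<le> M * \<bar>s - t\<bar>" by metis
  define c where "c n = spow (p - 1) (s n 0)" for n
  have "bounded (range (\<lambda>n. c (Suc n)))"
    unfolding bounded_iff c_def using slopes(2)[of 0] by (intro exI[of _ C]) auto
  then obtain c0 r where r: "strict_mono (r :: nat \<Rightarrow> nat)" "((\<lambda>n. c (Suc n)) \<circ> r) \<longlonglongrightarrow> c0"
    using bounded_imp_convergent_subsequence by blast
  obtain V k where V: "continuous_on {0..1} V" "strict_mono (k :: nat \<Rightarrow> nat)"
    "\<And>e. 0 < e \<Longrightarrow> \<exists>N. \<forall>n t. n \<ge> N \<and> t \<in> {0..1} \<longrightarrow> norm (W (Suc (r (k n))) t - V t) < e"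
  proof (rule Arzela_Ascoli[of "{0..1::real}" "\<lambda>n. W (Suc (r n))" M])
    show "norm (W (Suc (r n)) t) \<le> M" if "t \<in> {0..1}" for n t
      using W_lip[of "Suc (r n)" t 0] W[of 0 "Suc (r n)"] vD(3) that mult_left_mono[of t 1 M] M by auto
    show "\<exists>d>0. \<forall>n y. y \<in> {0..1} \<and> norm (x - y) < d \<longrightarrow> norm (W (Suc (r n)) x - W (Suc (r n)) y) < e"
      if "x \<in> {0..1}" "e > 0" for x e
    proof (intro exI[of _ "e / (M + 1)"] conjI allI impI)
      show "e / (M + 1) > 0" using that M by simp
      fix n y assume "y \<in> {0..1} \<and> norm (x - y) < e / (M + 1)"
      then have "M * \<bar>x - y\<bar> \<le> M * (e / (M + 1))" by (intro mult_left_mono M) simp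
      also have "\<dots> < e" using M that by (simp add: field_simps)
      finally show "norm (W (Suc (r n)) x - W (Suc (r n)) y) < e"
        using W_lip[of "Suc (r n)" x y] by simp
    qed
  qed auto
  define N where "N m = Suc (r (k m))" for m
  have N0: "N m > 0" for m by (simp add: N_def)
  have N: "filterlim N at_top sequentially"
    unfolding N_def using filterlim_compose[OF filterlim_Suc filterlim_compose[OF filterlim_subseq[OF r(1)] filterlim_subseq[OF V(2)]]] .
  have c_lim: "(\<lambda>m. c (N m)) \<longlonglongrightarrow> c0"
    using LIMSEQ_subseq_LIMSEQ[OF r(2) V(2)] by (simp add: N_def comp_def)
  have in01: "real i / real (N m) \<in> {0..1}" if "i \<le> N m" for i m
    using that N0[of m] by (simp add: field_simps)
  have gV: "grid_close N (\<lambda>m i. v (N m) i) V"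
    unfolding grid_close_def
  proof (intro allI impI)
    fix \<epsilon> :: real assume "\<epsilon> > 0"
    from V(3)[OF this] obtain m0 where m0: "\<And>m t. m \<ge> m0 \<Longrightarrow> t \<in> {0..1} \<Longrightarrow> \<bar>W (N m) t - V t\<bar> < \<epsilon>"
      unfolding N_def real_norm_def by blast
    show "eventually (\<lambda>m. \<forall>i<N m. \<bar>v (N m) i - V (real i / real (N m))\<bar> \<le> \<epsilon>) sequentially"
      using eventually_ge_at_top[of m0]
    proof eventually_elim
      case (elim m)
      show ?case
      proof (intro allI impI)
        fix i assume "i < N m"
        then show "\<bar>v (N m) i - V (real i / real (N m))\<bar> \<le> \<epsilon>"
          using m0[OF elim in01[of i m]] W[of i "N m"] by simp
      qed
    qed
  qed
  have V0\<alpha>: "V t \<in> {0..\<alpha>}" if "t \<in> {0..1}" for t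
  proof -
    note lim = grid_close_tendsto[OF gV N V(1) that]
    have "0 \<le> V t" by (rule LIMSEQ_le_const[OF lim]) (use vD in blast)
    moreover have "V t \<le> \<alpha>" by (rule LIMSEQ_le_const2[OF lim]) (use vD in blast)
    ultimately show ?thesis by simp
  qed
  \<comment> \<open>\<open>gV\<close> does not cover the last node, so the boundary value at 1 is
    taken from the interpolants.\<close>
  have V1: "V 1 = 0"
  proof (rule ccontr)
    assume "V 1 \<noteq> 0"
    then have "\<bar>V 1\<bar> > 0" by simp
    from V(3)[OF this] obtain m where "\<forall>n t. m \<le> n \<and> t \<in> {0..1} \<longrightarrow> norm (W (Suc (r (k n))) t - V t) < \<bar>V 1\<bar>" ..
    then have "\<bar>W (N m) 1 - V 1\<bar> < \<bar>V 1\<bar>" by (simp add: N_def)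
    moreover have "W (N m) 1 = 0" using W[of "N m" "N m"] N0[of m] vD(4)[of "N m" "N m"] by simp
    ultimately show False by simp
  qed
  define g where "g t = q t * f (V t)" for t
  have gc: "continuous_on {0..1} g"
    unfolding g_def by (intro continuous_intros qc continuous_on_compose2[OF fc V(1)]) auto
  have Vb: "\<bar>V t\<bar> \<le> \<alpha>" if "t \<in> {0..1}" for t using V0\<alpha>[OF that] by simp
  have gx: "grid_close N (\<lambda>m i. q (real i / real (N m)) * f (v (N m) i)) g"
    unfolding g_def by (rule grid_close_mult[OF grid_close_compose[OF gV Vb fc] Q])
  note gS = grid_close_integral[OF gx gc N]
  define R where "R t = c0 - integral {0..t} g" for t
  have Rc: "continuous_on {0..1} R"
    unfolding R_def by (intro continuous_intros indefinite_integral_continuous_1 integrable_continuous_real gc)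
  have gR: "grid_close N (\<lambda>m j. spow (p - 1) (s (N m) j)) R"
    unfolding grid_close_def
  proof (intro allI impI)
    fix \<epsilon> :: real assume e: "\<epsilon> > 0"
    have "eventually (\<lambda>m. \<forall>j<N m. \<bar>(\<Sum>i<j. q (real i / real (N m)) * f (v (N m) i) / real (N m)) -
        integral {0..real j / real (N m)} g\<bar> \<le> \<epsilon> / 3) sequentially"
      by (rule grid_closeD[OF gS]) (use e in simp)
    moreover have "eventually (\<lambda>m. dist (c (N m)) c0 < \<epsilon> / 3) sequentially"
      by (rule tendstoD[OF c_lim]) (use e in simp)
    moreover have "eventually (\<lambda>m. N m > nat \<lceil>3 * C / \<epsilon>\<rceil>) sequentially"
      by (rule eventually_compose_filterlim[OF eventually_gt_at_top N])
    ultimately show "eventually (\<lambda>m. \<forall>j<N m. \<bar>spow (p - 1) (s (N m) j) - R (real j / real (N m))\<bar> \<le> \<epsilon>) sequentially"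
    proof eventually_elim
      case (elim m)
      show ?case
      proof (intro allI impI)
        fix j assume j: "j < N m"
        \<comment> \<open>The Euler-Lagrange sum includes the index \<open>j\<close>, the Riemann
          sum in \<open>gS\<close> stops before it; the extra summand is at most
          \<open>C / N m\<close>.\<close>
        have "\<bar>q (real j / real (N m)) * f (v (N m) j) / real (N m)\<bar> \<le> C / real (N m)"
          using C[OF in01[of j m], of "v (N m) j"] vD j by (simp add: divide_right_mono)
        also have "\<dots> \<le> \<epsilon> / 3"
        proof -
          have "3 * C / \<epsilon> \<le> real (N m)" using elim(3) by linarith
          then show ?thesis using e N0[of m] by (simp add: field_simps)
        qed
        finally have 1: "\<bar>q (real j / real (N m)) * f (v (N m) j) / real (N m)\<bar> \<le> \<epsilon> / 3" .
        have 2: "\<bar>(\<Sum>i<j. q (real i / real (N m)) * f (v (N m) i) / real (N m)) -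
          integral {0..real j / real (N m)} g\<bar> \<le> \<epsilon> / 3" using elim(1) j by blast
        have 3: "\<bar>c (N m) - c0\<bar> < \<epsilon> / 3" using elim(2) by (simp add: dist_real_def)
        have "spow (p - 1) (s (N m) j) = c (N m) - (\<Sum>i<j. q (real i / real (N m)) * f (v (N m) i) / real (N m))
            - q (real j / real (N m)) * f (v (N m) j) / real (N m)"
          using slopes(1)[OF j] by (simp add: c_def)
        with 1 2 3 show "\<bar>spow (p - 1) (s (N m) j) - R (real j / real (N m))\<bar> \<le> \<epsilon>"
          unfolding R_def by linarith
      qed
    qed
  qed
  have RC: "\<bar>R t\<bar> \<le> C" if "t \<in> {0..1}" for t
  proof -
    have "(\<lambda>m. \<bar>spow (p - 1) (s (N m) (min (nat \<lfloor>t * real (N m)\<rfloor>) (N m - 1)))\<bar>) \<longlonglongrightarrow> \<bar>R t\<bar>"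
      by (intro tendsto_rabs grid_close_tendsto[OF gR N Rc that])
    then show ?thesis
      by (rule LIMSEQ_le_const2) (use N0 slopes(2) in \<open>auto intro!: exI[of _ 0] simp: min_less_iff_disj\<close>)
  qed
  let ?\<psi> = "spow (1 / (p - 1))"
  have \<psi>c: "continuous_on UNIV ?\<psi>" using p by (intro continuous_on_spow) simp
  have \<psi>Rc: "continuous_on {0..1} (\<lambda>t. ?\<psi> (R t))"
    by (rule continuous_on_compose2[OF \<psi>c Rc]) simp
  have "grid_close N (\<lambda>m j. ?\<psi> (spow (p - 1) (s (N m) j))) (\<lambda>t. ?\<psi> (R t))"
    by (rule grid_close_compose[OF gR RC \<psi>c])
  then have gs: "grid_close N (\<lambda>m j. s (N m) j) (\<lambda>t. ?\<psi> (R t))"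
    unfolding \<psi>\<phi> .
  \<comment> \<open>The node values are also the partial sums of the slopes. This gives a second
    limit for the same grid functions, and uniqueness of limits identifies it with
    \<open>V\<close>.\<close>
  have gV': "grid_close N (\<lambda>m i. v (N m) i) (\<lambda>t. integral {0..t} (\<lambda>t. ?\<psi> (R t)))"
    using grid_close_integral[OF gs \<psi>Rc N] unfolding v_sum[OF N0, symmetric] .
  have V_eq: "V t = integral {0..t} (\<lambda>t. ?\<psi> (R t))" if "t \<in> {0..1}" for t
    by (rule grid_close_unique[OF gV gV' N V(1) _ that])
      (intro indefinite_integral_continuous_1 integrable_continuous_real \<psi>Rc)
  have int_deriv: "((\<lambda>t. integral {0..t} h) has_real_derivative h t) (at t)"
    if "continuous_on {0..1} h" "t \<in> {0<..<1}" for h :: "real \<Rightarrow> real" and t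
    using integral_has_real_derivative[OF that(1), of t] that(2) by (simp add: at_within_Icc_at)
  show thesis
  proof (rule that[OF V(1) Rc _ V1 V0\<alpha> RC])
    show "V 0 = 0" using V_eq[of 0] by simp
    fix t :: real assume t: "t \<in> {0<..<1}"
    show "(V has_real_derivative ?\<psi> (R t)) (at t)"
      by (rule has_field_derivative_transform_within_open[OF int_deriv[OF \<psi>Rc t] _ t]) (use V_eq in auto)
    show "(R has_real_derivative - (q t * f (V t))) (at t)"
      unfolding R_def using int_deriv[OF gc t] by (auto intro!: derivative_eq_intros simp: g_def)
  next
    \<comment> \<open>If V were 0, the minimisers would tend to 0 uniformly and their potential part
      would be at most \<delta> n / 2. The slope part is nonnegative, so their energy would be at
      least -\<delta> n / 2, above the value -\<delta> n of a competitor.\<close>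
    show "\<exists>t\<in>{0<..<1}. V t \<noteq> 0"
    proof (rule ccontr)
      assume "\<not> (\<exists>t\<in>{0<..<1}. V t \<noteq> 0)"
      then have V0: "V t = 0" if "t \<in> {0..1}" for t
        using that V_eq[of 0] V1 by (cases "t = 0 \<or> t = 1") auto
      obtain \<delta> where \<delta>: "\<delta> > 0"
        "eventually (\<lambda>n. \<exists>w\<in>grid_box \<alpha> n. grid_energy p q F n w \<le> - \<delta> * real n) sequentially"
        by (rule grid_energy_negative[where q = q and F = F, OF p q \<xi> Fpos l neg])
      have "eventually (\<lambda>m. \<exists>w\<in>grid_box \<alpha> (N m). grid_energy p q F (N m) w \<le> - \<delta> * real (N m)) sequentially"
        by (rule eventually_compose_filterlim[OF \<delta>(2) N])
      moreover have "eventually (\<lambda>m. \<forall>i<N m. \<bar>q (real i / real (N m)) * F (v (N m) i) -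
          q (real i / real (N m)) * F (V (real i / real (N m)))\<bar> \<le> \<delta> / 2) sequentially"
        by (rule grid_closeD[OF grid_close_mult[OF grid_close_compose[OF gV Vb Fc] Q]]) (use \<delta> in auto)
      ultimately have "eventually (\<lambda>m. False) sequentially"
      proof eventually_elim
        case (elim m)
        have "q (real i / real (N m)) * F (v (N m) i) \<le> \<delta> / 2" if "i < N m" for i
          using elim(2)[rule_format, OF that] V0[OF in01[of i m]] F0 that by simp
        then have "(\<Sum>i<N m. q (real i / real (N m)) * F (v (N m) i)) \<le> (\<Sum>i<N m. \<delta> / 2)"
          by (intro sum_mono) auto
        moreover have "(\<Sum>i<N m. \<delta> / 2) = \<delta> / 2 * real (N m)" by simp
        moreover have "(\<Sum>i<N m. \<bar>grid_slope (N m) (v (N m)) i\<bar> powr p / p) \<ge> 0"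
          using p by (intro sum_nonneg) auto
        ultimately have "grid_energy p q F (N m) (v (N m)) \<ge> - (\<delta> / 2 * real (N m))"
          unfolding grid_energy_def by linarith
        moreover have "grid_energy p q F (N m) (v (N m)) \<le> - \<delta> * real (N m)"
          using elim(1) min by (meson order_trans)
        moreover have "\<delta> * real (N m) > 0" using \<delta>(1) N0[of m] by simp
        ultimately show False by linarith
      qed
      then show False by simp
    qed
  qed
qed

section \<open>From the profile to weak solutions\<close>

text \<open>\<open>R\<close> is the flux \<open>\<bar>V'\<bar> powr (p - 2) * V'\<close>.\<close>

definition Dirichlet_profile ::
  "real \<Rightarrow> (real \<Rightarrow> real) \<Rightarrow> (real \<Rightarrow> real) \<Rightarrow> real \<Rightarrow> real \<Rightarrow> (real \<Rightarrow> real) \<Rightarrow> (real \<Rightarrow> real) \<Rightarrow> bool" where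
  "Dirichlet_profile p q f \<alpha> C V R \<longleftrightarrow>
    continuous_on {0..1} V \<and> continuous_on {0..1} R \<and> V 0 = 0 \<and> V 1 = 0 \<and>
    (\<forall>t\<in>{0..1}. V t \<in> {0..\<alpha>} \<and> \<bar>R t\<bar> \<le> C) \<and>
    (\<forall>t\<in>{0<..<1}. (V has_real_derivative spow (1 / (p - 1)) (R t)) (at t) \<and>
      (R has_real_derivative - (q t * f (V t))) (at t))"

lemma Dirichlet_profileD:
  assumes "Dirichlet_profile p q f \<alpha> C V R"
  shows "continuous_on {0..1} V" "continuous_on {0..1} R" "V 0 = 0" "V 1 = 0"
    "t \<in> {0..1} \<Longrightarrow> 0 \<le> V t" "t \<in> {0..1} \<Longrightarrow> V t \<le> \<alpha>" "t \<in> {0..1} \<Longrightarrow> \<bar>R t\<bar> \<le> C"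
    "t \<in> {0<..<1} \<Longrightarrow> (V has_real_derivative spow (1 / (p - 1)) (R t)) (at t)"
    "t \<in> {0<..<1} \<Longrightarrow> (R has_real_derivative - (q t * f (V t))) (at t)"
  using assms by (auto simp: Dirichlet_profile_def)

lemma powr_times_eq_spow: "\<bar>x\<bar> powr (p - 2) * x = spow (p - 1) x"
proof (cases "x = 0")
  case False
  have "\<bar>x\<bar> powr (p - 1) = \<bar>x\<bar> powr (p - 2) * \<bar>x\<bar>"
    using False powr_add[of "\<bar>x\<bar>" "p - 2" 1] by simp
  then show ?thesis by (auto simp: spow_def sgn_if)
qed (simp add: spow_def)

lemma spow_inverse: "p > 1 \<Longrightarrow> spow (p - 1) (spow (1 / (p - 1)) x) = x"
  by (simp add: spow_spow spow_1)

lemma spow_mult: "y > 0 \<Longrightarrow> spow r (x * y) = spow r x * y powr r"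
  by (auto simp: spow_def abs_mult sgn_mult powr_mult)

lemma spow_bound: "r > 0 \<Longrightarrow> \<bar>x\<bar> \<le> C \<Longrightarrow> \<bar>spow r x\<bar> \<le> C powr r"
  by (simp add: abs_spow powr_mono2)

lemma W1p_norm_le:
  fixes u :: "'a::euclidean_space \<Rightarrow> real"
  assumes "open \<Omega>" "bounded \<Omega>" "p > 0"
    and u: "\<And>x. x \<in> \<Omega> \<Longrightarrow> (u has_derivative (\<lambda>h. G x \<bullet> h)) (at x)"
    and G: "continuous_on \<Omega> G"
    and K: "\<And>x. x \<in> \<Omega> \<Longrightarrow> \<bar>u x\<bar> \<le> A" "\<And>x. x \<in> \<Omega> \<Longrightarrow> norm (G x) \<le> B"
  shows "W1p_norm p \<Omega> u \<le> ((A powr p + B powr p) * measure lebesgue \<Omega>) powr (1 / p)"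
    and "(LINT x|lebesgue_on \<Omega>. norm (weak_gradient \<Omega> u x) powr p) \<le> B powr p * measure lebesgue \<Omega>"
proof -
  have l: "\<Omega> \<in> lmeasurable" using assms by (intro lmeasurable_open)
  interpret finite_measure "lebesgue_on \<Omega>" by (rule finite_measure_lebesgue_on[OF l])
  have K': "\<bar>u x\<bar> \<le> max A B" "norm (G x) \<le> max A B" if "x \<in> \<Omega>" for x
    using K[OF that] by (auto simp: le_max_iff_disj)
  note U = W1p_classical[OF assms(1-3) u G K', simplified]
  have le: "(LINT x|lebesgue_on \<Omega>. norm (f x) powr p) \<le> c powr p * measure lebesgue \<Omega>"
    if f: "f \<in> borel_measurable (lebesgue_on \<Omega>)" and c: "\<And>x. x \<in> \<Omega> \<Longrightarrow> norm (f x) \<le> c"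
    for f :: "'a \<Rightarrow> 'b::euclidean_space" and c
  proof -
    have "(LINT x|lebesgue_on \<Omega>. norm (f x) powr p) \<le> (LINT x|lebesgue_on \<Omega>. c powr p)"
      using Lp_bounded[OF l f c assms(3)] c assms(3)
      by (intro integral_mono) (auto simp: Lp_def intro!: powr_mono2)
    then show ?thesis using assms(1) by (simp add: measure_restrict_space mult.commute)
  qed
  have 1: "(LINT x|lebesgue_on \<Omega>. \<bar>u x\<bar> powr p) \<le> A powr p * measure lebesgue \<Omega>"
    using le[OF U(4), of A] K(1) by simp
  have 2: "(LINT x|lebesgue_on \<Omega>. norm (G x) powr p) \<le> B powr p * measure lebesgue \<Omega>"
    using le[OF U(3), of B] K(2) by simp
  show "W1p_norm p \<Omega> u \<le> ((A powr p + B powr p) * measure lebesgue \<Omega>) powr (1 / p)"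
    unfolding W1p_norm_eq[OF assms(1) U(2,3)] using 1 2 assms(3)
    by (intro powr_mono2) (auto simp: distrib_right)
  have ae: "AE x in lebesgue_on \<Omega>. weak_gradient \<Omega> u x = G x"
    by (rule weak_gradient_AE_eq[OF assms(1) U(2)])
  have m: "weak_gradient \<Omega> u \<in> borel_measurable (lebesgue_on \<Omega>)"
    by (rule borel_measurable_lebesgue_on_cong_AE[OF _ ae U(3)]) (use assms(1) in auto)
  have "(LINT x|lebesgue_on \<Omega>. norm (weak_gradient \<Omega> u x) powr p) = (LINT x|lebesgue_on \<Omega>. norm (G x) powr p)"
    by (intro integral_cong_AE) (use m U(3) ae in \<open>auto elim!: eventually_mono\<close>)
  then show "(LINT x|lebesgue_on \<Omega>. norm (weak_gradient \<Omega> u x) powr p) \<le> B powr p * measure lebesgue \<Omega>"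
    using 2 by simp
qed

text \<open>In dimension one the field \<open>X\<close> is the flux \<open>R\<close> itself and the
  divergence identity is its differential equation. The norm sees only V', which is at most
  \<open>C powr (1 / (p - 1))\<close> on an interval of length 1.\<close>

lemma profile_ode_solution:
  assumes p: "p > 1" and qc: "continuous_on {0..1} q" and fc: "continuous_on UNIV f"
    and P: "Dirichlet_profile p q f \<alpha> C V R"
  shows "ode_weak_solution p q f V" and "ode_norm p V \<le> C powr (1 / (p - 1))"
proof -
  note D = Dirichlet_profileD[OF P]
  let ?\<Omega> = "{0<..<1::real}"
  let ?G = "\<lambda>t. spow (1 / (p - 1)) (R t)"
  have op: "open ?\<Omega>" "bounded ?\<Omega>" by auto
  have Gc: "continuous_on {0..1} ?G"
    by (rule continuous_on_compose2[OF continuous_on_spow[of _ UNIV] D(2)]) (use p in auto)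
  have u: "(V has_derivative (\<lambda>h. ?G t \<bullet> h)) (at t)" if "t \<in> ?\<Omega>" for t
    using D(8)[OF that] by (simp add: has_field_derivative_def)
  have Gc': "continuous_on ?\<Omega> ?G" by (rule continuous_on_subset[OF Gc]) auto
  have B: "\<bar>V t\<bar> \<le> \<alpha>" "\<bar>?G t\<bar> \<le> C powr (1 / (p - 1))" if "t \<in> {0..1}" for t
    using D(5,6)[OF that] spow_bound[OF _ D(7)[OF that], of "1 / (p - 1)"] p by auto
  obtain W W' K where W: "\<And>j::nat. W j \<in> test_functions ?\<Omega>"
    "\<And>j x. (W j has_real_derivative W' j x) (at x)"
    "\<And>x. x \<in> ?\<Omega> \<Longrightarrow> (\<lambda>j. W j x) \<longlonglongrightarrow> V x"
    "\<And>x. x \<in> ?\<Omega> \<Longrightarrow> (\<lambda>j. W' j x) \<longlonglongrightarrow> ?G x"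
    "\<And>j x. x \<in> ?\<Omega> \<Longrightarrow> \<bar>W j x\<bar> \<le> K" "\<And>j x. x \<in> ?\<Omega> \<Longrightarrow> \<bar>W' j x\<bar> \<le> K"
    by (rule test_function_approx[OF zero_less_one D(1) Gc D(8) D(3,4)]) (assumption, rule that)
  have gW: "grad (W j) x = W' j x" for j x
    by (rule grad_eqI) (use W(2) in \<open>simp add: has_field_derivative_def\<close>)
  define K' where "K' = max K (max \<alpha> (C powr (1 / (p - 1))))"
  have V0: "V \<in> W1p_0 p ?\<Omega>"
  proof (rule W1p_0_classical[OF op _ u Gc', of p K' W])
    show "0 < p" using p by simp
    fix x :: real and j assume x: "x \<in> ?\<Omega>"
    show "\<bar>V x\<bar> \<le> K'" "norm (?G x) \<le> K'" "\<bar>W j x\<bar> \<le> K'" "norm (grad (W j) x) \<le> K'"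
      using B[of x] W(5,6)[OF x, of j] x by (auto simp: K'_def gW le_max_iff_disj)
    show "(\<lambda>j. W j x) \<longlonglongrightarrow> V x" "(\<lambda>j. grad (W j) x) \<longlonglongrightarrow> ?G x"
      using W(3,4)[OF x] by (auto simp: gW)
  qed (use W in auto)
  have gc: "continuous_on {0..1} (\<lambda>t. q t * f (V t))"
    by (intro continuous_intros qc continuous_on_compose2[OF fc D(1)]) auto
  obtain Kg where Kg: "\<And>t. t \<in> {0..1} \<Longrightarrow> \<bar>q t * f (V t)\<bar> \<le> Kg"
    using compact_imp_bounded[OF compact_continuous_image[OF gc compact_Icc]]
    unfolding bounded_iff by force
  show "ode_weak_solution p q f V"
    unfolding ode_weak_solution_def
  proof (intro conjI ballI V0)
    fix w assume w: "w \<in> W1p_0 p ?\<Omega>"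
    have "(LINT x|lebesgue_on ?\<Omega>. (norm (weak_gradient ?\<Omega> V x) powr (p - 2) *\<^sub>R weak_gradient ?\<Omega> V x)
      \<bullet> weak_gradient ?\<Omega> w x) = (LINT x|lebesgue_on ?\<Omega>. (q x * f (V x)) * w x)"
    proof (rule weak_solution_classical(2)[OF op _ u Gc', of p R "max C Kg" "\<lambda>x h. - (q x * f (V x)) * h"])
      show "norm (?G x) powr (p - 2) *\<^sub>R ?G x = R x" for x
        using powr_times_eq_spow[of "?G x" p] spow_inverse[OF p] by simp
      show "continuous_on ?\<Omega> (\<lambda>x. - (q x * f (V x)) * i)" for i
        by (intro continuous_on_mult continuous_on_minus continuous_on_const continuous_on_subset[OF gc]) auto
      show "continuous_on ?\<Omega> (\<lambda>x. q x * f (V x))" by (rule continuous_on_subset[OF gc]) auto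
      fix x assume x: "x \<in> ?\<Omega>"
      show "(R has_derivative (\<lambda>h. - (q x * f (V x)) * h)) (at x)"
        using D(9)[OF x] by (simp only: has_field_derivative_def)
      show "norm (R x) \<le> max C Kg" "\<bar>q x * f (V x)\<bar> \<le> max C Kg"
        using D(7)[of x] Kg[of x] x by (auto simp: le_max_iff_disj)
    qed (use p w in auto)
    then show "(LINT t|lebesgue_on ?\<Omega>. \<bar>weak_deriv01 V t\<bar> powr (p - 2) * weak_deriv01 V t * weak_deriv01 w t) -
        (LINT t|lebesgue_on ?\<Omega>. q t * f (V t) * w t) = 0" by simp
  qed
  have "(LINT x|lebesgue_on ?\<Omega>. norm (weak_gradient ?\<Omega> V x) powr p) \<le>
      (C powr (1 / (p - 1))) powr p * measure lebesgue ?\<Omega>"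
    by (rule W1p_norm_le(2)[OF op _ u Gc', of p \<alpha>]) (use B p in auto)
  then have "ode_norm p V \<le> ((C powr (1 / (p - 1))) powr p) powr (1 / p)"
    unfolding ode_norm_def using p by (intro powr_mono2) (auto intro: integral_nonneg_AE)
  then show "ode_norm p V \<le> C powr (1 / (p - 1))"
    using p by (simp add: powr_powr)
qed

text \<open>In both cases of the definition the weight is \<open>\<tau>' powr (- p)\<close>, where \<open>t = \<tau> r\<close> is the new variable.\<close>

lemma annulus_change_of_variables:
  assumes p: "1 < p" "p \<le> real N" and ab: "0 < a" "a < b"
  obtains \<tau> \<kappa> where "\<kappa> > 0" "\<tau> a = 0" "\<tau> b = 1"
    "\<And>r. r > 0 \<Longrightarrow> (\<tau> has_real_derivative \<kappa> * r powr (- ((real N - 1) / (p - 1)))) (at r)"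
    "\<And>r. r > 0 \<Longrightarrow> annulus_weight N p a b (\<tau> r) = (\<kappa> * r powr (- ((real N - 1) / (p - 1)))) powr (- p)"
proof (cases "p < real N")
  case True
  define e where "e = (real N - p) / (p - 1)"
  have e: "e > 0" using True p by (simp add: e_def)
  define D where "D = b powr e - a powr e"
  have D: "D > 0" using e ab by (simp add: D_def powr_less_mono2)
  define A where "A = (a * b) powr e / D"
  define B where "B = b powr e / D"
  have A: "A > 0" using D ab by (simp add: A_def)
  have \<sigma>: "(real N - 1) / (p - 1) = e + 1" using p by (simp add: e_def field_simps)
  show thesis
  proof (rule that[of "A * e" "\<lambda>r. B - A * r powr (- e)"])
    show "A * e > 0" using A e by simp
    show "B - A * a powr (- e) = 0" "B - A * b powr (- e) = 1"
      using ab D by (auto simp: A_def B_def powr_mult powr_minus field_simps) (simp add: D_def)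
    fix r :: real assume r: "r > 0"
    show "((\<lambda>r. B - A * r powr (- e)) has_real_derivative A * e * r powr (- ((real N - 1) / (p - 1)))) (at r)"
      unfolding \<sigma> using r by (auto intro!: derivative_eq_intros)
    have "annulus_weight N p a b (B - A * r powr (- e)) =
        (1 / e) powr p * (A powr (p / e) / (A * r powr (- e)) powr (p * (e + 1) / e))"
    proof -
      \<comment> \<open>In terms of \<open>e\<close> the exponents of the weight are p / e and p / e
        + p, so the powers of \<open>A\<close> combine to \<open>A powr (- p)\<close>.\<close>
      have Np: "real N - p = (p - 1) * e" "real N - 1 = (p - 1) * (e + 1)"
        using p by (simp_all add: e_def distrib_left)
      have "(p - 1) * p / (real N - p) = p / e" "p * (real N - 1) / (real N - p) = p * (e + 1) / e"
        "(p - 1) / (real N - p) = 1 / e"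
        unfolding Np using p by simp_all
      then show ?thesis
        using True by (simp add: annulus_weight_def Let_def e_def[symmetric] A_def[symmetric] B_def[symmetric] D_def[symmetric])
    qed
    also have "(A * r powr (- e)) powr (p * (e + 1) / e) = A powr (p / e + p) * r powr (- (p * (e + 1)))"
    proof -
      have "p * (e + 1) / e = p / e + p" "- e * (p * (e + 1) / e) = - (p * (e + 1))"
        using e by (simp_all add: distrib_left add_divide_distrib)
      moreover have "(A * r powr (- e)) powr c = A powr c * r powr (- e * c)" for c
        using A r by (simp add: powr_mult powr_powr)
      ultimately show ?thesis by metis
    qed
    also have "(1 / e) powr p * (A powr (p / e) / (A powr (p / e + p) * r powr (- (p * (e + 1))))) =
        e powr (- p) * A powr (- p) * r powr (p * (e + 1))"
    proof -
      have *: "inverse x * (y / (y * z * inverse w)) = inverse x * inverse z * w" if "y \<noteq> 0" for w x y z :: real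
        using that by (simp add: divide_inverse mult_ac)
      have "(1 / e) powr p = inverse (e powr p)"
        using e by (simp add: powr_divide inverse_eq_divide)
      then show ?thesis
        unfolding powr_minus powr_add using A by (simp only: *[of "A powr (p / e)"] powr_gt_zero less_imp_neq[symmetric] simp_thms)
    qed
    also have "\<dots> = (A * e * r powr (- ((real N - 1) / (p - 1)))) powr (- p)"
    proof -
      have "- (e + 1) * - p = p * (e + 1)" by (simp add: algebra_simps)
      then show ?thesis
        unfolding \<sigma> using A r e by (simp only: powr_mult powr_powr mult.commute[of A])
    qed
    finally show "annulus_weight N p a b (B - A * r powr (- e)) = (A * e * r powr (- ((real N - 1) / (p - 1)))) powr (- p)" .
  qed
next
  case False
  then have pN: "p = real N" using p by simp
  define L where "L = ln (b / a)"
  have L: "L > 0" using ab by (simp add: L_def)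
  have \<sigma>: "(real N - 1) / (p - 1) = 1" using p pN by simp
  show thesis
  proof (rule that[of "1 / L" "\<lambda>r. ln (r / a) / L"])
    fix r :: real assume r: "r > 0"
    show "((\<lambda>r. ln (r / a) / L) has_real_derivative 1 / L * r powr (- ((real N - 1) / (p - 1)))) (at r)"
      unfolding \<sigma> using r ab L by (auto intro!: derivative_eq_intros simp: powr_minus_divide)
    have "(b / a) powr (ln (r / a) / L) = r / a"
      using r ab L unfolding powr_def L_def[symmetric] by simp
    then have "annulus_weight N p a b (ln (r / a) / L) = (r * L) powr p"
      using False ab by (simp add: annulus_weight_def L_def[symmetric])
    also have "\<dots> = (1 / L * r powr (- ((real N - 1) / (p - 1)))) powr (- p)"
      unfolding \<sigma> using r L by (simp add: powr_minus powr_mult powr_divide field_simps)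
    finally show "annulus_weight N p a b (ln (r / a) / L) = (1 / L * r powr (- ((real N - 1) / (p - 1)))) powr (- p)" .
  qed (use L ab in \<open>auto simp: L_def\<close>)
qed

section \<open>Radial functions on the annulus\<close>

lemma open_annulus: "open (annulus a b :: 'a::euclidean_space set)"
proof -
  have "annulus a b = (norm :: 'a \<Rightarrow> real) -` {a<..<b}" by (auto simp: annulus_def)
  then show ?thesis by (simp add: open_vimage continuous_on_norm_id)
qed

lemma bounded_annulus: "bounded (annulus a b :: 'a::euclidean_space set)"
  by (rule boundedI[of _ b]) (auto simp: annulus_def)

lemma continuous_on_radial:
  assumes "continuous_on {a<..<b} h"
  shows "continuous_on (annulus a b) (\<lambda>x. h (norm x))"
  by (rule continuous_on_compose2[OF assms continuous_on_norm_id]) (auto simp: annulus_def)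

text \<open>The squared norm is a polynomial and hence smooth everywhere, which is why radial test
  functions are built in the variable |x|^2 over the interval from a^2 to b^2.\<close>

lemma test_function_radial:
  assumes ab: "0 < a" "a < b" and W: "W \<in> test_functions {a\<^sup>2<..<b\<^sup>2}"
  shows "(\<lambda>x::'a::euclidean_space. W (x \<bullet> x)) \<in> test_functions (annulus a b)"
proof -
  obtain K where K: "compact K" "K \<subseteq> {a\<^sup>2<..<b\<^sup>2}" "\<And>s. s \<notin> K \<Longrightarrow> W s = 0"
    by (rule test_functions_support[OF W]) metis
  have C: "C_k k (\<lambda>x::'a. x \<bullet> x)" for k
  proof -
    have "C_k k (\<lambda>x::'a. \<Sum>i\<in>Basis. (x \<bullet> i) * (x \<bullet> i))"
      by (intro C_k_sum C_k_mult C_k_bounded_linear bounded_linear_inner_left) simp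
    then show ?thesis by (simp add: euclidean_inner[symmetric])
  qed
  have "closed ((\<lambda>x::'a. x \<bullet> x) -` K)"
    by (intro closed_vimage compact_imp_closed K continuous_intros)
  then have "closure {x::'a. W (x \<bullet> x) \<noteq> 0} \<subseteq> (\<lambda>x. x \<bullet> x) -` K"
    using K(3) by (intro closure_minimal) auto
  also have sub: "(\<lambda>x::'a. x \<bullet> x) -` K \<subseteq> annulus a b"
  proof
    fix x :: 'a assume "x \<in> (\<lambda>x. x \<bullet> x) -` K"
    then have "a\<^sup>2 < (norm x)\<^sup>2" "(norm x)\<^sup>2 < b\<^sup>2" using K(2) by (auto simp: dot_square_norm)
    then show "x \<in> annulus a b"
      using ab power2_less_imp_less[of a "norm x"] power2_less_imp_less[of "norm x" b] by (auto simp: annulus_def)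
  qed
  finally have cl: "closure {x::'a. W (x \<bullet> x) \<noteq> 0} \<subseteq> annulus a b" .
  then have "compact (closure {x::'a. W (x \<bullet> x) \<noteq> 0})"
    using bounded_subset[OF bounded_annulus] by (auto simp: compact_eq_bounded_closed)
  then show ?thesis
    using C_k_compose[OF _ C] W cl by (auto simp: test_functions_def)
qed

text \<open>The gradient of \<open>u\<close> is radial with absolute value |V'| \<tau>', so its flux
  is R(\<tau>) (\<tau>')^(p - 1) x / r. Here (\<tau>')^(p - 1) = \<kappa>^(p - 1) r^(1 - N), and the
  field r^(-N) x is divergence free away from the origin; therefore the divergence of the flux is
  (\<tau>')^p times R'(\<tau>) = - q(\<tau>) f(V(\<tau>)). The weight is q(\<tau>) = (\<tau>')^(-p),
  which leaves - f(u).\<close>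

lemma profile_annulus_solution:
  fixes a b :: real
  assumes p: "1 < p" and ab: "0 < a" "a < b" and qc: "continuous_on {0..1} q" and fc: "continuous_on UNIV f"
    and P: "Dirichlet_profile p q f \<alpha> C V R"
    and \<kappa>: "\<kappa> > 0" and \<tau>ab: "\<tau> a = 0" "\<tau> b = 1"
    and \<tau>: "\<And>r. r > 0 \<Longrightarrow> (\<tau> has_real_derivative \<kappa> * r powr (- ((real DIM('a::euclidean_space) - 1) / (p - 1)))) (at r)"
    and q\<tau>: "\<And>r. r \<in> {a..b} \<Longrightarrow> q (\<tau> r) = (\<kappa> * r powr (- ((real DIM('a) - 1) / (p - 1)))) powr (- p)"
  defines "u \<equiv> \<lambda>x::'a. V (\<tau> (norm x))"
  shows "p_laplace_weak_solution p (annulus a b) f u"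
    and "W1p_norm p (annulus a b) u \<le>
      ((\<alpha> powr p + (C powr (1 / (p - 1)) * (\<kappa> * a powr (- ((real DIM('a) - 1) / (p - 1))))) powr p) *
        measure lebesgue (annulus a b :: 'a set)) powr (1 / p)"
    and "continuous_on (annulus a b) u"
    and "(x :: 'a) \<in> annulus a b \<Longrightarrow> \<tau> (norm x) \<in> {0<..<1}"
    and "t \<in> {0<..<1} \<Longrightarrow> \<exists>x\<in>(annulus a b :: 'a set). \<tau> (norm x) = t"
proof -
  define N where "N = real DIM('a)"
  have N: "N \<ge> 1" using DIM_positive[where 'a='a] by (simp add: N_def Suc_le_eq)
  define \<sigma> where "\<sigma> = (N - 1) / (p - 1)"
  have \<sigma>: "\<sigma> \<ge> 0" using N p by (simp add: \<sigma>_def)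
  have \<sigma>p: "\<sigma> * (p - 1) = N - 1" using p by (simp add: \<sigma>_def)
  define \<tau>' where "\<tau>' r = \<kappa> * r powr (- \<sigma>)" for r
  have \<tau>_der: "(\<tau> has_real_derivative \<tau>' r) (at r)" if "r > 0" for r
    using \<tau>[OF that] by (simp add: \<tau>'_def \<sigma>_def N_def)
  have q_eq: "q (\<tau> r) = \<tau>' r powr (- p)" if "r \<in> {a..b}" for r
    using q\<tau>[OF that] by (simp add: \<tau>'_def \<sigma>_def N_def)
  have \<tau>'_pos: "\<tau>' r > 0" if "r > 0" for r using \<kappa> that by (simp add: \<tau>'_def)
  have \<tau>'_le: "\<tau>' r \<le> \<tau>' a" if "r \<ge> a" for r
    unfolding \<tau>'_def using \<kappa> ab that \<sigma> by (intro mult_left_mono powr_mono2') auto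
  have \<tau>_less: "\<tau> r < \<tau> s" if "0 < r" "r < s" for r s
    using that by (intro DERIV_pos_imp_increasing[OF that(2)]) (use \<tau>_der \<tau>'_pos that(1) less_le_trans in blast)
  have \<tau>01: "\<tau> r \<in> {0<..<1}" if "r \<in> {a<..<b}" for r
    using \<tau>_less[of a r] \<tau>_less[of r b] that ab \<tau>ab by auto
  have \<tau>01': "\<tau> r \<in> {0..1}" if "r \<in> {a..b}" for r
    using \<tau>01[of r] that \<tau>ab by (cases "r = a \<or> r = b") auto
  have \<tau>c: "continuous_on S \<tau>" if "S \<subseteq> {0<..}" for S
    by (rule continuous_at_imp_continuous_on) (use that \<tau>_der DERIV_isCont in blast)
  note D = Dirichlet_profileD[OF P]
  let ?\<Omega> = "annulus a b :: 'a set"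
  note op = open_annulus[of a b, where 'a = 'a] and bd = bounded_annulus[of a b, where 'a = 'a]
  have nx: "norm x \<in> {a<..<b}" "norm x > 0" if "x \<in> ?\<Omega>" for x
    using that ab by (auto simp: annulus_def)
  show "x \<in> ?\<Omega> \<Longrightarrow> \<tau> (norm x) \<in> {0<..<1}" using \<tau>01[OF nx(1)] by blast
  show "\<exists>x\<in>?\<Omega>. \<tau> (norm x) = t" if t: "t \<in> {0<..<1}"
  proof -
    obtain r where r: "a \<le> r" "r \<le> b" "\<tau> r = t"
    proof (rule exE[OF IVT'[of \<tau> a t b, OF _ _ _ \<tau>c]])
      show "{a..b} \<subseteq> {0<..}" using ab by auto
    qed (use \<tau>ab t ab that in auto)
    then have "r \<noteq> a" "r \<noteq> b" using \<tau>ab t by auto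
    obtain e :: 'a where "e \<in> Basis" by (meson nonempty_Basis ex_in_conv)
    then have "r *\<^sub>R e \<in> ?\<Omega>" "\<tau> (norm (r *\<^sub>R e)) = t"
      using r \<open>r \<noteq> a\<close> \<open>r \<noteq> b\<close> ab by (auto simp: annulus_def)
    then show ?thesis by blast
  qed
  define d where "d t = spow (1 / (p - 1)) (R t)" for t
  have dc: "continuous_on {0..1} d"
    unfolding d_def by (rule continuous_on_compose2[OF continuous_on_spow[of _ UNIV] D(2)]) (use p in auto)
  have dB: "\<bar>d t\<bar> \<le> C powr (1 / (p - 1))" if "t \<in> {0..1}" for t
    unfolding d_def using spow_bound[OF _ D(7)[OF that], of "1 / (p - 1)"] p by auto
  have der_norm: "(norm has_derivative (\<lambda>h. (x \<bullet> h) / norm x)) (at x)" if "x \<in> ?\<Omega>" for x :: 'a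
    using has_derivative_norm[of x] nx(2)[OF that] by (simp add: sgn_div_norm inner_commute divide_inverse mult.commute)
  have der_radial: "((\<lambda>x::'a. h (norm x)) has_derivative (\<lambda>k. h' * ((x \<bullet> k) / norm x))) (at x)"
    if "x \<in> ?\<Omega>" "(h has_real_derivative h') (at (norm x))" for x h h'
    using has_derivative_compose[OF der_norm[OF that(1)], of h "(*) h'"] that(2)
    by (simp add: has_field_derivative_def)
  have der_\<tau>: "((\<lambda>r. h (\<tau> r)) has_real_derivative h' * \<tau>' r) (at r)"
    if "r > 0" "(h has_real_derivative h') (at (\<tau> r))" for r h h'
    by (rule DERIV_chain2[OF that(2) \<tau>_der[OF that(1)]])
  define G where "G x = (d (\<tau> (norm x)) * \<tau>' (norm x) / norm x) *\<^sub>R x" for x :: 'a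
  have u: "(u has_derivative (\<lambda>h. G x \<bullet> h)) (at x)" if x: "x \<in> ?\<Omega>" for x
    using der_radial[OF x der_\<tau>[OF nx(2)[OF x] D(8)[OF \<tau>01[OF nx(1)[OF x]]]]]
    by (simp add: u_def G_def d_def)
  show uc: "continuous_on ?\<Omega> u"
    by (rule has_derivative_continuous_on) (use u in \<open>auto intro: has_derivative_at_withinI\<close>)
  have comp\<tau>: "continuous_on {a<..<b} (\<lambda>r. h (\<tau> r))" if "continuous_on {0..1} h" for h :: "real \<Rightarrow> real"
  proof (rule continuous_on_compose2[OF that \<tau>c])
    show "{a<..<b} \<subseteq> {0<..}" using ab by auto
    show "\<tau> ` {a<..<b} \<subseteq> {0..1}" using \<tau>01 by fastforce
  qed
  have \<tau>'c: "continuous_on {a<..<b} \<tau>'"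
    unfolding \<tau>'_def using ab by (intro continuous_intros) auto
  have Gc: "continuous_on ?\<Omega> G"
    unfolding G_def using nx(2)
    by (intro continuous_intros continuous_on_radial[of a b "\<lambda>r. d (\<tau> r)"] continuous_on_radial[OF \<tau>'c] comp\<tau> dc) auto
  have normG: "norm (G x) = \<bar>d (\<tau> (norm x))\<bar> * \<tau>' (norm x)" if x: "x \<in> ?\<Omega>" for x
    using nx(2)[OF x] \<tau>'_pos[OF nx(2)[OF x]] by (simp add: G_def abs_mult)
  have GB: "norm (G x) \<le> C powr (1 / (p - 1)) * \<tau>' a" if x: "x \<in> ?\<Omega>" for x
    unfolding normG[OF x] using nx[OF x] \<tau>01[OF nx(1)[OF x]] \<tau>'_pos[OF nx(2)[OF x]]
    by (intro mult_mono dB \<tau>'_le) auto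
  have uB: "\<bar>u x\<bar> \<le> \<alpha>" if x: "x \<in> ?\<Omega>" for x
    using D(5,6)[of "\<tau> (norm x)"] \<tau>01[OF nx(1)[OF x]] by (simp add: u_def)
  show "W1p_norm p ?\<Omega> u \<le> ((\<alpha> powr p + (C powr (1 / (p - 1)) * (\<kappa> * a powr (- ((real DIM('a) - 1) / (p - 1))))) powr p) *
        measure lebesgue ?\<Omega>) powr (1 / p)"
    using W1p_norm_le(1)[OF op bd _ u Gc uB GB, of p] p by (simp add: \<tau>'_def \<sigma>_def N_def)
  have uW: "u \<in> W1p_0 p ?\<Omega>"
  proof -
    \<comment> \<open>The approximation is carried out in s = |x|^2 and pulled back by the smooth
      map to \<open>x \<bullet> x\<close>; \<open>D2\<close> is the derivative in \<open>s\<close>,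
      whence the factor \<open>1 / (2 * sqrt s)\<close>.\<close>
    define V2 where "V2 s = V (\<tau> (sqrt s))" for s
    define D2 where "D2 s = d (\<tau> (sqrt s)) * \<tau>' (sqrt s) / (2 * sqrt s)" for s
    have a2b2: "a\<^sup>2 < b\<^sup>2" using ab by (simp add: power_strict_mono)
    have sq: "sqrt s \<in> {a..b}" if "s \<in> {a\<^sup>2..b\<^sup>2}" for s
      using that ab real_sqrt_le_mono[of "a\<^sup>2" s] real_sqrt_le_mono[of s "b\<^sup>2"] by auto
    have sq': "sqrt s \<in> {a<..<b}" if "s \<in> {a\<^sup>2<..<b\<^sup>2}" for s
      using that ab real_sqrt_less_mono[of "a\<^sup>2" s] real_sqrt_less_mono[of s "b\<^sup>2"] by auto
    have c2: "continuous_on {a\<^sup>2..b\<^sup>2} (\<lambda>s. h (\<tau> (sqrt s)))" if "continuous_on {0..1} h" for h :: "real \<Rightarrow> real"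
    proof (rule continuous_on_compose2[OF that])
      show "continuous_on {a\<^sup>2..b\<^sup>2} (\<lambda>s. \<tau> (sqrt s))"
        by (rule continuous_on_compose2[OF \<tau>c[of "{a..b}"]]) (use ab sq in \<open>auto intro!: continuous_intros\<close>)
    qed (use sq \<tau>01' in blast)
    have s_pos: "s > 0" if "s \<in> {a\<^sup>2..b\<^sup>2}" for s
      using that ab less_le_trans[of 0 "a\<^sup>2" s] by simp
    have D2c: "continuous_on {a\<^sup>2..b\<^sup>2} D2"
      unfolding D2_def \<tau>'_def using s_pos
      by (intro continuous_intros c2 dc) (auto simp: less_imp_neq[symmetric])
    have V2d: "(V2 has_real_derivative D2 s) (at s)" if s: "s \<in> {a\<^sup>2<..<b\<^sup>2}" for s
    proof -
      have s0: "s > 0" using s_pos[of s] s by auto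
      have 1: "(sqrt has_real_derivative inverse (sqrt s) / 2) (at s)" using s0 by (rule DERIV_real_sqrt)
      have 2: "((\<lambda>r. V (\<tau> r)) has_real_derivative spow (1 / (p - 1)) (R (\<tau> (sqrt s))) * \<tau>' (sqrt s)) (at (sqrt s))"
        by (rule der_\<tau>[OF _ D(8)[OF \<tau>01[OF sq'[OF s]]]]) (use s0 in simp)
      have "D2 s = spow (1 / (p - 1)) (R (\<tau> (sqrt s))) * \<tau>' (sqrt s) * (inverse (sqrt s) / 2)"
      proof -
        have "y / (2 * z) = y * (inverse z / 2)" for y z :: real by (simp add: field_simps)
        then show ?thesis unfolding D2_def d_def by blast
      qed
      then show ?thesis unfolding V2_def[abs_def] using DERIV_chain2[OF 2 1] by (simp only:)
    qed
    have V20: "V2 (a\<^sup>2) = 0" "V2 (b\<^sup>2) = 0" using ab \<tau>ab D(3,4) by (auto simp: V2_def)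
    obtain W W' K where W: "\<And>j::nat. W j \<in> test_functions {a\<^sup>2<..<b\<^sup>2}"
      "\<And>j s. (W j has_real_derivative W' j s) (at s)"
      "\<And>s. s \<in> {a\<^sup>2<..<b\<^sup>2} \<Longrightarrow> (\<lambda>j. W j s) \<longlonglongrightarrow> V2 s"
      "\<And>s. s \<in> {a\<^sup>2<..<b\<^sup>2} \<Longrightarrow> (\<lambda>j. W' j s) \<longlonglongrightarrow> D2 s"
      "\<And>j s. s \<in> {a\<^sup>2<..<b\<^sup>2} \<Longrightarrow> \<bar>W j s\<bar> \<le> K" "\<And>j s. s \<in> {a\<^sup>2<..<b\<^sup>2} \<Longrightarrow> \<bar>W' j s\<bar> \<le> K"
      by (rule test_function_approx[OF a2b2 c2[OF D(1), folded V2_def] D2c V2d V20]) (assumption, rule that)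
    have gW: "grad (\<lambda>x. W j (x \<bullet> x)) x = (2 * W' j (x \<bullet> x)) *\<^sub>R x" for j and x :: 'a
    proof (rule grad_eqI)
      have "((\<lambda>x::'a. x \<bullet> x) has_derivative (\<lambda>h. 2 * (x \<bullet> h))) (at x)"
        by (auto intro!: derivative_eq_intros simp: inner_commute)
      from has_derivative_compose[OF this, of "W j" "(*) (W' j (x \<bullet> x))"] W(2)[of j "x \<bullet> x"]
      show "((\<lambda>x. W j (x \<bullet> x)) has_derivative (\<lambda>h. (2 * W' j (x \<bullet> x)) *\<^sub>R x \<bullet> h)) (at x)"
        by (simp add: has_field_derivative_def mult_ac)
    qed
    have x2: "x \<bullet> x \<in> {a\<^sup>2<..<b\<^sup>2}" "sqrt (x \<bullet> x) = norm x" if "x \<in> ?\<Omega>" for x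
      using that ab by (auto simp: annulus_def dot_square_norm norm_eq_sqrt_inner[symmetric] intro: power_strict_mono)
    define K' where "K' = Max {\<bar>K\<bar>, 2 * \<bar>K\<bar> * b, \<alpha>, C powr (1 / (p - 1)) * \<tau>' a}"
    have K': "\<bar>K\<bar> \<le> K'" "2 * \<bar>K\<bar> * b \<le> K'" "\<alpha> \<le> K'" "C powr (1 / (p - 1)) * \<tau>' a \<le> K'"
      by (simp_all add: K'_def)
    show ?thesis
    proof (rule W1p_0_classical[OF op bd _ u Gc, of p K' "\<lambda>j x. W j (x \<bullet> x)"])
      show "0 < p" using p by simp
      show "(\<lambda>x. W j (x \<bullet> x)) \<in> test_functions ?\<Omega>" for j
        by (rule test_function_radial[OF ab W(1)])
      fix x :: 'a and j assume x: "x \<in> ?\<Omega>"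
      show "\<bar>u x\<bar> \<le> K'" "norm (G x) \<le> K'"
        using uB[OF x] GB[OF x] K' by auto
      show "\<bar>W j (x \<bullet> x)\<bar> \<le> K'" using W(5)[OF x2(1)[OF x], of j] K'(1) by simp
      have "norm (grad (\<lambda>x. W j (x \<bullet> x)) x) = 2 * \<bar>W' j (x \<bullet> x)\<bar> * norm x" by (simp add: gW abs_mult)
      also have "\<dots> \<le> 2 * \<bar>K\<bar> * b"
        using W(6)[OF x2(1)[OF x], of j] nx[OF x] by (intro mult_mono) auto
      finally show "norm (grad (\<lambda>x. W j (x \<bullet> x)) x) \<le> K'" using K'(2) by simp
      show "(\<lambda>j. W j (x \<bullet> x)) \<longlonglongrightarrow> u x"
        using W(3)[OF x2(1)[OF x]] x2(2)[OF x] by (simp add: u_def V2_def)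
      have "(\<lambda>j. (2 * W' j (x \<bullet> x)) *\<^sub>R x) \<longlonglongrightarrow> (2 * D2 (x \<bullet> x)) *\<^sub>R x"
        by (intro tendsto_intros W(4)[OF x2(1)[OF x]])
      also have "(2 * D2 (x \<bullet> x)) *\<^sub>R x = G x"
        unfolding D2_def x2(2)[OF x] G_def by simp
      finally show "(\<lambda>j. grad (\<lambda>x. W j (x \<bullet> x)) x) \<longlonglongrightarrow> G x" by (simp add: gW)
    qed
  qed
  \<comment> \<open>\<open>\<kappa> powr (p - 1) * r powr (1 - N)\<close> is
    \<open>\<tau>' r powr (p - 1)\<close>; the further factor 1 / r normalises the position vector.
    \<open>\<rho>'\<close> and \<open>X'\<close> are the derivatives given by the chain and product
    rules.\<close>
  define \<rho> where "\<rho> r = \<kappa> powr (p - 1) * r powr (- N) * R (\<tau> r)" for r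
  define \<rho>' where "\<rho>' r = \<kappa> powr (p - 1) * (- N * r powr (- N - 1) * R (\<tau> r)
    - r powr (- N) * (q (\<tau> r) * f (V (\<tau> r)) * \<tau>' r))" for r
  define X where "X x = \<rho> (norm x) *\<^sub>R x" for x :: 'a
  define X' where "X' x h = \<rho> (norm x) *\<^sub>R h + (\<rho>' (norm x) * ((x \<bullet> h) / norm x)) *\<^sub>R x" for x h :: 'a
  have \<rho>_der: "(\<rho> has_real_derivative \<rho>' r) (at r)" if r: "r \<in> {a<..<b}" for r
  proof -
    have r0: "r > 0" using r ab by auto
    have "((\<lambda>r. R (\<tau> r)) has_real_derivative - (q (\<tau> r) * f (V (\<tau> r))) * \<tau>' r) (at r)"
      by (rule der_\<tau>[OF r0 D(9)[OF \<tau>01[OF r]]])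
    moreover have "((\<lambda>r. r powr (- N)) has_real_derivative - N * r powr (- N - 1)) (at r)"
      using r0 by (rule has_real_derivative_powr)
    ultimately have "((\<lambda>r. \<kappa> powr (p - 1) * (r powr (- N) * R (\<tau> r))) has_real_derivative
        \<kappa> powr (p - 1) * (- N * r powr (- N - 1) * R (\<tau> r) + - (q (\<tau> r) * f (V (\<tau> r))) * \<tau>' r * r powr (- N))) (at r)"
      by (intro DERIV_cmult DERIV_mult)
    then show ?thesis
      unfolding \<rho>_def[abs_def] \<rho>'_def by (simp add: algebra_simps)
  qed
  have fVc: "continuous_on {0..1} (\<lambda>t. f (V t))"
    by (rule continuous_on_compose2[OF fc D(1)]) simp
  have \<rho>c: "continuous_on {a<..<b} \<rho>" and \<rho>'c: "continuous_on {a<..<b} \<rho>'"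
    unfolding \<rho>_def \<rho>'_def using ab
    by (intro continuous_intros comp\<tau>[OF D(2)] comp\<tau>[OF qc] comp\<tau>[OF fVc] \<tau>'c; auto)+
  obtain Kf where Kf: "\<And>t. t \<in> {0..1} \<Longrightarrow> \<bar>f (V t)\<bar> \<le> Kf"
    using compact_imp_bounded[OF compact_continuous_image[OF fVc compact_Icc]] unfolding bounded_iff by force
  have GX: "norm (G x) powr (p - 2) *\<^sub>R G x = X x" if x: "x \<in> ?\<Omega>" for x
  proof -
    let ?r = "norm x"
    let ?y = "d (\<tau> ?r) * \<tau>' ?r"
    have r: "?r > 0" by (rule nx(2)[OF x])
    have "norm (G x) powr (p - 2) *\<^sub>R G x = (\<bar>?y\<bar> powr (p - 2) * ?y / ?r) *\<^sub>R x"
      unfolding normG[OF x] using \<tau>'_pos[OF r] by (simp add: G_def abs_mult)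
    also have "\<bar>?y\<bar> powr (p - 2) * ?y = R (\<tau> ?r) * \<tau>' ?r powr (p - 1)"
      unfolding powr_times_eq_spow spow_mult[OF \<tau>'_pos[OF r]] d_def spow_inverse[OF p] ..
    also have "\<tau>' ?r powr (p - 1) = \<kappa> powr (p - 1) * ?r powr (1 - N)"
      using \<kappa> r \<sigma>p by (simp add: \<tau>'_def powr_mult powr_powr)
    also have "R (\<tau> ?r) * (\<kappa> powr (p - 1) * ?r powr (1 - N)) / ?r = \<rho> ?r"
      using r powr_add[of ?r "- N" 1] by (simp add: \<rho>_def)
    finally show ?thesis by (simp add: X_def)
  qed
  have XB: "norm (X x) \<le> (C powr (1 / (p - 1)) * \<tau>' a) powr (p - 1)" if x: "x \<in> ?\<Omega>" for x
  proof -
    have "norm (X x) = norm (G x) powr (p - 1)"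
      unfolding GX[OF x, symmetric] using powr_add[of "norm (G x)" "p - 2" 1]
      by (cases "G x = 0") simp_all
    also have "\<dots> \<le> (C powr (1 / (p - 1)) * \<tau>' a) powr (p - 1)"
      using GB[OF x] p by (intro powr_mono2) auto
    finally show ?thesis .
  qed
  define K where "K = max ((C powr (1 / (p - 1)) * \<tau>' a) powr (p - 1)) Kf"
  show "p_laplace_weak_solution p ?\<Omega> f u"
    unfolding p_laplace_weak_solution_def
  proof (intro conjI ballI uW)
    fix w assume w: "w \<in> W1p_0 p ?\<Omega>"
    have p1: "p \<ge> 1" using p by simp
    have XK: "norm (X x) \<le> K" if "x \<in> ?\<Omega>" for x
      using XB[OF that] by (simp add: K_def le_max_iff_disj)
    have Xd: "(X has_derivative X' x) (at x)" if x: "x \<in> ?\<Omega>" for x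
      using has_derivative_scaleR[OF der_radial[OF x \<rho>_der[OF nx(1)[OF x]]] has_derivative_ident]
      unfolding X_def[abs_def] X'_def by simp
    have X'c: "continuous_on ?\<Omega> (\<lambda>x. X' x i)" for i
      unfolding X'_def using nx(2)
      by (intro continuous_intros continuous_on_radial[OF \<rho>c] continuous_on_radial[OF \<rho>'c]) auto
    have fuc: "continuous_on ?\<Omega> (\<lambda>x. f (u x))"
      by (rule continuous_on_compose2[OF fc uc]) simp
    have fuK: "\<bar>f (u x)\<bar> \<le> K" if x: "x \<in> ?\<Omega>" for x
      using Kf[of "\<tau> (norm x)"] \<tau>01[OF nx(1)[OF x]] by (simp add: u_def K_def le_max_iff_disj)
    have div: "(\<Sum>i\<in>Basis. X' x i \<bullet> i) = - f (u x)" if x: "x \<in> ?\<Omega>" for x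
    proof -
      let ?r = "norm x"
      have r: "?r > 0" "?r \<in> {a..b}" using nx[OF x] by auto
      have "(\<Sum>i\<in>Basis. X' x i \<bullet> i) = (\<Sum>i\<in>Basis. \<rho> ?r + \<rho>' ?r / ?r * ((x \<bullet> i) * (x \<bullet> i)))"
        by (intro sum.cong) (auto simp: X'_def inner_add_left)
      also have "\<dots> = N * \<rho> ?r + \<rho>' ?r / ?r * (x \<bullet> x)"
        unfolding sum.distrib sum_distrib_left[symmetric] euclidean_inner[of x x] by (simp add: N_def)
      also have "\<rho>' ?r / ?r * (x \<bullet> x) = \<rho>' ?r * ?r"
        using r by (simp add: dot_square_norm power2_eq_square)
      \<comment> \<open>The two terms with the factor \<open>N\<close> cancel, and only the
        derivative of \<open>R (\<tau> r)\<close> remains.\<close>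
      also have "N * \<rho> ?r + \<rho>' ?r * ?r = - (\<kappa> powr (p - 1) * ?r powr (1 - N) * \<tau>' ?r * q (\<tau> ?r)) * f (u x)"
      proof -
        have "?r powr (- N - 1) * ?r = ?r powr (- N)" "?r powr (- N) * ?r = ?r powr (1 - N)"
          using r powr_add[of ?r "- N - 1" 1] powr_add[of ?r "- N" 1] by simp_all
        moreover have "N * (k * y * z) + k * (- N * x * z - y * (c * h * t)) * s = - (k * e * t * c) * h"
          if "x * s = y" "y * s = e" for x y z k c h t s e :: real
          unfolding that[symmetric] by (simp add: algebra_simps)
        ultimately show ?thesis unfolding \<rho>_def \<rho>'_def u_def by blast
      qed
      also have "\<kappa> powr (p - 1) * ?r powr (1 - N) * \<tau>' ?r * q (\<tau> ?r) = 1"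
      proof -
        have "\<kappa> powr (p - 1) * ?r powr (1 - N) = \<tau>' ?r powr (p - 1)"
          using \<kappa> r \<sigma>p by (simp add: \<tau>'_def powr_mult powr_powr)
        moreover have "\<tau>' ?r powr (p - 1) * \<tau>' ?r = \<tau>' ?r powr p"
          using \<tau>'_pos[OF r(1)] powr_add[of "\<tau>' ?r" "p - 1" 1] by simp
        ultimately show ?thesis
          unfolding q_eq[OF r(2)] using \<tau>'_pos[OF r(1)] by (simp add: powr_add[symmetric])
      qed
      finally show ?thesis by simp
    qed
    show "integrable (lebesgue_on ?\<Omega>) (\<lambda>x. f (u x) * w x)"
      by (rule weak_solution_classical(1)[OF op bd p1 u Gc GX XK Xd X'c fuc fuK div w])
    show "(LINT x|lebesgue_on ?\<Omega>. (norm (weak_gradient ?\<Omega> u x) powr (p - 2) *\<^sub>R weak_gradient ?\<Omega> u x)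
             \<bullet> weak_gradient ?\<Omega> w x) = (LINT x|lebesgue_on ?\<Omega>. f (u x) * w x)"
      by (rule weak_solution_classical(2)[OF op bd p1 u Gc GX XK Xd X'c fuc fuK div w])
  qed
qed

section \<open>Small solutions\<close>

lemma primitive_has_derivative:
  assumes "continuous_on UNIV f"
  shows "(primitive f has_real_derivative f y) (at y)"
proof -
  \<comment> \<open>The interval has both 0 and \<open>y\<close> in its interior, so the derivative
    within it is a two-sided one for either sign of \<open>y\<close>.\<close>
  define a b where "a = min 0 y - 1" and "b = max 0 y + 1"
  have "((\<lambda>u. LBINT t=ereal 0..ereal u. f t) has_vector_derivative f y) (at y within {a..b})"
    by (rule interval_integral_FTC2) (use assms in \<open>auto simp: a_def b_def intro: continuous_on_subset\<close>)
  moreover have "at y within {a..b} = at y"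
    by (rule at_within_Icc_at) (auto simp: a_def b_def)
  ultimately show ?thesis
    by (simp add: has_real_derivative_iff_has_vector_derivative primitive_def[abs_def] zero_ereal_def)
qed

lemma primitive_0 [simp]: "primitive f 0 = 0"
  by (simp add: primitive_def zero_ereal_def[symmetric])

lemma SUP_infdist_endpoints: "(SUP t\<in>{0<..<1}. infdist t {0, 1::real}) = 1 / 2"
proof (rule cSup_eq_maximum)
  have d: "infdist t {0, 1} = min t (1 - t)" if "t \<in> {0<..<1}" for t :: real
    using that by (simp add: infdist_def dist_real_def cInf_eq_Min)
  show "1 / 2 \<in> (\<lambda>t. infdist t {0, 1::real}) ` {0<..<1}"
    by (rule image_eqI[of _ _ "1 / 2"]) (auto simp: d)
  show "x \<le> 1 / 2" if "x \<in> (\<lambda>t. infdist t {0, 1::real}) ` {0<..<1}" for x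
    using that d by (auto simp: min_def)
qed

lemma sigma_const_lessD:
  assumes "q0 > 0" "sigma_const p q0 < c"
  obtains \<mu> where "0 < \<mu>" "\<mu> < 1" "1 / (q0 * \<mu> * (1 - \<mu>) powr (p - 1)) < c"
proof -
  have "bdd_below ((\<lambda>\<mu>. 1 / (q0 * \<mu> * (1 - \<mu>) powr (p - 1))) ` {0<..<1})"
    using assms(1) by (intro bdd_belowI2[of _ 0]) auto
  then show ?thesis
    using assms(2) that by (auto simp: sigma_const_def cINF_less_iff)
qed

text \<open>Height and flux are controlled separately: the height by a small barrier value \<gamma>
  with f(\<gamma>) \<le> 0, the flux by the smallness of f near 0. The lower bound on the upper
  limit supplies a trapezoid of height below \<gamma> with negative energy, which makes the solution
  nonzero.\<close>

lemma arbitrarily_small_profiles: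
  fixes f q :: "real \<Rightarrow> real" and \<alpha> \<beta> :: "nat \<Rightarrow> real"
  assumes p: "1 < p" and fc: "continuous_on UNIV f" and qc: "continuous_on {0..1} q" and q0: "q0 > 0"
    and f0: "f 0 = 0" and q: "\<forall>t\<in>{0..1}. q t \<ge> q0"
    and F: "(INF \<xi>\<in>{0..}. ereal (primitive f \<xi>)) \<ge> 0"
    and \<alpha>\<beta>: "\<forall>k. 0 < \<alpha> k \<and> 0 < \<beta> k \<and> \<alpha> k < \<beta> k" and \<beta>: "\<beta> \<longlonglongrightarrow> 0"
    and sup: "\<forall>k. (SUP \<xi>\<in>{\<alpha> k..\<beta> k}. f \<xi>) \<le> 0"
    and lim: "ereal (sigma_const p q0 / (p * (SUP t\<in>{0<..<1}. infdist t {0, 1::real}) powr p))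
           < Limsup (at_right 0) (\<lambda>\<xi>. ereal (primitive f \<xi> / \<xi> powr p))"
    and \<epsilon>: "\<epsilon> > 0"
  obtains V R \<gamma> C t where "Dirichlet_profile p q f \<gamma> C V R" "0 < \<gamma>" "\<gamma> < \<epsilon>" "0 \<le> C" "C \<le> \<epsilon>"
    "t \<in> {0<..<1}" "V t > 0"
proof -
  obtain Q where Q: "Q > 0" "\<And>t. t \<in> {0..1} \<Longrightarrow> \<bar>q t\<bar> \<le> Q"
  proof -
    obtain Q where "\<forall>t\<in>{0..1}. norm (q t) \<le> Q"
      using compact_imp_bounded[OF compact_continuous_image[OF qc compact_Icc]] by (auto simp: bounded_iff)
    then show ?thesis by (intro that[of "max Q 1"]) (auto simp: le_max_iff_disj)
  qed
  have "isCont f 0" using fc by (simp add: continuous_on_eq_continuous_at)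
  \<comment> \<open>The flux is bounded by the maximum of |q t * f y|. With |f| < \<epsilon> / Q
    near 0 this maximum is at most \<epsilon>, which becomes the constant \<open>C\<close>.\<close>
  then obtain \<delta> where \<delta>: "\<delta> > 0" "\<And>y. \<bar>y\<bar> < \<delta> \<Longrightarrow> \<bar>f y\<bar> < \<epsilon> / Q"
    using \<epsilon> Q(1) f0 unfolding continuous_at_eps_delta dist_real_def
    by (metis diff_zero divide_pos_pos)
  have "eventually (\<lambda>k. \<beta> k < min \<delta> \<epsilon>) sequentially"
    using \<delta>(1) \<epsilon> by (intro order_tendstoD(2)[OF \<beta>]) simp
  then obtain k where "\<beta> k < min \<delta> \<epsilon>" by (auto simp: eventually_sequentially)
  \<comment> \<open>As a point of \<open>{\<alpha> k..\<beta> k}\<close> it satisfies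
    \<open>f \<gamma> \<le> 0\<close>, and it is small because it lies below
    \<open>\<beta> k\<close>.\<close>
  define \<gamma> where "\<gamma> = \<alpha> k"
  have \<gamma>: "0 < \<gamma>" "\<gamma> < \<delta>" "\<gamma> < \<epsilon>"
    using \<alpha>\<beta>[rule_format, of k] \<open>\<beta> k < min \<delta> \<epsilon>\<close> by (auto simp: \<gamma>_def)
  have f\<gamma>: "f \<gamma> \<le> 0"
  proof -
    have "bdd_above (f ` {\<alpha> k..\<beta> k})"
      by (intro bounded_imp_bdd_above compact_imp_bounded compact_continuous_image continuous_on_subset[OF fc]) auto
    then have "f \<gamma> \<le> (SUP \<xi>\<in>{\<alpha> k..\<beta> k}. f \<xi>)"
      using \<alpha>\<beta>[rule_format, of k] by (intro cSUP_upper) (auto simp: \<gamma>_def)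
    then show ?thesis using sup by (meson order_trans)
  qed
  have Fpos: "primitive f y \<ge> 0" if "y \<ge> 0" for y
  proof -
    have "0 \<le> ereal (primitive f y)"
      using that by (intro order_trans[OF F] INF_lower) simp
    then show ?thesis by simp
  qed
  \<comment> \<open>A number \<open>c\<close> strictly inside the gap serves both sides: some
    \<open>\<mu>\<close> undercuts it in the infimum defining \<open>sigma_const\<close>, and some
    \<open>\<xi>\<close> below \<open>\<gamma>\<close> exceeds it in the quotient.\<close>
  from ereal_dense2[OF lim] obtain c where c: "sigma_const p q0 / (p * (1 / 2) powr p) < c"
    "ereal c < Limsup (at_right 0) (\<lambda>\<xi>. ereal (primitive f \<xi> / \<xi> powr p))"
    unfolding SUP_infdist_endpoints by auto
  have "sigma_const p q0 < c * (p * (1 / 2) powr p)"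
    using c(1) p by (simp add: divide_less_eq)
  then obtain \<mu> where \<mu>: "0 < \<mu>" "\<mu> < 1" "1 / (q0 * \<mu> * (1 - \<mu>) powr (p - 1)) < c * (p * (1 / 2) powr p)"
    using sigma_const_lessD[OF q0] by blast
  obtain \<xi> where \<xi>: "0 < \<xi>" "\<xi> < \<gamma>" "c < primitive f \<xi> / \<xi> powr p"
  proof (rule ccontr)
    assume "\<not> thesis"
    then have "\<forall>\<xi>. 0 < \<xi> \<and> \<xi> < \<gamma> \<longrightarrow> primitive f \<xi> / \<xi> powr p \<le> c" using that not_le by blast
    then have "eventually (\<lambda>\<xi>. ereal (primitive f \<xi> / \<xi> powr p) \<le> ereal c) (at_right 0)"
      using \<gamma>(1) by (auto simp: eventually_at_right_field)
    then have "Limsup (at_right 0) (\<lambda>\<xi>. ereal (primitive f \<xi> / \<xi> powr p)) \<le> ereal c"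
      by (rule Limsup_bounded)
    then show False using c(2) by simp
  qed
  have F\<xi>: "c * \<xi> powr p < primitive f \<xi>"
    using \<xi>(1,3) by (simp add: pos_less_divide_eq)
  \<comment> \<open>The length of one ramp, so that the plateau has length \<mu> = 1 - 2 l. With
    this choice the condition \<open>neg\<close> is the inequality satisfied by
    \<open>\<mu>\<close>, combined with \<open>F\<xi>\<close>.\<close>
  define l where "l = (1 - \<mu>) / 2"
  have l: "0 < l" "l < 1 / 2" using \<mu> by (auto simp: l_def)
  have neg: "2 * l * ((\<xi> / l) powr p / p) < (1 - 2 * l) * (q0 * primitive f \<xi>)"
  proof -
    have m: "(1 - \<mu>) powr p = (1 - \<mu>) powr (p - 1) * (1 - \<mu>)"
      using \<mu>(2) powr_add[of "1 - \<mu>" "p - 1" 1] by simp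
    have "2 * l * ((\<xi> / l) powr p / p) = \<xi> powr p * (1 / (1 - \<mu>) powr (p - 1)) / (p * (1 / 2) powr p)"
    proof -
      have "(\<xi> / l) powr p = \<xi> powr p / ((1 - \<mu>) powr p * (1 / 2) powr p)"
        using \<xi>(1) \<mu>(2) by (simp add: l_def powr_divide powr_mult)
      moreover have "x * (y / (z * x * h) / p) = y * (1 / z) / (p * h)" if "x \<noteq> 0" for x y z h :: real
        using that by simp
      moreover have "2 * l = 1 - \<mu>" by (simp add: l_def)
      ultimately show ?thesis
        unfolding m using \<mu>(2) by simp
    qed
    also have "\<dots> < \<xi> powr p * (q0 * \<mu> * c * (p * (1 / 2) powr p)) / (p * (1 / 2) powr p)"
    proof (intro divide_strict_right_mono mult_strict_left_mono)
      show "1 / (1 - \<mu>) powr (p - 1) < q0 * \<mu> * c * (p * (1 / 2) powr p)"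
        using \<mu> q0 by (simp add: field_simps)
    qed (use \<xi>(1) p in auto)
    also have "\<dots> = q0 * \<mu> * (c * \<xi> powr p)" using p by simp
    also have "\<dots> < q0 * \<mu> * primitive f \<xi>"
      using F\<xi> q0 \<mu> by (intro mult_strict_left_mono) auto
    also have "\<dots> = (1 - 2 * l) * (q0 * primitive f \<xi>)" by (simp add: l_def diff_divide_distrib)
    finally show ?thesis .
  qed
  have C: "\<bar>q t * f y\<bar> \<le> \<epsilon>" if "t \<in> {0..1}" "y \<in> {0..\<gamma>}" for t y
  proof -
    have "\<bar>f y\<bar> \<le> \<epsilon> / Q" using \<delta>(2)[of y] that \<gamma> by auto
    then have "\<bar>q t * f y\<bar> \<le> Q * (\<epsilon> / Q)"
      unfolding abs_mult using Q that by (intro mult_mono) auto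
    then show ?thesis using Q(1) by simp
  qed
  obtain V R where VR: "continuous_on {0..1} V" "continuous_on {0..1} R" "V 0 = 0" "V 1 = 0"
    "\<And>t. t \<in> {0..1} \<Longrightarrow> V t \<in> {0..\<gamma>}" "\<And>t. t \<in> {0..1} \<Longrightarrow> \<bar>R t\<bar> \<le> \<epsilon>"
    "\<And>t. t \<in> {0<..<1} \<Longrightarrow> (V has_real_derivative spow (1 / (p - 1)) (R t)) (at t)"
    "\<And>t. t \<in> {0<..<1} \<Longrightarrow> (R has_real_derivative - (q t * f (V t))) (at t)"
    "\<exists>t\<in>{0<..<1}. V t \<noteq> 0"
  proof (rule Dirichlet_solution_exists[OF p qc _ _ fc primitive_has_derivative[OF fc] primitive_0
        \<gamma>(1) f0 f\<gamma> C \<xi>(1) _ _ l neg])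
  qed (use q q0 \<xi>(2) Fpos in auto)
  from VR(9) obtain t where t: "t \<in> {0<..<1}" "V t \<noteq> 0" by blast
  then have "V t > 0" using VR(5)[of t] by force
  moreover have "Dirichlet_profile p q f \<gamma> \<epsilon> V R"
    unfolding Dirichlet_profile_def using VR(1-8) by blast
  ultimately show thesis using that \<gamma> \<epsilon> t(1) by (meson less_imp_le order_refl)
qed

text \<open>Profiles are kept apart by their heights: the next bound \<gamma> is taken below the
  positive value of the current profile at its witness point \<open>t\<close>, so all later profiles
  stay below that value on the whole interval. Bounding \<gamma> and C by 1 / (k + 1) as well sends
  both to 0.\<close>

lemma decreasing_profile_sequence:
  assumes small: "\<And>\<epsilon>. \<epsilon> > 0 \<Longrightarrow> \<exists>V R \<gamma> C t. Dirichlet_profile p q f \<gamma> C V R \<and>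
    0 < \<gamma> \<and> \<gamma> < \<epsilon> \<and> 0 \<le> C \<and> C \<le> \<epsilon> \<and> t \<in> {0<..<1} \<and> V t > 0"
  obtains V R :: "nat \<Rightarrow> real \<Rightarrow> real" and \<gamma> C t :: "nat \<Rightarrow> real"
  where "\<And>k. Dirichlet_profile p q f (\<gamma> k) (C k) (V k) (R k)" "\<gamma> \<longlonglongrightarrow> 0" "C \<longlonglongrightarrow> 0"
    "\<And>k. t k \<in> {0<..<1}" "\<And>k. V k (t k) > 0" "\<And>k l s. k < l \<Longrightarrow> s \<in> {0..1} \<Longrightarrow> V l s < V k (t k)"
proof -
  \<comment> \<open>A state collects profile, flux, height bound, flux bound and witness point;
    dependent choice then runs over states, with \<open>next_ok\<close> linking consecutive
    ones.\<close>
  define S where "S \<epsilon> x \<longleftrightarrow> (case x of (V, R, \<gamma>, C, t) \<Rightarrow> Dirichlet_profile p q f \<gamma> C V R \<and>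
    0 < \<gamma> \<and> \<gamma> < \<epsilon> \<and> 0 \<le> C \<and> C \<le> \<epsilon> \<and> t \<in> {0<..<1} \<and> V t > 0)" for \<epsilon> x
  have ex: "\<exists>x. S \<epsilon> x" if "\<epsilon> > 0" for \<epsilon>
    using small[OF that] unfolding S_def by fast
  define next_ok where "next_ok x y \<longleftrightarrow> (case x of (V, R, \<gamma>, C, t) \<Rightarrow> case y of (V', R', \<gamma>', C', t') \<Rightarrow>
    \<gamma>' < V t)" for x y :: "(real \<Rightarrow> real) \<times> (real \<Rightarrow> real) \<times> real \<times> real \<times> real"
  have "\<exists>X. \<forall>k. S (1 / (real k + 1)) (X k) \<and> next_ok (X k) (X (Suc k))"
  proof (rule dependent_nat_choice)
    show "\<exists>x. S (1 / (real 0 + 1)) x" by (rule ex) simp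
    fix x k assume x: "S (1 / (real k + 1)) x"
    obtain V R \<gamma> C t where xx: "x = (V, R, \<gamma>, C, t)" by (cases x)
    have "min (1 / (real (Suc k) + 1)) (V t) > 0" using x by (simp add: S_def xx)
    from ex[OF this] obtain y where y: "S (min (1 / (real (Suc k) + 1)) (V t)) y" by blast
    show "\<exists>y. S (1 / (real (Suc k) + 1)) y \<and> next_ok x y"
      using y by (intro exI[of _ y]) (auto simp: S_def next_ok_def xx)
  qed
  then obtain X where X: "\<And>k. S (1 / (real k + 1)) (X k)" "\<And>k. next_ok (X k) (X (Suc k))" by blast
  define V R \<gamma> C t where "V k = fst (X k)" and "R k = fst (snd (X k))" and "\<gamma> k = fst (snd (snd (X k)))"
    and "C k = fst (snd (snd (snd (X k))))" and "t k = snd (snd (snd (snd (X k))))" for k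
  note defs = V_def R_def \<gamma>_def C_def t_def
  have P: "Dirichlet_profile p q f (\<gamma> k) (C k) (V k) (R k)"
    and b: "0 < \<gamma> k" "\<gamma> k < 1 / (real k + 1)" "0 \<le> C k" "C k \<le> 1 / (real k + 1)"
    and t: "t k \<in> {0<..<1}" "V k (t k) > 0" for k
    using X(1)[of k] by (auto simp: S_def defs split: prod.splits)
  have n: "\<gamma> (Suc k) < V k (t k)" for k
    using X(2)[of k] by (auto simp: next_ok_def defs split: prod.splits)
  have le: "V k (t k) \<le> \<gamma> k" for k
    using Dirichlet_profileD(6)[OF P, of "t k" k] t(1)[of k] by auto
  have dec: "\<gamma> l \<le> \<gamma> k" if "k \<le> l" for k l
    using that by (rule lift_Suc_antimono_le[of \<gamma>, rotated]) (use n le in \<open>meson less_imp_le order_trans\<close>)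
  have z: "(\<lambda>k. 1 / (real k + 1)) \<longlonglongrightarrow> 0" by real_asymp
  show thesis
  proof (rule that[of \<gamma> C V R t, OF P])
    show "\<gamma> \<longlonglongrightarrow> 0"
      by (rule real_tendsto_sandwich[OF _ _ tendsto_const z]) (use b in \<open>auto intro!: always_eventually less_imp_le\<close>)
    show "C \<longlonglongrightarrow> 0"
      by (rule real_tendsto_sandwich[OF _ _ tendsto_const z]) (use b in \<open>auto intro!: always_eventually\<close>)
    show "V l s < V k (t k)" if "k < l" "s \<in> {0..1}" for k l s
      using Dirichlet_profileD(6)[OF P that(2), of l] dec[of "Suc k" l] n[of k] that(1) by simp
  qed (use t in auto)
qed

theorem theorem1p3:
  fixes p q0 :: real and f q :: "real \<Rightarrow> real" and \<alpha> \<beta> :: "nat \<Rightarrow> real"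
  assumes "1 < p" and "p \<le> real CARD('n::finite)"
    and "continuous_on UNIV f"
    and "continuous_on {0..1} q"
    and "q0 > 0"
    and "f 0 = 0"
    and "\<forall>t\<in>{0..1}. q t \<ge> q0"
    and "(INF \<xi>\<in>{0..}. ereal (primitive f \<xi>)) \<ge> 0"
    and "\<forall>k. 0 < \<alpha> k \<and> 0 < \<beta> k \<and> \<alpha> k < \<beta> k"
    and "\<beta> \<longlonglongrightarrow> 0"
    and "filterlim (\<lambda>k. \<beta> k / \<alpha> k) at_top sequentially"
    and "\<forall>k. (SUP \<xi>\<in>{\<alpha> k..\<beta> k}. f \<xi>) \<le> 0"
    and "ereal (sigma_const p q0 / (p * (SUP t\<in>{0<..<1}. infdist t {0, 1::real}) powr p))
           < Limsup (at_right 0) (\<lambda>\<xi>. ereal (primitive f \<xi> / \<xi> powr p))"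
    and "Limsup (at_right 0) (\<lambda>\<xi>. ereal (primitive f \<xi> / \<xi> powr p)) < \<infinity>"
  shows "(\<exists>v :: nat \<Rightarrow> real \<Rightarrow> real.
            (\<forall>k. ode_weak_solution p q f (v k) \<and>
                 (AE t in lebesgue_on {0<..<1}. v k t \<ge> 0) \<and>
                 \<not> (AE t in lebesgue_on {0<..<1}. v k t = 0)) \<and>
            (\<forall>k l. k \<noteq> l \<longrightarrow> \<not> (AE t in lebesgue_on {0<..<1}. v k t = v l t)) \<and>
            (\<lambda>k. ode_norm p (v k)) \<longlonglongrightarrow> 0)
       \<and> (\<forall>a b. 0 < a \<and> a < b \<and> (\<forall>t\<in>{0..1}. q t = annulus_weight CARD('n) p a b t) \<longrightarrow>
           (\<exists>u :: nat \<Rightarrow> real ^ 'n \<Rightarrow> real.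
            (\<forall>k. p_laplace_weak_solution p (annulus a b) f (u k) \<and>
                 (AE x in lebesgue_on (annulus a b). u k x \<ge> 0) \<and>
                 \<not> (AE x in lebesgue_on (annulus a b). u k x = 0)) \<and>
            (\<forall>k l. k \<noteq> l \<longrightarrow> \<not> (AE x in lebesgue_on (annulus a b). u k x = u l x)) \<and>
            (\<lambda>k. W1p_norm p (annulus a b) (u k)) \<longlonglongrightarrow> 0))"
proof -
  have "\<exists>V R \<gamma> C t. Dirichlet_profile p q f \<gamma> C V R \<and>
    0 < \<gamma> \<and> \<gamma> < \<epsilon> \<and> 0 \<le> C \<and> C \<le> \<epsilon> \<and> t \<in> {0<..<1} \<and> V t > 0" if "\<epsilon> > 0" for \<epsilon>
    using arbitrarily_small_profiles[OF assms(1,3,4,5,6,7,8,9,10,12,13) that] by metis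
  from decreasing_profile_sequence[OF this]
  obtain V R :: "nat \<Rightarrow> real \<Rightarrow> real" and \<gamma> C t :: "nat \<Rightarrow> real" where
    P: "\<And>k. Dirichlet_profile p q f (\<gamma> k) (C k) (V k) (R k)" and lim: "\<gamma> \<longlonglongrightarrow> 0" "C \<longlonglongrightarrow> 0"
    and t: "\<And>k. t k \<in> {0<..<1}" "\<And>k. V k (t k) > 0"
    and less: "\<And>k l s. k < l \<Longrightarrow> s \<in> {0..1} \<Longrightarrow> V l s < V k (t k)" by metis
  have p0: "p > 0" using assms(1) by simp
  have C0: "C k \<ge> 0" for k using Dirichlet_profileD(7)[OF P, of 0 k] by simp
  have \<gamma>0: "\<gamma> k \<ge> 0" for k using Dirichlet_profileD(5,6)[OF P, of 0 k] by simp
  have M_lim: "(\<lambda>k. C k powr (1 / (p - 1))) \<longlonglongrightarrow> 0"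
    using tendsto_powr'[OF lim(2) tendsto_const[of "1 / (p - 1)"]] C0 assms(1) by simp
  have ode: "\<exists>v :: nat \<Rightarrow> real \<Rightarrow> real.
            (\<forall>k. ode_weak_solution p q f (v k) \<and>
                 (AE t in lebesgue_on {0<..<1}. v k t \<ge> 0) \<and>
                 \<not> (AE t in lebesgue_on {0<..<1}. v k t = 0)) \<and>
            (\<forall>k l. k \<noteq> l \<longrightarrow> \<not> (AE t in lebesgue_on {0<..<1}. v k t = v l t)) \<and>
            (\<lambda>k. ode_norm p (v k)) \<longlonglongrightarrow> 0"
  proof (intro exI[of _ V] conjI allI impI)
    fix k
    have c: "continuous_on {0<..<1} (V k)" for k
      by (rule continuous_on_subset[OF Dirichlet_profileD(1)[OF P]]) auto
    show "ode_weak_solution p q f (V k)"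
      by (rule profile_ode_solution(1)[OF assms(1,4,3) P])
    show "AE t in lebesgue_on {0<..<1}. V k t \<ge> 0"
      using Dirichlet_profileD(5)[OF P] by (intro AE_I2) auto
    show "\<not> (AE t in lebesgue_on {0<..<1}. V k t = 0)"
      using continuous_AE_eq_imp_eq[OF _ c continuous_on_const[of _ 0] _ t(1), of k k] t(2)[of k] by auto
    \<comment> \<open>For \<open>k < l\<close> the two continuous functions differ at the witness
      point \<open>t k\<close>; the other order follows by symmetry.\<close>
    have ne: "\<not> (AE t in lebesgue_on {0<..<1}. V k t = V l t)" if "k < l" for k l
      using continuous_AE_eq_imp_eq[OF _ c c _ t(1), of k l k] less[OF that, of "t k"] t(1)[of k] by auto
    fix l assume "k \<noteq> l"
    then show "\<not> (AE t in lebesgue_on {0<..<1}. V k t = V l t)"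
      using ne[of k l] ne[of l k] by (auto simp: eq_commute nat_neq_iff)
  next
    show "(\<lambda>k. ode_norm p (V k)) \<longlonglongrightarrow> 0"
      by (rule real_tendsto_sandwich[OF _ _ tendsto_const M_lim])
        (use profile_ode_solution(2)[OF assms(1,4,3) P] in \<open>auto simp: ode_norm_def\<close>)
  qed
  moreover have "\<exists>u :: nat \<Rightarrow> real ^ 'n \<Rightarrow> real.
            (\<forall>k. p_laplace_weak_solution p (annulus a b) f (u k) \<and>
                 (AE x in lebesgue_on (annulus a b). u k x \<ge> 0) \<and>
                 \<not> (AE x in lebesgue_on (annulus a b). u k x = 0)) \<and>
            (\<forall>k l. k \<noteq> l \<longrightarrow> \<not> (AE x in lebesgue_on (annulus a b). u k x = u l x)) \<and>
            (\<lambda>k. W1p_norm p (annulus a b) (u k)) \<longlonglongrightarrow> 0"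
    if ab: "0 < a" "a < b" and qw: "\<forall>t\<in>{0..1}. q t = annulus_weight CARD('n) p a b t" for a b
  proof -
    obtain \<tau> \<kappa> where \<kappa>: "\<kappa> > 0" "\<tau> a = 0" "\<tau> b = 1"
      and \<tau>: "\<And>r. r > 0 \<Longrightarrow> (\<tau> has_real_derivative \<kappa> * r powr (- ((real CARD('n) - 1) / (p - 1)))) (at r)"
      and w: "\<And>r. r > 0 \<Longrightarrow> annulus_weight CARD('n) p a b (\<tau> r) = (\<kappa> * r powr (- ((real CARD('n) - 1) / (p - 1)))) powr (- p)"
      by (rule annulus_change_of_variables[OF assms(1,2) ab]) (rule that)
    \<comment> \<open>\<open>q\<close> is tied to the weight only on [0, 1], so the change of
      variables must be known to stay there.\<close>
    have \<tau>01: "\<tau> r \<in> {0..1}" if "r \<in> {a..b}" for r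
    proof -
      have "\<tau> r \<le> \<tau> s" if "0 < r" "r \<le> s" for r s
      proof (rule DERIV_nonneg_imp_nondecreasing[OF that(2)])
        fix x assume "r \<le> x"
        then show "\<exists>y. (\<tau> has_real_derivative y) (at x) \<and> 0 \<le> y"
          using \<tau>[of x] that(1) \<kappa>(1) by (intro exI conjI) auto
      qed
      from this[of a r] this[of r b] show ?thesis using that ab \<kappa> by auto
    qed
    have q\<tau>: "q (\<tau> r) = (\<kappa> * r powr (- ((real DIM(real ^ 'n) - 1) / (p - 1)))) powr (- p)"
      if "r \<in> {a..b}" for r
      using w[of r] qw \<tau>01[OF that] that ab by simp
    have \<tau>': "(\<tau> has_real_derivative \<kappa> * r powr (- ((real DIM(real ^ 'n) - 1) / (p - 1)))) (at r)" if "r > 0" for r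
      using \<tau>[OF that] by simp
    let ?\<Omega> = "annulus a b :: (real ^ 'n) set"
    let ?u = "\<lambda>k (x :: real ^ 'n). V k (\<tau> (norm x))"
    let ?T = "\<kappa> * a powr (- ((real DIM(real ^ 'n) - 1) / (p - 1)))"
    note A = profile_annulus_solution[where 'a = "real ^ 'n", OF assms(1) ab assms(4,3) P \<kappa> \<tau>' q\<tau>]
    have A1: "p_laplace_weak_solution p ?\<Omega> f (?u k)"
      and A2: "W1p_norm p ?\<Omega> (?u k) \<le>
        ((\<gamma> k powr p + (C k powr (1 / (p - 1)) * ?T) powr p) * measure lebesgue ?\<Omega>) powr (1 / p)"
      and A3: "continuous_on ?\<Omega> (?u k)" for k
      by (rule A; assumption)+
    have A4: "\<tau> (norm x) \<in> {0<..<1}" if "x \<in> ?\<Omega>" for x :: "real ^ 'n"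
      by (rule A(4)[OF _ _ that]; assumption)
    have A5: "\<exists>x\<in>?\<Omega>. \<tau> (norm x) = t k" for k
      by (rule A(5)[OF _ _ t(1)]; assumption)
    note op = open_annulus[of a b, where 'a = "real ^ 'n"]
    show ?thesis
    proof (intro exI[of _ ?u] conjI allI impI)
      fix k
      show "p_laplace_weak_solution p ?\<Omega> f (?u k)" by (rule A1)
      show "AE x in lebesgue_on ?\<Omega>. ?u k x \<ge> 0"
        using Dirichlet_profileD(5)[OF P] A4 by (intro AE_I2) force
      obtain x where x: "x \<in> ?\<Omega>" "\<tau> (norm x) = t k" using A5 by blast
      then show "\<not> (AE x in lebesgue_on ?\<Omega>. ?u k x = 0)"
        using continuous_AE_eq_imp_eq[OF op A3 continuous_on_const[of _ 0] _ x(1), of k] t(2)[of k] by auto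
      have ne: "\<not> (AE x in lebesgue_on ?\<Omega>. ?u k x = ?u l x)" if "k < l" for k l
      proof -
        obtain x where x: "x \<in> ?\<Omega>" "\<tau> (norm x) = t k" using A5 by blast
        then show ?thesis
          using continuous_AE_eq_imp_eq[OF op A3 A3 _ x(1), of k l] less[OF that, of "t k"] t(1)[of k] by auto
      qed
      fix l assume "k \<noteq> l"
      then show "\<not> (AE x in lebesgue_on ?\<Omega>. ?u k x = ?u l x)"
        using ne[of k l] ne[of l k] by (auto simp: eq_commute nat_neq_iff)
    next
      \<comment> \<open>In contrast to \<open>ode_norm\<close>, \<open>W1p_norm\<close> contains the
        function itself, so the heights \<gamma> must tend to 0 along with the flux bounds.\<close>
      have "(\<lambda>k. ((\<gamma> k powr p + (C k powr (1 / (p - 1)) * ?T) powr p) * measure lebesgue ?\<Omega>) powr (1 / p)) \<longlonglongrightarrow>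
          ((0 powr p + (0 * ?T) powr p) * measure lebesgue ?\<Omega>) powr (1 / p)"
        using p0 \<kappa>(1) ab \<gamma>0
        by (intro tendsto_powr' tendsto_mult tendsto_add tendsto_const lim M_lim)
          (auto intro!: always_eventually add_nonneg_nonneg mult_nonneg_nonneg)
      then have z: "(\<lambda>k. ((\<gamma> k powr p + (C k powr (1 / (p - 1)) * ?T) powr p) * measure lebesgue ?\<Omega>) powr (1 / p)) \<longlonglongrightarrow> 0"
        using p0 by simp
      show "(\<lambda>k. W1p_norm p ?\<Omega> (?u k)) \<longlonglongrightarrow> 0"
        by (rule real_tendsto_sandwich[OF _ _ tendsto_const z])
          (use A2 in \<open>auto simp: W1p_norm_def intro!: always_eventually\<close>)
    qed
  qed
  ultimately show ?thesis by blast
qed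

end
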